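(* Let $G$ be a cograph and $r \geq 2$. The following are equivalent: (1) $\Sigma_r(G)$ is vertex decomposable; (2) $\Sigma_r(G)$ is shellable; (3) $\Sigma_r(G)$ is Cohen–Macaulay (over a field $\mathbb K$); (4) $G$ is $r$-gap-free; (5) the clutter $\mathrm{Con}_r(G)$ is co-chordal.
   Context: Cographs are the graphs obtained from single-vertex graphs by finitely many disjoint unions and joins (the join $G_1*G_2$ adds all edges between $V(G_1)$ and $V(G_2)$). $\mathrm{Con}_r(G)$ is the $r$-uniform clutter on $V(G)$ whose circuits are the $r$-subsets $W$ with $G[W]$ connected; $\Sigma_r(G)$ is the simplicial complex generated by $V(G)\setminus W$ for such $W$. $G$ is $r$-gap-free if every induced matching of $\mathrm{Con}_r(G)$ (set of pairwise disjoint circuits $M$ such that the circuits contained in $\bigcup M$ are exactly those of $M$) has at most one element. For a $d$-uniform clutter $\mathcal H$: a clique is a vertex set all of whose $d$-subsets are circuits; $\mathcal N_{\mathcal H}[Z]=Z\cup\{x\notin Z: x\in\mathcal E\subseteq Z\cup\{x\}\text{ for some circuit }\mathcal E\}$; a $(d-1)$-subset $Z$ is a simplicial maximal subcircuit if $\mathcal N_{\mathcal H}[Z]$ is a clique; $\mathcal H\setminus_d Z$ keeps the circuits not containing $Z$; $\mathcal H$ is chordal if it has no circuits or has a simplicial maximal subcircuit $Z$ with $\mathcal H\setminus_d Z$ chordal; $\mathcal H$ is co-chordal if its complement (circuits = $d$-subsets not circuits of $\mathcal H$) is chordal. Vertex decomposable and shellable have their standard meanings (simplex/empty/void complex or a shedding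 vertex with vertex decomposable link and deletion; a facet order with each new facet meeting the previous ones in a pure codimension-one subcomplex). *)

theory Defs
  imports
    "HOL-Library.Poly_Mapping"
    "HOL-Library.Extended_Nat"
    "HOL-Algebra.Algebraic_Closure_Type"
begin

section \<open>Graphs and cographs\<close>

text \<open>A simple graph is given by its vertex set and its set of edges, an edge being the
  two-element set of its ends.\<close>

inductive cograph :: "'a set \<Rightarrow> 'a set set \<Rightarrow> bool" where
  single: "cograph {v} {}"
| disjoint_union:
    "\<lbrakk>cograph V\<^sub>1 E\<^sub>1; cograph V\<^sub>2 E\<^sub>2; V\<^sub>1 \<inter> V\<^sub>2 = {}\<rbrakk>
      \<Longrightarrow> cograph (V\<^sub>1 \<union> V\<^sub>2) (E\<^sub>1 \<union> E\<^sub>2)"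
| join:
    "\<lbrakk>cograph V\<^sub>1 E\<^sub>1; cograph V\<^sub>2 E\<^sub>2; V\<^sub>1 \<inter> V\<^sub>2 = {}\<rbrakk>
      \<Longrightarrow> cograph (V\<^sub>1 \<union> V\<^sub>2) (E\<^sub>1 \<union> E\<^sub>2 \<union> {{u, v} | u v. u \<in> V\<^sub>1 \<and> v \<in> V\<^sub>2})"

definition induced_connected :: "'a set set \<Rightarrow> 'a set \<Rightarrow> bool" where
  "induced_connected E W \<longleftrightarrow>
     W \<noteq> {} \<and>
     (\<forall>u\<in>W. \<forall>v\<in>W. (u, v) \<in> {(x, y). x \<in> W \<and> y \<in> W \<and> {x, y} \<in> E}\<^sup>*)"

definition Con :: "nat \<Rightarrow> 'a set \<Rightarrow> 'a set set \<Rightarrow> 'a set set" where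
  "Con r V E = {W. W \<subseteq> V \<and> card W = r \<and> induced_connected E W}"

text \<open>If \<open>Con r V E\<close> is empty, this is the void complex (not the complex whose only face is
  the empty set).\<close>

definition Sigma_complex :: "nat \<Rightarrow> 'a set \<Rightarrow> 'a set set \<Rightarrow> 'a set set" where
  "Sigma_complex r V E = {\<sigma>. \<exists>W\<in>Con r V E. \<sigma> \<subseteq> V - W}"

section \<open>Clutters\<close>

text \<open>A \<open>d\<close>-uniform clutter on \<open>V\<close> is given by its set of circuits, a set of \<open>d\<close>-subsets of
  \<open>V\<close>.\<close>

definition induced_matching :: "'a set set \<Rightarrow> 'a set set \<Rightarrow> bool" where
  "induced_matching C M \<longleftrightarrow> M \<subseteq> C \<and> disjoint M \<and> {c \<in> C. c \<subseteq> \<Union>M} = M"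

definition gap_free :: "nat \<Rightarrow> 'a set \<Rightarrow> 'a set set \<Rightarrow> bool" where
  "gap_free r V E \<longleftrightarrow> (\<forall>M. induced_matching (Con r V E) M \<longrightarrow> finite M \<and> card M \<le> 1)"

definition clutter_clique :: "nat \<Rightarrow> 'a set set \<Rightarrow> 'a set \<Rightarrow> bool" where
  "clutter_clique d C K \<longleftrightarrow> (\<forall>e. e \<subseteq> K \<and> card e = d \<longrightarrow> e \<in> C)"

definition closed_nbhd :: "'a set set \<Rightarrow> 'a set \<Rightarrow> 'a set" where
  "closed_nbhd C Z = Z \<union> {x. x \<notin> Z \<and> (\<exists>e\<in>C. x \<in> e \<and> e \<subseteq> insert x Z)}"

definition simplicial_subcircuit :: "nat \<Rightarrow> 'a set \<Rightarrow> 'a set set \<Rightarrow> 'a set \<Rightarrow> bool" where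
  "simplicial_subcircuit d V C Z \<longleftrightarrow>
     Z \<subseteq> V \<and> finite Z \<and> card Z + 1 = d \<and> clutter_clique d C (closed_nbhd C Z)"

inductive chordal_clutter :: "nat \<Rightarrow> 'a set \<Rightarrow> 'a set set \<Rightarrow> bool" for d V where
  no_circuits: "chordal_clutter d V {}"
| delete:
    "\<lbrakk>simplicial_subcircuit d V C Z; chordal_clutter d V {c \<in> C. \<not> Z \<subseteq> c}\<rbrakk>
      \<Longrightarrow> chordal_clutter d V C"

definition co_chordal :: "nat \<Rightarrow> 'a set \<Rightarrow> 'a set set \<Rightarrow> bool" where
  "co_chordal d V C \<longleftrightarrow> chordal_clutter d V {e. e \<subseteq> V \<and> card e = d \<and> e \<notin> C}"

section \<open>Simplicial complexes\<close>

text \<open>A simplicial complex is given by its set of faces, a subset-closed family of finite sets.\<close>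

definition facets :: "'a set set \<Rightarrow> 'a set set" where
  "facets \<Delta> = {F \<in> \<Delta>. \<forall>G\<in>\<Delta>. F \<subseteq> G \<longrightarrow> G = F}"

definition vertex_link :: "'a set set \<Rightarrow> 'a \<Rightarrow> 'a set set" where
  "vertex_link \<Delta> v = {\<sigma>. v \<notin> \<sigma> \<and> insert v \<sigma> \<in> \<Delta>}"

definition vertex_deletion :: "'a set set \<Rightarrow> 'a \<Rightarrow> 'a set set" where
  "vertex_deletion \<Delta> v = {\<sigma> \<in> \<Delta>. v \<notin> \<sigma>}"

definition shedding_vertex :: "'a set set \<Rightarrow> 'a \<Rightarrow> bool" where
  "shedding_vertex \<Delta> v \<longleftrightarrow>
     {v} \<in> \<Delta> \<and> (\<forall>\<sigma>\<in>vertex_link \<Delta> v. \<sigma> \<notin> facets (vertex_deletion \<Delta> v))"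

inductive vertex_decomposable :: "'a set set \<Rightarrow> bool" where
  void: "vertex_decomposable {}"
| simplex: "finite F \<Longrightarrow> vertex_decomposable (Pow F)"
    \<comment> \<open>includes the complex whose only face is the empty set\<close>
| shed:
    "\<lbrakk>shedding_vertex \<Delta> v; vertex_decomposable (vertex_link \<Delta> v);
      vertex_decomposable (vertex_deletion \<Delta> v)\<rbrakk>
      \<Longrightarrow> vertex_decomposable \<Delta>"

definition shellable :: "'a set set \<Rightarrow> bool" where
  "shellable \<Delta> \<longleftrightarrow>
     (\<exists>Fs. distinct Fs \<and> set Fs = facets \<Delta> \<and>
       (\<forall>i<length Fs. 0 < i \<longrightarrow>
         (\<forall>\<sigma>\<in>facets (Pow (Fs ! i) \<inter> (\<Union>j<i. Pow (Fs ! j))). card \<sigma> + 1 = card (Fs ! i))))"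

section \<open>Cohen--Macaulay complexes\<close>

definition krull_dim :: "('a, 'b) ring_scheme \<Rightarrow> enat" where
  "krull_dim R = Sup {enat n | n.
     \<exists>P. (\<forall>i\<le>n. primeideal (P i) R) \<and> (\<forall>i<n. P i \<subset> P (Suc i))}"

definition regular_sequence :: "('a, 'b) ring_scheme \<Rightarrow> 'a list \<Rightarrow> bool" where
  "regular_sequence R xs \<longleftrightarrow>
     set xs \<subseteq> carrier R \<and>
     (\<forall>i<length xs. \<forall>a\<in>carrier R.
        xs ! i \<otimes>\<^bsub>R\<^esub> a \<in> genideal R (set (take i xs)) \<longrightarrow> a \<in> genideal R (set (take i xs))) \<and>
     genideal R (set xs) \<noteq> carrier R"

text \<open>The type \<open>('a \<Rightarrow>\<^sub>0 nat) \<Rightarrow>\<^sub>0 'k\<close> is the polynomial ring over \<open>'k\<close> with one variable for each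
  element of \<open>'a\<close>: exponent vectors are finitely supported maps to \<open>nat\<close>, polynomials finitely
  supported maps from exponent vectors to coefficients.\<close>

definition poly_var :: "'a \<Rightarrow> ('a \<Rightarrow>\<^sub>0 nat) \<Rightarrow>\<^sub>0 'k::field" where
  "poly_var v = Poly_Mapping.single (Poly_Mapping.single v 1) 1"

definition homogeneous :: "nat \<Rightarrow> (('a \<Rightarrow>\<^sub>0 nat) \<Rightarrow>\<^sub>0 'k::field) \<Rightarrow> bool" where
  "homogeneous n p \<longleftrightarrow>
     (\<forall>m\<in>Poly_Mapping.keys p. (\<Sum>v\<in>Poly_Mapping.keys m. Poly_Mapping.lookup m v) = n)"

text \<open>Every finite non-face contributes a generator. In particular, the variables that are not
  vertices of \<open>\<Delta>\<close> lie in the ideal, so that the quotient below is the usual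
  Stanley--Reisner ring, whatever set of variables containing the vertices of \<open>\<Delta>\<close> one starts
  from.\<close>

definition stanley_reisner_ideal :: "'a set set \<Rightarrow> (('a \<Rightarrow>\<^sub>0 nat) \<Rightarrow>\<^sub>0 'k::field) set" where
  "stanley_reisner_ideal \<Delta> =
     genideal ring_of_type_algebra {\<Prod>v\<in>\<tau>. poly_var v | \<tau>. finite \<tau> \<and> \<tau> \<notin> \<Delta>}"

definition stanley_reisner_ring :: "'a set set \<Rightarrow> (('a \<Rightarrow>\<^sub>0 nat) \<Rightarrow>\<^sub>0 'k::field) set ring" where
  "stanley_reisner_ring \<Delta> = ring_of_type_algebra Quot stanley_reisner_ideal \<Delta>"

definition sr_class :: "'a set set \<Rightarrow> (('a \<Rightarrow>\<^sub>0 nat) \<Rightarrow>\<^sub>0 'k::field) \<Rightarrow> (('a \<Rightarrow>\<^sub>0 nat) \<Rightarrow>\<^sub>0 'k) set" where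
  "sr_class \<Delta> p = stanley_reisner_ideal \<Delta> +>\<^bsub>ring_of_type_algebra\<^esub> p"

text \<open>The depth of a standard graded algebra is the maximal length of a regular sequence of
  homogeneous elements of its irrelevant maximal ideal, that is, of homogeneous elements of
  positive degree.\<close>

definition stanley_reisner_depth :: "'k::field itself \<Rightarrow> 'a set set \<Rightarrow> enat" where
  "stanley_reisner_depth K \<Delta> = Sup {enat (length xs) | xs.
     regular_sequence (stanley_reisner_ring \<Delta> :: (('a \<Rightarrow>\<^sub>0 nat) \<Rightarrow>\<^sub>0 'k) set ring) xs \<and>
     (\<forall>x\<in>set xs. \<exists>n p. 0 < n \<and> homogeneous n p \<and> x = sr_class \<Delta> p)}"

text \<open>The Stanley--Reisner ring of the void complex is the zero ring. It has neither prime ideals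
  nor regular sequences, both suprema are \<open>0\<close>, and the void complex is Cohen--Macaulay, in
  accordance with the convention that the zero module is.\<close>

definition cohen_macaulay :: "'k::field itself \<Rightarrow> 'a set set \<Rightarrow> bool" where
  "cohen_macaulay K \<Delta> \<longleftrightarrow>
     stanley_reisner_depth K \<Delta> =
     krull_dim (stanley_reisner_ring \<Delta> :: (('a \<Rightarrow>\<^sub>0 nat) \<Rightarrow>\<^sub>0 'k) set ring)"

end

theory Submission
  imports Defs
begin

text \<open>In a join, any vertex of one side can be exchanged into every circuit that meets the other
  side. Hence the vertices of a gap-free cograph can be shed one at a time until no connected
  \<open>r\<close>-subset remains: in a disjoint union only one part carries circuits, and in a join one empties
  the first side and then the second. Contracting a shed vertex \<open>v\<close> leaves the sets that are
  connected together with \<open>v\<close>, which are dismantled in the same way. Such an elimination gives a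
  vertex decomposition, a shelling, a chordal elimination of the complementary clutter, and, through
  the exact sequences \<open>0 \<rightarrow> S/(I : x) \<rightarrow> S/I \<rightarrow> S/(I + (x)) \<rightarrow> 0\<close>, the regularity of the elementary
  symmetric polynomials on the Stanley--Reisner ring.

  If \<open>G\<close> is not gap-free, two disjoint circuits \<open>W\<^sub>1\<close>, \<open>W\<^sub>2\<close> are the only circuits inside their union.
  The link of \<open>V - (W\<^sub>1 \<union> W\<^sub>2)\<close> then consists of two disjoint simplices of positive dimension. This
  contradicts vertex decomposability and shellability, the induced clutter on \<open>W\<^sub>1 \<union> W\<^sub>2\<close> has no
  simplicial subcircuit, and the disconnected link produces a nonzero Koszul cohomology class in
  degree \<open>card V - 2 * r + 1 < card V - r\<close>, below the dimension. The dimension itself is controlled by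
  counting monomials supported on faces.\<close>

section \<open>Vertex splittable clutters\<close>

text \<open>All four positive conclusions recurse on deletion and contraction of one vertex, hence
  the single notion \<open>splittable\<close>. Its exchange clause says that every circuit avoiding
  \<open>v\<close> contains a circuit of the contraction, the dual form of the shedding condition.

  Depth is treated from its bare definition, over a field that may be finite. A linear system of
  parameters need not exist there, and one chosen for a given complex need not suit the smaller
  complexes of the recursion. Elementary symmetric polynomials of the whole vertex set depend on the
  complex only through their number, so one sequence serves both outer terms of the exact sequence.

  For the upper bound, a Koszul complex on the variables is too coarse: the class of the
  disconnected link lives in local cohomology, in multidegree -1 at each vertex of
  \<open>V - (W\<^sub>1 \<union> W\<^sub>2)\<close>. It becomes visible over the squares, as x_t /
  x_t^2. Regular sequences are therefore raised to powers until they lie in the ideal of the squares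
  modulo the face ideal.\<close>

text \<open>A clutter is encoded without its vertex set, and the vertex operations on complexes are
  reused: for a family \<open>C\<close> of circuits, \<open>vertex_deletion C v\<close> and \<open>vertex_link C v\<close> are the
  deletion and the contraction of \<open>v\<close>. The complex of the complements of the circuits in \<open>U\<close>
  is the Alexander dual side of the picture, on which link and deletion change places.\<close>

inductive splittable :: "nat \<Rightarrow> 'a set set \<Rightarrow> bool" where
  empty: "splittable d {}"
| unit: "splittable 0 {{}}"
| shed:
    "\<lbrakk>\<forall>c\<in>C. v \<notin> c \<longrightarrow> (\<exists>u\<in>c. insert v (c - {u}) \<in> C);
      splittable (Suc d) (vertex_deletion C v); splittable d (vertex_link C v)\<rbrakk>
      \<Longrightarrow> splittable (Suc d) C"

definition cocomplex :: "'a set \<Rightarrow> 'a set set \<Rightarrow> 'a set set" where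
  "cocomplex U C = {\<sigma>. \<exists>c\<in>C. \<sigma> \<subseteq> U - c}"

lemma Sigma_complex_eq_cocomplex: "Sigma_complex r V E = cocomplex V (Con r V E)"
  by (simp add: Sigma_complex_def cocomplex_def)

lemma splittable_uniform:
  assumes "splittable d C" "c \<in> C"
  shows "finite c \<and> card c = d"
  using assms
proof (induction arbitrary: c)
  case (shed C v d)
  show ?case
  proof (cases "v \<in> c")
    case True
    then have "c - {v} \<in> vertex_link C v"
      using shed.prems by (simp add: vertex_link_def insert_absorb)
    then have "finite (c - {v}) \<and> card (c - {v}) = d"
      by (rule shed.IH)
    then show ?thesis
      using True card_Suc_Diff1[of c v] by simp
  next
    case False
    then show ?thesis
      using shed.prems shed.IH(1) by (simp add: vertex_deletion_def)
  qed
qed auto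

lemma vertex_link_cocomplex:
  "v \<in> U \<Longrightarrow> vertex_link (cocomplex U C) v = cocomplex (U - {v}) (vertex_deletion C v)"
  by (auto simp: vertex_link_def cocomplex_def vertex_deletion_def)

text \<open>Faces below \<open>U - c\<close> with \<open>v \<in> c\<close> already have the right
  form. If \<open>v \<notin> c\<close>, the exchange supplies the circuit \<open>c - {u}\<close> of
  the contraction inside \<open>c\<close>, and away from \<open>v\<close> its complement is only
  larger.\<close>

lemma vertex_deletion_cocomplex:
  assumes "\<forall>c\<in>C. v \<notin> c \<longrightarrow> (\<exists>u\<in>c. insert v (c - {u}) \<in> C)"
  shows "vertex_deletion (cocomplex U C) v = cocomplex (U - {v}) (vertex_link C v)"
proof
  show "vertex_deletion (cocomplex U C) v \<subseteq> cocomplex (U - {v}) (vertex_link C v)"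
  proof
    fix \<sigma> assume "\<sigma> \<in> vertex_deletion (cocomplex U C) v"
    then obtain c where c: "c \<in> C" "\<sigma> \<subseteq> U - c" "v \<notin> \<sigma>"
      by (auto simp: vertex_deletion_def cocomplex_def)
    show "\<sigma> \<in> cocomplex (U - {v}) (vertex_link C v)"
    proof (cases "v \<in> c")
      case True
      then have "c - {v} \<in> vertex_link C v"
        using c by (simp add: vertex_link_def insert_absorb)
      moreover have "\<sigma> \<subseteq> U - {v} - (c - {v})"
        using c by blast
      ultimately show ?thesis
        unfolding cocomplex_def by blast
    next
      case False
      then obtain u where "u \<in> c" "insert v (c - {u}) \<in> C"
        using assms c by blast
      then have "c - {u} \<in> vertex_link C v"
        using False by (simp add: vertex_link_def)
      moreover have "\<sigma> \<subseteq> U - {v} - (c - {u})"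
        using c by blast
      ultimately show ?thesis
        unfolding cocomplex_def by blast
    qed
  qed
  show "cocomplex (U - {v}) (vertex_link C v) \<subseteq> vertex_deletion (cocomplex U C) v"
  proof
    fix \<sigma> assume "\<sigma> \<in> cocomplex (U - {v}) (vertex_link C v)"
    then obtain c where "insert v c \<in> C" "\<sigma> \<subseteq> U - insert v c"
      by (auto simp: cocomplex_def vertex_link_def)
    then show "\<sigma> \<in> vertex_deletion (cocomplex U C) v"
      unfolding vertex_deletion_def cocomplex_def by blast
  qed
qed

text \<open>The degenerate case of a shed: a \<open>v\<close> in every circuit lies in no face, so
  it is no shedding vertex and is dropped from the ground set instead.\<close>

lemma cocomplex_vertex_link:
  assumes "vertex_deletion C v = {}"
  shows "cocomplex U C = cocomplex (U - {v}) (vertex_link C v)"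
proof
  have v: "v \<in> c" if "c \<in> C" for c
    using assms that by (auto simp: vertex_deletion_def)
  have "c - {v} \<in> vertex_link C v" if "c \<in> C" for c
    using that v by (simp add: vertex_link_def insert_absorb)
  moreover have "U - c \<subseteq> U - {v} - (c - {v})" if "c \<in> C" for c
    using v[OF that] by blast
  ultimately show "cocomplex U C \<subseteq> cocomplex (U - {v}) (vertex_link C v)"
    unfolding cocomplex_def by (smt (verit) mem_Collect_eq subset_iff)
  show "cocomplex (U - {v}) (vertex_link C v) \<subseteq> cocomplex U C"
    by (auto simp: cocomplex_def vertex_link_def; blast)
qed

lemma shed_in_Union:
  assumes "\<forall>c\<in>C. v \<notin> c \<longrightarrow> (\<exists>u\<in>c. insert v (c - {u}) \<in> C)" "C \<noteq> {}"
  shows "v \<in> \<Union>C"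
  using assms by blast

lemma Union_vertex_deletion_subset: "\<Union>C \<subseteq> U \<Longrightarrow> \<Union>(vertex_deletion C v) \<subseteq> U - {v}"
  by (auto simp: vertex_deletion_def)

lemma Union_vertex_link_subset: "\<Union>C \<subseteq> U \<Longrightarrow> \<Union>(vertex_link C v) \<subseteq> U - {v}"
  by (auto simp: vertex_link_def)

theorem splittable_imp_vertex_decomposable:
  assumes "splittable d C" "finite U" "\<Union>C \<subseteq> U"
  shows "vertex_decomposable (cocomplex U C)"
  using assms
proof (induction arbitrary: U)
  case (empty d)
  then show ?case
    by (simp add: cocomplex_def vertex_decomposable.void)
next
  case unit
  have "cocomplex U {{}} = Pow U"
    by (auto simp: cocomplex_def)
  then show ?case
    using unit by (simp add: vertex_decomposable.simplex)
next
  case (shed C v d)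
  show ?case
  proof (cases "C = {}")
    case True
    then show ?thesis
      by (simp add: cocomplex_def vertex_decomposable.void)
  next
    case False
    then have v: "v \<in> U"
      using shed_in_Union[OF shed.hyps(1)] shed.prems by blast
    have del: "vertex_decomposable (cocomplex (U - {v}) (vertex_deletion C v))"
      using shed.prems by (intro shed.IH(1) Union_vertex_deletion_subset) auto
    have link: "vertex_decomposable (cocomplex (U - {v}) (vertex_link C v))"
      using shed.prems by (intro shed.IH(2) Union_vertex_link_subset) auto
    show ?thesis
    proof (cases "vertex_deletion C v = {}")
      case True
      then show ?thesis
        using link cocomplex_vertex_link by metis
    next
      case nonempty: False
      have "shedding_vertex (cocomplex U C) v"
        unfolding shedding_vertex_def
      proof (intro conjI ballI)
        show "{v} \<in> cocomplex U C"
          using nonempty v by (auto simp: cocomplex_def vertex_deletion_def)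
      next
        fix \<sigma> assume "\<sigma> \<in> vertex_link (cocomplex U C) v"
        then obtain c where c: "c \<in> C" "v \<notin> c" "v \<notin> \<sigma>" "\<sigma> \<subseteq> U - c"
          by (auto simp: vertex_link_def cocomplex_def)
        then obtain u where u: "u \<in> c" "insert v (c - {u}) \<in> C"
          using shed.hyps(1) by blast
        \<comment> \<open>The vertex \<open>u\<close> given up in the exchange can be added to
          \<open>\<sigma>\<close>, so \<open>\<sigma>\<close> is not maximal in the
          deletion.\<close>
        then have "insert u \<sigma> \<in> vertex_deletion (cocomplex U C) v"
          using c shed.prems by (auto simp: vertex_deletion_def cocomplex_def intro!: bexI[OF _ u(2)])
        moreover have "u \<notin> \<sigma>"
          using c u by auto
        ultimately show "\<sigma> \<notin> facets (vertex_deletion (cocomplex U C) v)"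
          by (auto simp: facets_def dest!: bspec)
      qed
      then show ?thesis
      proof (rule vertex_decomposable.shed)
        show "vertex_decomposable (vertex_link (cocomplex U C) v)"
          using del by (simp only: vertex_link_cocomplex[OF v])
        show "vertex_decomposable (vertex_deletion (cocomplex U C) v)"
          using link by (simp only: vertex_deletion_cocomplex[OF shed.hyps(1)])
      qed
    qed
  qed
qed

section \<open>Shellings from linear quotients\<close>

text \<open>In such an order the squarefree monomials of the circuits have linear quotients;
  complements turn it into a shelling order.\<close>

definition linear_quotients :: "'a set list \<Rightarrow> bool" where
  "linear_quotients cs \<longleftrightarrow>
     (\<forall>i<length cs. \<forall>j<i. \<exists>k<i. \<exists>w. cs ! k - cs ! i = {w} \<and> w \<in> cs ! j)"

lemma linear_quotientsE:
  assumes "linear_quotients cs" "i < length cs" "j < i"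
  obtains k w where "k < i" "cs ! k - cs ! i = {w}" "w \<in> cs ! j"
  using assms unfolding linear_quotients_def by blast

text \<open>The circuits through \<open>v\<close> go first, in the order of the contraction. For a
  later circuit \<open>c\<close> without \<open>v\<close>, the exchange
  \<open>insert v (c - {u})\<close> comes earlier and adds only \<open>v\<close>, which lies in
  every circuit of the first block.\<close>

lemma splittable_imp_linear_quotients:
  assumes "splittable d C"
  shows "\<exists>cs. distinct cs \<and> set cs = C \<and> linear_quotients cs"
  using assms
proof induction
  case (empty d)
  then show ?case
    by (intro exI[of _ "[]"]) (simp add: linear_quotients_def)
next
  case unit
  then show ?case
    by (intro exI[of _ "[{}]"]) (simp add: linear_quotients_def)
next
  case (shed C v d)
  obtain as where as: "distinct as" "set as = vertex_deletion C v" "linear_quotients as"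
    using shed.IH by blast
  obtain bs where bs: "distinct bs" "set bs = vertex_link C v" "linear_quotients bs"
    using shed.IH by blast
  define bs' where "bs' = map (insert v) bs"
  have v: "v \<notin> b" if "b \<in> set bs" for b
    using that bs by (simp add: vertex_link_def)
  have "inj_on (insert v) (set bs)"
    using v by (metis inj_onI insert_ident)
  then have dist': "distinct bs'"
    using bs by (simp add: bs'_def distinct_map)
  have set': "set bs' = {c \<in> C. v \<in> c}"
  proof
    show "set bs' \<subseteq> {c \<in> C. v \<in> c}"
      using bs(2) by (auto simp: bs'_def vertex_link_def)
    have "c = insert v (c - {v}) \<and> c - {v} \<in> set bs" if "c \<in> C" "v \<in> c" for c
      using that bs(2) by (auto simp: vertex_link_def insert_absorb)
    then show "{c \<in> C. v \<in> c} \<subseteq> set bs'"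
      unfolding bs'_def set_map by blast
  qed
  have "linear_quotients (bs' @ as)"
    unfolding linear_quotients_def
  proof (intro allI impI)
    fix i j assume i: "i < length (bs' @ as)" and j: "j < i"
    show "\<exists>k<i. \<exists>w. (bs' @ as) ! k - (bs' @ as) ! i = {w} \<and> w \<in> (bs' @ as) ! j"
    proof (cases "i < length bs")
      case True
      then obtain k w where kw: "k < i" "bs ! k - bs ! i = {w}" "w \<in> bs ! j"
        using linear_quotientsE[OF bs(3) True j] by blast
      then have "insert v (bs ! k) - insert v (bs ! i) = {w}"
        using v True by (metis Diff_insert0 insert_Diff_if insertI1 less_trans nth_mem Diff_insert_absorb insert_Diff1)
      then show ?thesis
        using kw True j by (intro exI[of _ k]) (auto simp: nth_append bs'_def)
    next
      case False
      define i' where "i' = i - length bs"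
      have i': "i' < length as" "(bs' @ as) ! i = as ! i'"
        using False i by (auto simp: nth_append bs'_def i'_def)
      show ?thesis
      proof (cases "j < length bs")
        case True
        have c: "as ! i' \<in> C" "v \<notin> as ! i'"
          using i' as(2) nth_mem[of i' as] by (auto simp: vertex_deletion_def)
        then obtain u where u: "u \<in> as ! i'" "insert v (as ! i' - {u}) \<in> C"
          using shed.hyps(1) by blast
        then have "insert v (as ! i' - {u}) \<in> set bs'"
          using set' by simp
        then obtain k where k: "k < length bs" "bs' ! k = insert v (as ! i' - {u})"
          by (metis bs'_def in_set_conv_nth length_map)
        have "(bs' @ as) ! k - (bs' @ as) ! i = {v}"
          using k i' c by (auto simp: nth_append bs'_def)
        moreover have "v \<in> (bs' @ as) ! j"
          using True by (simp add: nth_append bs'_def)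
        ultimately show ?thesis
          using k False by (intro exI[of _ k]) auto
      next
        case jF: False
        then obtain k w where kw: "k < i'" "as ! k - as ! i' = {w}" "w \<in> as ! (j - length bs)"
          using linear_quotientsE[OF as(3) i'(1), of "j - length bs"] j
        unfolding i'_def by (metis diff_less_mono not_le)
        then show ?thesis
          using False jF j i'
          by (intro exI[of _ "k + length bs"]) (auto simp: nth_append bs'_def i'_def)
      qed
    qed
  qed
  moreover have "distinct (bs' @ as)"
    using dist' as set' by (auto simp: vertex_deletion_def)
  moreover have "set (bs' @ as) = C"
    using set' as by (auto simp: vertex_deletion_def)
  ultimately show ?case
    by blast
qed

lemma facets_cocomplex:
  assumes "\<And>c. c \<in> C \<Longrightarrow> c \<subseteq> U \<and> card c = d" "finite U"
  shows "facets (cocomplex U C) = (\<lambda>c. U - c) ` C"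
proof
  show "facets (cocomplex U C) \<subseteq> (\<lambda>c. U - c) ` C"
    by (auto simp: facets_def cocomplex_def dest!: bspec)
  show "(\<lambda>c. U - c) ` C \<subseteq> facets (cocomplex U C)"
  proof
    fix F assume "F \<in> (\<lambda>c. U - c) ` C"
    then obtain c where c: "c \<in> C" "F = U - c"
      by blast
    have "G = F" if "c' \<in> C" "G \<subseteq> U - c'" "F \<subseteq> G" for G c'
    proof (rule card_subset_eq[symmetric])
      show "finite G"
        using that assms(2) finite_subset by blast
      have "card G \<le> card (U - c')"
        using that assms(2) by (intro card_mono) auto
      then show "card F = card G"
        using assms c that card_mono[OF \<open>finite G\<close> \<open>F \<subseteq> G\<close>]
        by (metis card_Diff_subset finite_subset le_antisym)
    qed (use that in auto)
    then show "F \<in> facets (cocomplex U C)"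
      using c by (auto simp: facets_def cocomplex_def)
  qed
qed

theorem splittable_imp_shellable:
  assumes "splittable d C" "finite U" "\<Union>C \<subseteq> U"
  shows "shellable (cocomplex U C)"
proof -
  obtain cs where cs: "distinct cs" "set cs = C" "linear_quotients cs"
    using splittable_imp_linear_quotients[OF assms(1)] by blast
  define Fs where "Fs = map (\<lambda>c. U - c) cs"
  have C: "c \<subseteq> U" if "c \<in> C" for c
    using assms that by blast
  have "inj_on (\<lambda>c. U - c) C"
    using C by (intro inj_onI) blast
  then have "distinct Fs"
    using cs by (simp add: Fs_def distinct_map)
  moreover have "set Fs = facets (cocomplex U C)"
    using facets_cocomplex[of C U d] C assms splittable_uniform[OF assms(1)] cs by (simp add: Fs_def)
  moreover have "card \<sigma> + 1 = card (Fs ! i)"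
    if i: "i < length Fs" and \<sigma>: "\<sigma> \<in> facets (Pow (Fs ! i) \<inter> (\<Union>j<i. Pow (Fs ! j)))" for i \<sigma>
  proof -
    obtain j where j: "j < i" "\<sigma> \<subseteq> Fs ! i" "\<sigma> \<subseteq> Fs ! j"
      using \<sigma> by (auto simp: facets_def)
    obtain k w where kw: "k < i" "cs ! k - cs ! i = {w}" "w \<in> cs ! j"
      using linear_quotientsE[OF cs(3) _ j(1)] i unfolding Fs_def length_map by blast
    have "cs ! k \<in> C"
      using kw(1) i cs(2) nth_mem[of k cs] by (simp add: Fs_def)
    then have "cs ! k \<subseteq> U"
      by (rule C)
    then have w: "w \<in> Fs ! i"
      using kw i by (auto simp: Fs_def)
    have sub: "\<sigma> \<subseteq> Fs ! i - {w}"
      using j i kw by (auto simp: Fs_def)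
    \<comment> \<open>This codimension-one face contains \<open>\<sigma>\<close> and lies in an
      earlier facet, so maximality forces equality.\<close>
    have "Fs ! i - {w} \<in> Pow (Fs ! i) \<inter> (\<Union>j<i. Pow (Fs ! j))"
      using kw i by (auto simp: Fs_def intro!: bexI[of _ k])
    then have "\<sigma> = Fs ! i - {w}"
      using \<sigma> sub unfolding facets_def by blast
    moreover have "finite (Fs ! i)"
      using i assms(2) by (simp add: Fs_def)
    ultimately show ?thesis
      using card_Suc_Diff1[OF _ w] by simp
  qed
  ultimately show ?thesis
    unfolding shellable_def by (intro exI[of _ Fs]) simp
qed

section \<open>Chordality\<close>

lemma chordal_clutter_mono:
  assumes "chordal_clutter d U C" "U \<subseteq> V"
  shows "chordal_clutter d V C"
  using assms
proof induction
  case (delete C Z)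
  then show ?case
    by (intro chordal_clutter.delete[of d V C Z]) (auto simp: simplicial_subcircuit_def)
qed (rule chordal_clutter.no_circuits)

lemma closed_nbhd_uniform:
  assumes "\<And>c. c \<in> C \<Longrightarrow> finite c \<and> card c = Suc (card Z)" "finite Z"
  shows "closed_nbhd C Z = Z \<union> {x. x \<notin> Z \<and> insert x Z \<in> C}"
proof -
  have "e = insert x Z" if "e \<in> C" "e \<subseteq> insert x Z" "x \<notin> Z" for e x
    using that assms by (intro card_subset_eq) auto
  then show ?thesis
    unfolding closed_nbhd_def by blast
qed

text \<open>With \<open>D\<^sub>0\<close> and \<open>D\<^sub>1\<close> the complements of deletion
  and contraction, the union is the complement of the whole clutter. The elimination of
  \<open>D\<^sub>1\<close> is replayed with \<open>v\<close> added to every subcircuit until no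
  circuit through \<open>v\<close> is left. The hypothesis \<open>clique\<close> handles the sets in
  a neighbourhood that avoid \<open>v\<close>.\<close>

lemma chordal_clutter_combine:
  assumes "chordal_clutter d (U - {v}) D\<^sub>1" and U: "finite U" "v \<in> U"
    and D\<^sub>0: "chordal_clutter (Suc d) (U - {v}) D\<^sub>0" "\<And>c. c \<in> D\<^sub>0 \<Longrightarrow> c \<subseteq> U - {v} \<and> card c = Suc d"
    and D\<^sub>1: "\<And>c. c \<in> D\<^sub>1 \<Longrightarrow> c \<subseteq> U - {v} \<and> card c = d"
    and clique: "\<And>e. \<lbrakk>e \<subseteq> U - {v}; card e = Suc d; clutter_clique d D\<^sub>1 e\<rbrakk> \<Longrightarrow> e \<in> D\<^sub>0"
  shows "chordal_clutter (Suc d) U (D\<^sub>0 \<union> insert v ` D\<^sub>1)"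
  using assms(1) D\<^sub>1 clique
proof induction
  case no_circuits
  then show ?case
    using chordal_clutter_mono[OF D\<^sub>0(1)] by auto
next
  case (delete D\<^sub>1 Z)
  let ?D = "D\<^sub>0 \<union> insert v ` D\<^sub>1" and ?N = "closed_nbhd D\<^sub>1 Z"
  have Z: "Z \<subseteq> U - {v}" "finite Z" "card Z + 1 = d" "clutter_clique d D\<^sub>1 ?N"
    using delete.hyps(1) by (auto simp: simplicial_subcircuit_def)
  have fin: "finite c" if "c \<subseteq> U" for c
    using that U finite_subset by blast
  have N: "?N = Z \<union> {x. x \<notin> Z \<and> insert x Z \<in> D\<^sub>1}"
  proof (rule closed_nbhd_uniform)
    fix c assume "c \<in> D\<^sub>1"
    then show "finite c \<and> card c = Suc (card Z)"
      using delete.prems(1)[of c] fin[of c] Z(3) by auto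
  qed (rule Z(2))
  have NU: "?N \<subseteq> U - {v}"
    using delete.prems(1) Z unfolding N by auto
  have cardI: "card (insert v c) = Suc d" if "c \<in> D\<^sub>1" for c
    using delete.prems(1)[OF that] fin[of c] by (subst card_insert_disjoint) auto
  have "closed_nbhd ?D (insert v Z) = insert v Z \<union> {x. x \<notin> insert v Z \<and> insert x (insert v Z) \<in> ?D}"
  proof (rule closed_nbhd_uniform)
    fix c assume c: "c \<in> ?D"
    have "Suc (card (insert v Z)) = Suc d"
      using Z by (subst card_insert_disjoint) auto
    moreover have "c \<subseteq> U"
      using c D\<^sub>0(2) delete.prems(1) U(2) by blast
    moreover have "card c = Suc d"
      using c D\<^sub>0(2) cardI by blast
    ultimately show "finite c \<and> card c = Suc (card (insert v Z))"
      using fin by simp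
  qed (use Z in auto)
  also have "\<dots> \<subseteq> insert v ?N"
  proof -
    have "insert x Z \<in> D\<^sub>1" if "x \<noteq> v" and x: "insert x (insert v Z) \<in> ?D" for x
    proof -
      obtain f where f: "f \<in> D\<^sub>1" "insert x (insert v Z) = insert v f"
        using x D\<^sub>0(2)[of "insert x (insert v Z)"] by blast
      then have "f = insert x Z"
        using that Z delete.prems(1)[OF f(1)] by blast
      then show ?thesis
        using f by simp
    qed
    then show ?thesis
      unfolding N by blast
  qed
  finally have sub: "closed_nbhd ?D (insert v Z) \<subseteq> insert v ?N" .
  have "clutter_clique (Suc d) ?D (insert v ?N)"
    unfolding clutter_clique_def
  proof (intro allI impI)
    fix e assume e: "e \<subseteq> insert v ?N \<and> card e = Suc d"
    then have fe: "finite e"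
      using card.infinite by fastforce
    show "e \<in> ?D"
    proof (cases "v \<in> e")
      case True
      then have "e - {v} \<subseteq> ?N" "card (e - {v}) = d"
        using e fe by auto
      then have "e - {v} \<in> D\<^sub>1"
        using Z(4) unfolding clutter_clique_def by blast
      then show ?thesis
        using True by (metis UnI2 image_eqI insert_Diff)
    next
      case False
      then have "e \<subseteq> ?N"
        using e by blast
      then have "clutter_clique d D\<^sub>1 e" "e \<subseteq> U - {v}"
        using Z(4) NU by (auto simp: clutter_clique_def)
      then show ?thesis
        using delete.prems(2) e by blast
    qed
  qed
  then have "simplicial_subcircuit (Suc d) U ?D (insert v Z)"
    unfolding simplicial_subcircuit_def
  proof (intro conjI)
    assume "clutter_clique (Suc d) ?D (insert v ?N)"
    then show "clutter_clique (Suc d) ?D (closed_nbhd ?D (insert v Z))"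
      using sub unfolding clutter_clique_def by (meson subset_trans)
    have "v \<notin> Z"
      using Z(1) by blast
    then show "card (insert v Z) + 1 = Suc d"
      using Z(2,3) by simp
  qed (use Z U in auto)
  moreover have "{c \<in> ?D. \<not> insert v Z \<subseteq> c} = D\<^sub>0 \<union> insert v ` {c \<in> D\<^sub>1. \<not> Z \<subseteq> c}"
  proof -
    have "\<not> insert v Z \<subseteq> c" if "c \<in> D\<^sub>0" for c
      using D\<^sub>0(2)[OF that] by blast
    moreover have "insert v Z \<subseteq> insert v c \<longleftrightarrow> Z \<subseteq> c" for c
      using Z(1) by blast
    ultimately show ?thesis
      by blast
  qed
  \<comment> \<open>Removing circuits from \<open>D\<^sub>1\<close> leaves fewer cliques, so the
    clique hypothesis is inherited.\<close>
  moreover have "chordal_clutter (Suc d) U (D\<^sub>0 \<union> insert v ` {c \<in> D\<^sub>1. \<not> Z \<subseteq> c})"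
  proof (rule delete.IH)
    fix e assume "e \<subseteq> U - {v}" "card e = Suc d" "clutter_clique d {c \<in> D\<^sub>1. \<not> Z \<subseteq> c} e"
    then show "e \<in> D\<^sub>0"
      using delete.prems(2)[of e] by (simp add: clutter_clique_def)
  qed (use delete.prems(1) in blast)
  ultimately show ?case
    using chordal_clutter.delete[of "Suc d" U ?D "insert v Z"] by simp
qed

lemma chordal_clutter_1:
  assumes "\<And>c. c \<in> C \<Longrightarrow> card c = 1"
  shows "chordal_clutter 1 U C"
proof (rule chordal_clutter.delete[of _ _ _ "{}"])
  have "closed_nbhd C {} = {x. {x} \<in> C}"
    using closed_nbhd_uniform[of C "{}"] assms by (auto simp: card_1_singleton_iff)
  then show "simplicial_subcircuit 1 U C {}"
    by (auto simp: simplicial_subcircuit_def clutter_clique_def card_1_singleton_iff)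
qed (simp add: chordal_clutter.no_circuits)

text \<open>The clique hypothesis of \<open>chordal_clutter_combine\<close> is the exchange read
  backwards: a circuit \<open>e\<close> avoiding \<open>v\<close> has a subset
  \<open>e - {u}\<close> in the contraction, so not all its \<open>d\<close>-subsets are in
  \<open>D\<^sub>1\<close>.\<close>

lemma co_chordal_shed:
  assumes U: "finite U" "v \<in> U"
    and del: "co_chordal (Suc d) (U - {v}) (vertex_deletion C v)"
    and link: "co_chordal d (U - {v}) (vertex_link C v)"
    and shed: "\<forall>c\<in>C. v \<notin> c \<longrightarrow> (\<exists>u\<in>c. insert v (c - {u}) \<in> C)"
  shows "co_chordal (Suc d) U C"
proof -
  define D\<^sub>0 where "D\<^sub>0 = {e. e \<subseteq> U - {v} \<and> card e = Suc d \<and> e \<notin> vertex_deletion C v}"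
  define D\<^sub>1 where "D\<^sub>1 = {e. e \<subseteq> U - {v} \<and> card e = d \<and> e \<notin> vertex_link C v}"
  have fin: "finite e" if "e \<subseteq> U" for e
    using U that finite_subset by blast
  have "{e. e \<subseteq> U \<and> card e = Suc d \<and> e \<notin> C} = D\<^sub>0 \<union> insert v ` D\<^sub>1" (is "?D = _")
  proof
    show "?D \<subseteq> D\<^sub>0 \<union> insert v ` D\<^sub>1"
    proof
      fix e assume e: "e \<in> ?D"
      show "e \<in> D\<^sub>0 \<union> insert v ` D\<^sub>1"
      proof (cases "v \<in> e")
        case True
        then have "e - {v} \<in> D\<^sub>1" "e = insert v (e - {v})"
          using e by (auto simp: D\<^sub>1_def vertex_link_def insert_absorb)
        then show ?thesis
          by blast
      qed (use e in \<open>auto simp: D\<^sub>0_def vertex_deletion_def\<close>)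
    qed
    show "D\<^sub>0 \<union> insert v ` D\<^sub>1 \<subseteq> ?D"
      using U fin
      by (auto simp: D\<^sub>0_def D\<^sub>1_def vertex_deletion_def vertex_link_def subset_iff)
        (subst card_insert_disjoint; auto simp: subset_iff)+
  qed
  moreover have "chordal_clutter (Suc d) U (D\<^sub>0 \<union> insert v ` D\<^sub>1)"
  proof (rule chordal_clutter_combine)
    fix e assume e: "e \<subseteq> U - {v}" "card e = Suc d" "clutter_clique d D\<^sub>1 e"
    show "e \<in> D\<^sub>0"
    proof (rule ccontr)
      assume "e \<notin> D\<^sub>0"
      then have "e \<in> C" "v \<notin> e"
        using e by (auto simp: D\<^sub>0_def vertex_deletion_def)
      then obtain u where u: "u \<in> e" "insert v (e - {u}) \<in> C"
        using shed by blast
      then have "e - {u} \<in> vertex_link C v"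
        using \<open>v \<notin> e\<close> by (simp add: vertex_link_def)
      moreover have "card (e - {u}) = d"
        using u e by simp
      ultimately show False
        using e(3) by (auto simp: clutter_clique_def D\<^sub>1_def)
    qed
  qed (use assms in \<open>auto simp: co_chordal_def D\<^sub>0_def D\<^sub>1_def\<close>)
  ultimately show ?thesis
    by (simp add: co_chordal_def)
qed

lemma co_chordal_1: "co_chordal 1 U C"
  unfolding co_chordal_def by (rule chordal_clutter_1) auto

text \<open>The exchange holds vacuously for \<open>{}\<close>, so \<open>co_chordal_shed\<close>
  applies at any vertex, with deletion and contraction again empty.\<close>

lemma co_chordal_empty:
  assumes "finite U"
  shows "co_chordal (Suc d) U {}"
  using assms
proof (induction d arbitrary: U)
  case 0
  then show ?case
    using co_chordal_1 by simp
next
  case (Suc d)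
  show ?case
    using Suc.prems
  proof (induction U)
    case empty
    have "{e :: 'a set. e \<subseteq> {} \<and> card e = Suc (Suc d) \<and> e \<notin> {}} = {}"
      by auto
    then show ?case
      unfolding co_chordal_def by (simp only: chordal_clutter.no_circuits)
  next
    case (insert v U)
    then have U: "insert v U - {v} = U"
      by auto
    have "vertex_deletion {} v = ({} :: 'a set set)" "vertex_link {} v = ({} :: 'a set set)"
      by (auto simp: vertex_deletion_def vertex_link_def)
    then show ?case
      using insert.hyps insert.IH Suc.IH[of U] co_chordal_shed[of "insert v U" v "Suc d" "{}"]
      by (simp only: U finite_insert insertI1 ball_empty)
  qed
qed

theorem splittable_imp_co_chordal:
  assumes "splittable d C" "finite U" "\<Union>C \<subseteq> U" "0 < d"
  shows "co_chordal d U C"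
  using assms
proof (induction arbitrary: U)
  case (empty d)
  then show ?case
    using co_chordal_empty[of U "d - 1"] by simp
next
  case (shed C v d)
  show ?case
  \<comment> \<open>For \<open>d = 0\<close> the contraction is 0-uniform, where no subcircuit can
    exist. The 1-uniform complement is instead cleared at once by the subcircuit
    \<open>{}\<close>.\<close>
  proof (cases "C = {} \<or> d = 0")
    case True
    then show ?thesis
      using co_chordal_empty[of U d] co_chordal_1 shed.prems by auto
  next
    case False
    then have v: "v \<in> U"
      using shed_in_Union[OF shed.hyps(1)] shed.prems by blast
    show ?thesis
    proof (rule co_chordal_shed)
      show "co_chordal (Suc d) (U - {v}) (vertex_deletion C v)"
        using shed.prems by (intro shed.IH(1) Union_vertex_deletion_subset) auto
      show "co_chordal d (U - {v}) (vertex_link C v)"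
        using shed.prems False by (intro shed.IH(2) Union_vertex_link_subset) auto
    qed (use shed v in auto)
  qed
qed auto

section \<open>Connected sets in cographs\<close>

lemma cograph_finite: "cograph V E \<Longrightarrow> finite V"
  by (induction rule: cograph.induct) auto

lemma cograph_edges: "cograph V E \<Longrightarrow> e \<in> E \<Longrightarrow> e \<subseteq> V"
  by (induction arbitrary: e rule: cograph.induct) auto

lemma induced_connected_cong:
  assumes "\<And>x y. \<lbrakk>x \<in> W; y \<in> W\<rbrakk> \<Longrightarrow> {x, y} \<in> E \<longleftrightarrow> {x, y} \<in> E'"
  shows "induced_connected E W \<longleftrightarrow> induced_connected E' W"
proof -
  have "{(x, y). x \<in> W \<and> y \<in> W \<and> {x, y} \<in> E} = {(x, y). x \<in> W \<and> y \<in> W \<and> {x, y} \<in> E'}"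
    using assms by auto
  then show ?thesis
    by (simp add: induced_connected_def)
qed

lemma induced_connected_subset:
  assumes "induced_connected E W" "v \<in> W \<inter> A"
    and closed: "\<And>x y. \<lbrakk>x \<in> W \<inter> A; y \<in> W; {x, y} \<in> E\<rbrakk> \<Longrightarrow> y \<in> A"
  shows "W \<subseteq> A"
proof
  fix w assume "w \<in> W"
  then have "(v, w) \<in> {(x, y). x \<in> W \<and> y \<in> W \<and> {x, y} \<in> E}\<^sup>*"
    using assms by (auto simp: induced_connected_def)
  then show "w \<in> A"
    by induction (use assms(2) closed in auto)
qed

text \<open>A vertex of \<open>B\<close> is adjacent to \<open>a\<close>, and a vertex of
  \<open>A\<close> reaches \<open>a\<close> through \<open>b\<close>.\<close>

lemma induced_connected_join:
  assumes W: "W \<subseteq> A \<union> B" and a: "a \<in> W \<inter> A" and b: "b \<in> W \<inter> B"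
    and E: "\<And>x y. \<lbrakk>x \<in> W \<inter> A; y \<in> W \<inter> B\<rbrakk> \<Longrightarrow> {x, y} \<in> E"
  shows "induced_connected E W"
  unfolding induced_connected_def
proof (intro conjI ballI)
  let ?R = "{(x, y). x \<in> W \<and> y \<in> W \<and> {x, y} \<in> E}"
  have AB: "(x, y) \<in> ?R" "(y, x) \<in> ?R" if "x \<in> W \<inter> A" "y \<in> W \<inter> B" for x y
    using E[OF that] that by (auto simp: insert_commute)
  fix u v assume uv: "u \<in> W" "v \<in> W"
  have to_a: "(u, a) \<in> ?R\<^sup>*" if "u \<in> W" for u
  proof (cases "u \<in> B")
    case True
    then show ?thesis
      using AB(2)[OF a, of u] that by blast
  next
    case False
    then have "(u, b) \<in> ?R"
      using W that b by (intro AB(1)) auto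
    then show ?thesis
      using AB(2)[OF a b] by (meson converse_rtrancl_into_rtrancl r_into_rtrancl)
  qed
  have from_a: "(a, v) \<in> ?R\<^sup>*"
  proof (cases "v \<in> B")
    case True
    then show ?thesis
      using AB(1)[OF a, of v] uv by blast
  next
    case False
    then have "(b, v) \<in> ?R"
      using W uv b by (intro AB(2)) auto
    then show ?thesis
      using AB(1)[OF a b] by (meson converse_rtrancl_into_rtrancl r_into_rtrancl)
  qed
  show "(u, v) \<in> ?R\<^sup>*"
    using rtrancl_trans[OF to_a[OF uv(1)] from_a] .
qed (use a in blast)

section \<open>Disjoint unions and joins of two graphs\<close>

definition join_edges :: "'a set \<Rightarrow> 'a set \<Rightarrow> 'a set set" where
  "join_edges V\<^sub>1 V\<^sub>2 = {{u, v} | u v. u \<in> V\<^sub>1 \<and> v \<in> V\<^sub>2}"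

lemma join_edges_commute: "join_edges V\<^sub>1 V\<^sub>2 = join_edges V\<^sub>2 V\<^sub>1"
proof -
  have "join_edges A B \<subseteq> join_edges B A" for A B :: "'a set"
  proof
    fix e assume "e \<in> join_edges A B"
    then obtain u v where "u \<in> A" "v \<in> B" "e = {v, u}"
      by (auto simp: join_edges_def)
    then show "e \<in> join_edges B A"
      unfolding join_edges_def by blast
  qed
  then show ?thesis
    by blast
qed

lemma join_edges_iff:
  "V\<^sub>1 \<inter> V\<^sub>2 = {} \<Longrightarrow> {x, y} \<in> join_edges V\<^sub>1 V\<^sub>2 \<longleftrightarrow> x \<in> V\<^sub>1 \<and> y \<in> V\<^sub>2 \<or> x \<in> V\<^sub>2 \<and> y \<in> V\<^sub>1"
  by (auto simp: join_edges_def doubleton_eq_iff)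

text \<open>One setting for disjoint unions and joins. One-sided lemmas are proved for the first
  graph, and \<open>swap\<close> transfers them to the second.\<close>

locale graph_pair =
  fixes V\<^sub>1 V\<^sub>2 :: "'a set" and E\<^sub>1 E\<^sub>2 :: "'a set set"
  assumes disj: "V\<^sub>1 \<inter> V\<^sub>2 = {}"
    and edges\<^sub>1: "\<And>e. e \<in> E\<^sub>1 \<Longrightarrow> e \<subseteq> V\<^sub>1"
    and edges\<^sub>2: "\<And>e. e \<in> E\<^sub>2 \<Longrightarrow> e \<subseteq> V\<^sub>2"
begin

abbreviation "join_E \<equiv> E\<^sub>1 \<union> E\<^sub>2 \<union> join_edges V\<^sub>1 V\<^sub>2"

lemma edge_union_iff: "x \<in> V\<^sub>1 \<Longrightarrow> {x, y} \<in> E\<^sub>1 \<union> E\<^sub>2 \<longleftrightarrow> {x, y} \<in> E\<^sub>1"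
  using disj edges\<^sub>2[of "{x, y}"] by auto

lemma connected_union_iff:
  assumes "v \<in> W" "v \<in> V\<^sub>1"
  shows "induced_connected (E\<^sub>1 \<union> E\<^sub>2) W \<longleftrightarrow> W \<subseteq> V\<^sub>1 \<and> induced_connected E\<^sub>1 W"
proof -
  have "induced_connected (E\<^sub>1 \<union> E\<^sub>2) W \<longleftrightarrow> induced_connected E\<^sub>1 W" if "W \<subseteq> V\<^sub>1"
    using that edge_union_iff by (intro induced_connected_cong) auto
  moreover have "W \<subseteq> V\<^sub>1" if "induced_connected (E\<^sub>1 \<union> E\<^sub>2) W"
    by (rule induced_connected_subset[OF that])
      (use assms edge_union_iff edges\<^sub>1 in auto)
  ultimately show ?thesis
    by blast
qed

lemma connected_join_iff:
  assumes "W \<subseteq> V\<^sub>1"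
  shows "induced_connected join_E W \<longleftrightarrow> induced_connected E\<^sub>1 W"
proof (rule induced_connected_cong)
  fix x y assume "x \<in> W" "y \<in> W"
  then have "x \<in> V\<^sub>1" "y \<in> V\<^sub>1" "x \<notin> V\<^sub>2" "y \<notin> V\<^sub>2"
    using assms disj by auto
  then show "{x, y} \<in> join_E \<longleftrightarrow> {x, y} \<in> E\<^sub>1"
    using edge_union_iff join_edges_iff[OF disj] by auto
qed

lemma connected_join:
  assumes "W \<subseteq> V\<^sub>1 \<union> V\<^sub>2" "a \<in> W" "a \<in> V\<^sub>1" "b \<in> W" "b \<in> V\<^sub>2"
  shows "induced_connected join_E W"
  using assms by (intro induced_connected_join[of W V\<^sub>1 V\<^sub>2 a b]) (auto simp: join_edges_iff[OF disj])

lemma swap: "graph_pair V\<^sub>2 V\<^sub>1 E\<^sub>2 E\<^sub>1"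
  using disj edges\<^sub>1 edges\<^sub>2 by unfold_locales auto

lemma join_E_commute: "join_E = E\<^sub>2 \<union> E\<^sub>1 \<union> join_edges V\<^sub>2 V\<^sub>1"
  using join_edges_commute[of V\<^sub>1 V\<^sub>2] by blast

end

lemma cograph_graph_pair:
  "\<lbrakk>cograph V\<^sub>1 E\<^sub>1; cograph V\<^sub>2 E\<^sub>2; V\<^sub>1 \<inter> V\<^sub>2 = {}\<rbrakk> \<Longrightarrow> graph_pair V\<^sub>1 V\<^sub>2 E\<^sub>1 E\<^sub>2"
  by unfold_locales (auto dest: cograph_edges)

section \<open>Gap-free cographs\<close>

text \<open>Every vertex of a complete clutter can be shed. A contraction takes this form once a
  join has made connectivity automatic.\<close>

lemma splittable_full:
  assumes "finite S"
  shows "splittable k {U. U \<subseteq> S \<and> card U = k}"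
  using assms
proof (induction S arbitrary: k)
  case empty
  have "{U :: 'a set. U \<subseteq> {} \<and> card U = k} = (if k = 0 then {{}} else {})"
    by auto
  then show ?case
    using splittable.empty splittable.unit by (metis (full_types))
next
  case (insert v S)
  show ?case
  proof (cases k)
    case 0
    have "{U. U \<subseteq> insert v S \<and> card U = 0} = {{}}"
      using insert.hyps(1) finite_subset[of _ "insert v S"] by (auto simp: card_eq_0_iff)
    then show ?thesis
      using 0 splittable.unit by simp
  next
    case (Suc d)
    have fin: "finite U" if "U \<subseteq> S" for U
      using that insert.hyps(1) finite_subset by blast
    show ?thesis
      unfolding Suc
    proof (rule splittable.shed[of _ v])
      have "insert v (c - {u}) \<subseteq> insert v S \<and> card (insert v (c - {u})) = Suc d"
        if "c \<subseteq> insert v S" "card c = Suc d" "v \<notin> c" "u \<in> c" for c u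
      proof -
        have "finite c"
          using that(2) card.infinite by fastforce
        then show ?thesis
          using that card_Suc_Diff1[of c u] by auto
      qed
      then show "\<forall>c\<in>{U. U \<subseteq> insert v S \<and> card U = Suc d}. v \<notin> c \<longrightarrow>
          (\<exists>u\<in>c. insert v (c - {u}) \<in> {U. U \<subseteq> insert v S \<and> card U = Suc d})"
        by (metis (mono_tags, lifting) card_gt_0_iff ex_in_conv mem_Collect_eq zero_less_Suc)
      have "vertex_deletion {U. U \<subseteq> insert v S \<and> card U = Suc d} v = {U. U \<subseteq> S \<and> card U = Suc d}"
        using insert.hyps(2) by (auto simp: vertex_deletion_def)
      then show "splittable (Suc d) (vertex_deletion {U. U \<subseteq> insert v S \<and> card U = Suc d} v)"
        using insert.IH by simp
      have "vertex_link {U. U \<subseteq> insert v S \<and> card U = Suc d} v = {U. U \<subseteq> S \<and> card U = d}"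
      proof -
        have "v \<notin> U \<and> insert v U \<subseteq> insert v S \<and> card (insert v U) = Suc d \<longleftrightarrow> U \<subseteq> S \<and> card U = d" for U
        proof -
          have "v \<notin> U \<and> insert v U \<subseteq> insert v S \<longleftrightarrow> U \<subseteq> S"
            using insert.hyps(2) by blast
          then show ?thesis
            using fin[of U] by auto
        qed
        then show ?thesis
          unfolding vertex_link_def by auto
      qed
      then show "splittable d (vertex_link {U. U \<subseteq> insert v S \<and> card U = Suc d} v)"
        using insert.IH by simp
    qed
  qed
qed

text \<open>For finite \<open>S\<close> and \<open>v \<notin> S\<close> this is the contraction of
  \<open>v\<close> in the clutter of connected \<open>Suc k\<close>-subsets of
  \<open>insert v S\<close>.\<close>

definition rooted_connected :: "'a set set \<Rightarrow> 'a \<Rightarrow> nat \<Rightarrow> 'a set \<Rightarrow> 'a set set" where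
  "rooted_connected E v k S = {U. U \<subseteq> S \<and> card U = k \<and> induced_connected E (insert v U)}"

lemma rooted_connected_0: "finite S \<Longrightarrow> rooted_connected E v 0 S = {{}}"
  by (auto simp: rooted_connected_def induced_connected_def card_eq_0_iff dest: finite_subset)

context graph_pair
begin

lemma rooted_connected_union:
  assumes "v \<in> V\<^sub>1" "S \<subseteq> V\<^sub>1 \<union> V\<^sub>2"
  shows "rooted_connected (E\<^sub>1 \<union> E\<^sub>2) v k S = rooted_connected E\<^sub>1 v k (S \<inter> V\<^sub>1)"
  using assms connected_union_iff[of v "insert v _"] by (auto simp: rooted_connected_def)

text \<open>A vertex \<open>x\<close> on the other side of the join is adjacent to the root, and every set
  containing both is connected: contracting \<open>x\<close> leaves all subsets of the right size.\<close>

lemma splittable_rooted_connected_join: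
  assumes v: "v \<in> V\<^sub>1" and fin: "finite T" and T: "T \<subseteq> V\<^sub>2"
    and S: "S \<subseteq> V\<^sub>1 - {v}" "finite S"
    and base: "\<And>k. splittable k (rooted_connected E\<^sub>1 v k S)"
  shows "splittable k (rooted_connected join_E v k (S \<union> T))"
  using fin T
proof (induction T arbitrary: k)
  case empty
  have "rooted_connected join_E v k S = rooted_connected E\<^sub>1 v k S"
    unfolding rooted_connected_def using v S(1)
    by (intro Collect_cong conj_cong refl connected_join_iff) auto
  then show ?case
    using base by simp
next
  case (insert x T)
  let ?C = "\<lambda>k. rooted_connected join_E v k (S \<union> insert x T)"
  have x: "x \<in> V\<^sub>2" "x \<notin> V\<^sub>1" "x \<noteq> v" "x \<notin> S"
    using insert.prems disj v S by auto
  have fin: "finite (S \<union> insert x T)"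
    using S insert.hyps by auto
  show ?case
  proof (cases k)
    case 0
    then show ?thesis
      using rooted_connected_0[OF fin] splittable.unit by metis
  next
    case (Suc d)
    have conn: "induced_connected join_E (insert v (insert x U))" if "U \<subseteq> S \<union> insert x T" for U
      using that v x S insert.prems by (intro connected_join[of _ v x]) auto
    show ?thesis
      unfolding Suc
    proof (rule splittable.shed[of _ x])
      show "\<forall>c\<in>?C (Suc d). x \<notin> c \<longrightarrow> (\<exists>u\<in>c. insert x (c - {u}) \<in> ?C (Suc d))"
      proof (intro ballI impI)
        fix c assume c: "c \<in> ?C (Suc d)" "x \<notin> c"
        then have c': "c \<subseteq> S \<union> insert x T" "card c = Suc d"
          by (auto simp: rooted_connected_def)
        then obtain u where u: "u \<in> c" "finite c"
          using card.infinite by fastforce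
        then have "card (insert x (c - {u})) = Suc d"
          using c(2) c'(2) card_Suc_Diff1[of c u] by simp
        then show "\<exists>u\<in>c. insert x (c - {u}) \<in> ?C (Suc d)"
          using u conn[of "c - {u}"] c'(1) by (intro bexI[of _ u]) (auto simp: rooted_connected_def)
      qed
      have "vertex_deletion (?C (Suc d)) x = rooted_connected join_E v (Suc d) (S \<union> T)"
        using insert.hyps x by (auto simp: vertex_deletion_def rooted_connected_def)
      then show "splittable (Suc d) (vertex_deletion (?C (Suc d)) x)"
        using insert.IH insert.prems by simp
      have "vertex_link (?C (Suc d)) x = {U. U \<subseteq> S \<union> T \<and> card U = d}"
      proof -
        have "x \<notin> U \<and> insert x U \<in> ?C (Suc d) \<longleftrightarrow> U \<subseteq> S \<union> T \<and> card U = d" for U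
        proof -
          have *: "x \<notin> U \<and> insert x U \<subseteq> S \<union> insert x T \<longleftrightarrow> U \<subseteq> S \<union> T"
            using insert.hyps(2) x(4) by auto
          have "finite U" if "U \<subseteq> S \<union> T"
            using finite_subset[OF that] fin by simp
          then show ?thesis
            using * conn[of U] unfolding rooted_connected_def by auto
        qed
        then show ?thesis
          by (simp add: vertex_link_def)
      qed
      then show "splittable d (vertex_link (?C (Suc d)) x)"
        using splittable_full[of "S \<union> T"] fin by simp
    qed
  qed
qed

end

text \<open>The root takes over the role of gap-freeness: in a disjoint union only the side of
  \<open>v\<close> contributes, and in a join the vertices across from \<open>v\<close> are shed
  before those on its own side.\<close>

lemma splittable_rooted_connected:
  assumes "cograph V E" "v \<in> V" "S \<subseteq> V - {v}"
  shows "splittable k (rooted_connected E v k S)"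
  using assms
proof (induction arbitrary: v S k rule: cograph.induct)
  case (single w)
  then have S: "S = {}"
    by auto
  show ?case
  proof (cases k)
    case 0
    then show ?thesis
      using rooted_connected_0[of S] splittable.unit S by (metis finite.emptyI)
  next
    case (Suc d)
    then have "rooted_connected {} v k S = {}"
      by (auto simp: rooted_connected_def S)
    then show ?thesis
      using splittable.empty by metis
  qed
next
  case (disjoint_union V\<^sub>1 E\<^sub>1 V\<^sub>2 E\<^sub>2)
  interpret graph_pair V\<^sub>1 V\<^sub>2 E\<^sub>1 E\<^sub>2
    using disjoint_union by (intro cograph_graph_pair)
  show ?case
  proof (cases "v \<in> V\<^sub>1")
    case True
    then show ?thesis
      using rooted_connected_union[of v S] disjoint_union.IH(1)[of v "S \<inter> V\<^sub>1"] disjoint_union.prems by fastforce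
  next
    case False
    then show ?thesis
      using graph_pair.rooted_connected_union[OF swap, of v S] disjoint_union.IH(2)[of v "S \<inter> V\<^sub>2"]
        disjoint_union.prems by (fastforce simp: Un_commute)
  qed
next
  case (join V\<^sub>1 E\<^sub>1 V\<^sub>2 E\<^sub>2)
  interpret graph_pair V\<^sub>1 V\<^sub>2 E\<^sub>1 E\<^sub>2
    using join by (intro cograph_graph_pair)
  have fin: "finite S"
    using join.hyps join.prems cograph_finite by (metis finite_Diff finite_UnI finite_subset)
  have S: "S = S \<inter> V\<^sub>1 \<union> S \<inter> V\<^sub>2" "S = S \<inter> V\<^sub>2 \<union> S \<inter> V\<^sub>1"
    using join.prems by auto
  have "splittable k (rooted_connected join_E v k S)"
  proof (cases "v \<in> V\<^sub>1")
    case True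
    have "splittable k (rooted_connected join_E v k (S \<inter> V\<^sub>1 \<union> S \<inter> V\<^sub>2))"
      using True fin join.prems join.IH(1)[of v "S \<inter> V\<^sub>1"]
      by (intro splittable_rooted_connected_join) auto
    then show ?thesis
      using S(1) by simp
  next
    case False
    then have "v \<in> V\<^sub>2"
      using join.prems by auto
    then have "splittable k (rooted_connected (E\<^sub>2 \<union> E\<^sub>1 \<union> join_edges V\<^sub>2 V\<^sub>1) v k (S \<inter> V\<^sub>2 \<union> S \<inter> V\<^sub>1))"
      using fin join.prems join.IH(2)[of v "S \<inter> V\<^sub>2"]
      by (intro graph_pair.splittable_rooted_connected_join[OF swap]) auto
    then show ?thesis
      using S(2) join_E_commute by simp
  qed
  then show ?case
    by (simp add: join_edges_def)
qed

section \<open>Elimination orders for connected sets\<close>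

text \<open>Only the deletions are recorded, as vertex subsets;
  \<open>splittable_rooted_connected\<close> settles the contractions in every cograph.\<close>

inductive eliminable :: "nat \<Rightarrow> 'a set set \<Rightarrow> 'a set \<Rightarrow> bool" for r E where
  empty: "Con r S E = {} \<Longrightarrow> eliminable r E S"
| step:
    "\<lbrakk>v \<in> S; \<forall>c\<in>Con r (S - {v}) E. \<exists>u\<in>c. insert v (c - {u}) \<in> Con r S E;
      eliminable r E (S - {v})\<rbrakk> \<Longrightarrow> eliminable r E S"

lemma eliminable_imp_splittable:
  assumes G: "cograph V E" and "eliminable (Suc d) E S" "S \<subseteq> V"
  shows "splittable (Suc d) (Con (Suc d) S E)"
  using assms(2,3)
proof induction
  case (empty S)
  then show ?case
    by (simp add: splittable.empty)
next
  case (step v S)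
  have fin: "finite U" if "U \<subseteq> S" for U
    using that step.prems cograph_finite[OF G] by (meson finite_subset)
  have del: "vertex_deletion (Con (Suc d) S E) v = Con (Suc d) (S - {v}) E"
    by (auto simp: vertex_deletion_def Con_def)
  have link: "vertex_link (Con (Suc d) S E) v = rooted_connected E v d (S - {v})"
  proof -
    have "v \<notin> U \<and> insert v U \<in> Con (Suc d) S E \<longleftrightarrow> U \<in> rooted_connected E v d (S - {v})" for U
    proof -
      have "v \<notin> U \<and> insert v U \<subseteq> S \<longleftrightarrow> U \<subseteq> S - {v}"
        using step.hyps(1) by blast
      moreover have "card (insert v U) = Suc (card U)" if "U \<subseteq> S - {v}"
        using that fin[of U] by (subst card_insert_disjoint) auto
      ultimately show ?thesis
        by (auto simp: Con_def rooted_connected_def)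
    qed
    then show ?thesis
      by (auto simp: vertex_link_def)
  qed
  show ?case
  proof (rule splittable.shed[of _ v])
    show "\<forall>c\<in>Con (Suc d) S E. v \<notin> c \<longrightarrow> (\<exists>u\<in>c. insert v (c - {u}) \<in> Con (Suc d) S E)"
      using step.hyps(2) by (auto simp: Con_def subset_Diff_insert)
    show "splittable (Suc d) (vertex_deletion (Con (Suc d) S E) v)"
      unfolding del using step.prems by (intro step.IH) auto
    show "splittable d (vertex_link (Con (Suc d) S E) v)"
      unfolding link using step.hyps step.prems by (intro splittable_rooted_connected[OF G]) auto
  qed
qed

context graph_pair
begin

lemma Con_union:
  assumes "S \<subseteq> V\<^sub>1" "T \<subseteq> V\<^sub>2"
  shows "Con r (S \<union> T) (E\<^sub>1 \<union> E\<^sub>2) = Con r S E\<^sub>1 \<union> Con r T E\<^sub>2"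
proof -
  have 1: "c \<in> Con r S E\<^sub>1 \<union> Con r T E\<^sub>2" if c: "c \<in> Con r (S \<union> T) (E\<^sub>1 \<union> E\<^sub>2)" for c
  proof -
    have c': "c \<subseteq> S \<union> T" "card c = r" "induced_connected (E\<^sub>1 \<union> E\<^sub>2) c" "c \<noteq> {}"
      using c by (auto simp: Con_def induced_connected_def)
    then obtain v where v: "v \<in> c" "v \<in> V\<^sub>1 \<or> v \<in> V\<^sub>2"
      using assms by blast
    then have "c \<subseteq> V\<^sub>1 \<and> induced_connected E\<^sub>1 c \<or> c \<subseteq> V\<^sub>2 \<and> induced_connected E\<^sub>2 c"
      using c'(3) connected_union_iff[of v c] graph_pair.connected_union_iff[OF swap, of v c]
      by (metis Un_commute)
    moreover have "c \<subseteq> V\<^sub>1 \<Longrightarrow> c \<subseteq> S" "c \<subseteq> V\<^sub>2 \<Longrightarrow> c \<subseteq> T"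
      using c'(1) assms disj by blast+
    ultimately show ?thesis
      using c'(2) by (auto simp: Con_def)
  qed
  have "c \<in> Con r (S \<union> T) (E\<^sub>1 \<union> E\<^sub>2)" if c: "c \<in> Con r S E\<^sub>1" for c
  proof -
    obtain v where "v \<in> c"
      using c by (auto simp: Con_def induced_connected_def)
    then show ?thesis
      using c assms connected_union_iff[of v c] by (auto simp: Con_def)
  qed
  moreover have "c \<in> Con r (S \<union> T) (E\<^sub>1 \<union> E\<^sub>2)" if c: "c \<in> Con r T E\<^sub>2" for c
  proof -
    obtain v where "v \<in> c"
      using c by (auto simp: Con_def induced_connected_def)
    then show ?thesis
      using c assms graph_pair.connected_union_iff[OF swap, of v c] by (auto simp: Con_def Un_commute)
  qed
  ultimately show ?thesis
    using 1 by blast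
qed

lemma Con_join_left: "S \<subseteq> V\<^sub>1 \<Longrightarrow> Con r S join_E = Con r S E\<^sub>1"
  unfolding Con_def by (intro Collect_cong conj_cong refl connected_join_iff) auto

lemma Con_join_right: "S \<subseteq> V\<^sub>2 \<Longrightarrow> Con r S join_E = Con r S E\<^sub>2"
  unfolding join_E_commute by (rule graph_pair.Con_join_left[OF swap])

text \<open>The circuit-free part stays in place throughout: an elimination stops when the circuits
  are gone, not when the vertices are.\<close>

lemma eliminable_union:
  assumes "eliminable r E\<^sub>1 S" "S \<subseteq> V\<^sub>1" "Con r V\<^sub>2 E\<^sub>2 = {}"
  shows "eliminable r (E\<^sub>1 \<union> E\<^sub>2) (S \<union> V\<^sub>2)"
  using assms(1,2)
proof induction
  case (empty S)
  then show ?case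
    using assms(3) by (intro eliminable.empty) (simp add: Con_union)
next
  case (step v S)
  have S: "S \<union> V\<^sub>2 - {v} = (S - {v}) \<union> V\<^sub>2" "S - {v} \<subseteq> V\<^sub>1"
    using step.hyps step.prems disj by auto
  show ?case
  proof (rule eliminable.step[of v])
    show "\<forall>c\<in>Con r (S \<union> V\<^sub>2 - {v}) (E\<^sub>1 \<union> E\<^sub>2). \<exists>u\<in>c. insert v (c - {u}) \<in> Con r (S \<union> V\<^sub>2) (E\<^sub>1 \<union> E\<^sub>2)"
      using step.hyps(2) Con_union[OF S(2) order_refl, of r] Con_union[OF step.prems order_refl, of r]
      unfolding S(1) assms(3) by blast
    show "eliminable r (E\<^sub>1 \<union> E\<^sub>2) (S \<union> V\<^sub>2 - {v})"
      unfolding S(1) using step.IH S(2) by blast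
  qed (use step.hyps(1) in blast)
qed

text \<open>The circuit keeps a vertex \<open>b\<close> of \<open>V\<^sub>2\<close>. Since
  \<open>2 \<le> r\<close> it has another vertex \<open>u\<close> to trade for \<open>v\<close>, and
  \<open>v\<close> and \<open>b\<close> on opposite sides make the new set connected, whatever
  \<open>u\<close> was.\<close>

lemma join_exchange:
  assumes v: "v \<in> S" "S \<subseteq> V\<^sub>1" and r: "2 \<le> r"
    and c: "c \<in> Con r ((S - {v}) \<union> V\<^sub>2) join_E" "\<not> c \<subseteq> V\<^sub>1"
  shows "\<exists>u\<in>c. insert v (c - {u}) \<in> Con r (S \<union> V\<^sub>2) join_E"
proof -
  have c': "c \<subseteq> S - {v} \<union> V\<^sub>2" "card c = r"
    using c by (auto simp: Con_def)
  obtain b where b: "b \<in> c" "b \<in> V\<^sub>2"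
    using c(2) c'(1) v by blast
  have fin: "finite c"
    using c'(2) r card.infinite by fastforce
  have "card (c - {b}) \<noteq> 0"
    using b c'(2) r by simp
  then obtain u where u: "u \<in> c" "u \<noteq> b"
    by (metis DiffE card_eq_0_iff ex_in_conv insertI1)
  have "v \<notin> c"
    using c'(1) v disj by blast
  then have "card (insert v (c - {u})) = r"
    using fin u c'(2) card_Suc_Diff1[of c u] by simp
  moreover have "induced_connected join_E (insert v (c - {u}))"
    using v b u c'(1) by (intro connected_join[of _ v b]) auto
  ultimately show ?thesis
    using u v c'(1) by (intro bexI[of _ u]) (auto simp: Con_def)
qed

lemma eliminable_join_right:
  assumes "eliminable r E\<^sub>2 S" "S \<subseteq> V\<^sub>2"
  shows "eliminable r join_E S"
  using assms
proof induction
  case (empty S)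
  then show ?case
    by (intro eliminable.empty) (simp add: Con_join_right)
next
  case (step v S)
  have S: "S - {v} \<subseteq> V\<^sub>2"
    using step.prems by blast
  show ?case
    using step.hyps(1,2) step.IH[OF S]
    unfolding Con_join_right[OF step.prems, of r, symmetric] Con_join_right[OF S, of r, symmetric]
    by (rule eliminable.step)
qed

text \<open>Circuits inside \<open>V\<^sub>1\<close> use the exchange given for
  \<open>E\<^sub>1\<close>, all others use \<open>join_exchange\<close>.\<close>

lemma eliminable_join_step:
  assumes v: "v \<in> S" "S \<subseteq> V\<^sub>1" and r: "2 \<le> r"
    and shed: "\<forall>c\<in>Con r (S - {v}) E\<^sub>1. \<exists>u\<in>c. insert v (c - {u}) \<in> Con r S E\<^sub>1"
    and "eliminable r join_E ((S - {v}) \<union> V\<^sub>2)"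
  shows "eliminable r join_E (S \<union> V\<^sub>2)"
proof (rule eliminable.step)
  have S: "S \<union> V\<^sub>2 - {v} = (S - {v}) \<union> V\<^sub>2"
    using v disj by auto
  show "eliminable r join_E (S \<union> V\<^sub>2 - {v})"
    using assms by (simp add: S)
  show "\<forall>c\<in>Con r (S \<union> V\<^sub>2 - {v}) join_E. \<exists>u\<in>c. insert v (c - {u}) \<in> Con r (S \<union> V\<^sub>2) join_E"
    unfolding S
  proof
    fix c assume c: "c \<in> Con r ((S - {v}) \<union> V\<^sub>2) join_E"
    show "\<exists>u\<in>c. insert v (c - {u}) \<in> Con r (S \<union> V\<^sub>2) join_E"
    proof (cases "c \<subseteq> V\<^sub>1")
      case True
      then have "c \<in> Con r (S - {v}) join_E"
        using c disj by (auto simp: Con_def)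
      then have "c \<in> Con r (S - {v}) E\<^sub>1"
        using Con_join_left[of "S - {v}" r] v by blast
      then obtain u where "u \<in> c" "insert v (c - {u}) \<in> Con r S join_E"
        using shed Con_join_left[OF v(2), of r] by blast
      then show ?thesis
        by (auto simp: Con_def)
    next
      case False
      then show ?thesis
        using join_exchange[OF v r c] by blast
    qed
  qed
qed (use v in blast)

lemma eliminable_join:
  assumes "eliminable r E\<^sub>1 S" "S \<subseteq> V\<^sub>1" and "finite V\<^sub>1" "eliminable r E\<^sub>2 V\<^sub>2" "2 \<le> r"
  shows "eliminable r join_E (S \<union> V\<^sub>2)"
  using assms(1,2)
proof induction
  case (empty S)
  \<comment> \<open>The elimination of \<open>E\<^sub>1\<close> ends here, but in the join circuits
    meeting \<open>V\<^sub>2\<close> may remain. The leftover vertices of \<open>S\<close> are shed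
    in any order, as the exchange within \<open>E\<^sub>1\<close> is vacuous, and then the
    elimination of \<open>E\<^sub>2\<close> takes over.\<close>
  have "finite S"
    using empty.prems assms(3) finite_subset by blast
  then show ?case
    using empty
  proof (induction S)
    case empty
    then show ?case
      using eliminable_join_right[OF assms(4)] by simp
  next
    case (insert v S)
    have "Con r S E\<^sub>1 = {}"
      using insert.prems(1) by (auto simp: Con_def)
    moreover have S: "insert v S - {v} = S" "S \<subseteq> V\<^sub>1"
      using insert.hyps(2) insert.prems(2) by auto
    ultimately have "eliminable r join_E (insert v S - {v} \<union> V\<^sub>2)"
      "\<forall>c\<in>Con r (insert v S - {v}) E\<^sub>1. \<exists>u\<in>c. insert v (c - {u}) \<in> Con r (insert v S) E\<^sub>1"
      using insert.IH by simp_all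
    then show ?case
      using eliminable_join_step[OF insertI1 insert.prems(2) assms(5)] by blast
  qed
next
  case (step v S)
  then have "S - {v} \<subseteq> V\<^sub>1"
    by blast
  then show ?case
    using eliminable_join_step[OF step.hyps(1) step.prems assms(5) step.hyps(2)] step.IH by blast
qed

end

section \<open>Gap-freeness of the parts of a cograph\<close>

lemma gap_free_induced:
  assumes "gap_free r V E" "{c \<in> Con r V E. c \<subseteq> V'} = Con r V' E'"
  shows "gap_free r V' E'"
  unfolding gap_free_def
proof (intro allI impI)
  fix M assume M: "induced_matching (Con r V' E') M"
  then have "\<Union>M \<subseteq> V'"
    by (auto simp: induced_matching_def Con_def)
  then have "{c \<in> Con r V E. c \<subseteq> \<Union>M} = {c \<in> Con r V' E'. c \<subseteq> \<Union>M}"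
    using assms(2) by blast
  moreover have "M \<subseteq> Con r V E"
    using M assms(2) by (auto simp: induced_matching_def)
  ultimately have "induced_matching (Con r V E) M"
    using M by (simp add: induced_matching_def)
  then show "finite M \<and> card M \<le> 1"
    using assms(1) by (simp add: gap_free_def)
qed

text \<open>One circuit from each part would give an induced matching of size two, because no
  connected set meets both parts.\<close>

lemma (in graph_pair) gap_free_union:
  assumes "gap_free r (V\<^sub>1 \<union> V\<^sub>2) (E\<^sub>1 \<union> E\<^sub>2)" and fin: "finite V\<^sub>1" "finite V\<^sub>2"
  shows "Con r V\<^sub>1 E\<^sub>1 = {} \<or> Con r V\<^sub>2 E\<^sub>2 = {}"
proof (rule ccontr)
  assume "\<not> ?thesis"
  then obtain W\<^sub>1 W\<^sub>2 where W: "W\<^sub>1 \<in> Con r V\<^sub>1 E\<^sub>1" "W\<^sub>2 \<in> Con r V\<^sub>2 E\<^sub>2"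
    by blast
  then have sub: "W\<^sub>1 \<subseteq> V\<^sub>1" "W\<^sub>2 \<subseteq> V\<^sub>2" "W\<^sub>1 \<noteq> {}" "W\<^sub>2 \<noteq> {}" "card W\<^sub>1 = r" "card W\<^sub>2 = r"
    by (auto simp: Con_def induced_connected_def)
  have ne: "W\<^sub>1 \<noteq> W\<^sub>2" "W\<^sub>1 \<inter> W\<^sub>2 = {}"
    using sub disj by blast+
  have finW: "finite W\<^sub>1" "finite W\<^sub>2"
    using sub fin finite_subset by blast+
  have Con: "Con r (V\<^sub>1 \<union> V\<^sub>2) (E\<^sub>1 \<union> E\<^sub>2) = Con r V\<^sub>1 E\<^sub>1 \<union> Con r V\<^sub>2 E\<^sub>2"
    by (intro Con_union) auto
  have "c = W\<^sub>1" if "c \<in> Con r V\<^sub>1 E\<^sub>1" "c \<subseteq> W\<^sub>1 \<union> W\<^sub>2" for c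
  proof (rule card_subset_eq[OF finW(1)])
    show "c \<subseteq> W\<^sub>1"
      using that sub(2) disj by (auto simp: Con_def)
  qed (use that sub in \<open>simp add: Con_def\<close>)
  moreover have "c = W\<^sub>2" if "c \<in> Con r V\<^sub>2 E\<^sub>2" "c \<subseteq> W\<^sub>1 \<union> W\<^sub>2" for c
  proof (rule card_subset_eq[OF finW(2)])
    show "c \<subseteq> W\<^sub>2"
      using that sub(1) disj by (auto simp: Con_def)
  qed (use that sub in \<open>simp add: Con_def\<close>)
  ultimately have "{c \<in> Con r (V\<^sub>1 \<union> V\<^sub>2) (E\<^sub>1 \<union> E\<^sub>2). c \<subseteq> \<Union>{W\<^sub>1, W\<^sub>2}} = {W\<^sub>1, W\<^sub>2}"
    unfolding Con using W by auto
  then have "induced_matching (Con r (V\<^sub>1 \<union> V\<^sub>2) (E\<^sub>1 \<union> E\<^sub>2)) {W\<^sub>1, W\<^sub>2}"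
    using W ne unfolding induced_matching_def Con by (auto simp: disjoint_def)
  then have "card {W\<^sub>1, W\<^sub>2} \<le> 1"
    using assms unfolding gap_free_def by blast
  then show False
    using ne(1) by simp
qed

theorem gap_free_imp_splittable:
  assumes "cograph V E" "gap_free r V E" "2 \<le> r"
  shows "splittable r (Con r V E)"
proof -
  have "eliminable r E V"
    using assms
  proof (induction rule: cograph.induct)
    case (single v)
    have "card c \<le> 1" if "c \<subseteq> {v}" for c
      using that card_mono[of "{v}" c] by simp
    then have "Con r {v} {} = {}"
      using \<open>2 \<le> r\<close> unfolding Con_def by (metis (mono_tags, lifting) empty_Collect_eq not_less_eq_eq numeral_2_eq_2 One_nat_def)
    then show ?case
      by (rule eliminable.empty)
  next
    case (disjoint_union V\<^sub>1 E\<^sub>1 V\<^sub>2 E\<^sub>2)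
    interpret graph_pair V\<^sub>1 V\<^sub>2 E\<^sub>1 E\<^sub>2
      using disjoint_union by (intro cograph_graph_pair)
    have fin: "finite V\<^sub>1" "finite V\<^sub>2"
      using disjoint_union.hyps cograph_finite by auto
    have Con: "Con r (V\<^sub>1 \<union> V\<^sub>2) (E\<^sub>1 \<union> E\<^sub>2) = Con r V\<^sub>1 E\<^sub>1 \<union> Con r V\<^sub>2 E\<^sub>2"
      by (intro Con_union) auto
    show ?case
    proof (cases "Con r V\<^sub>2 E\<^sub>2 = {}")
      case True
      then have "gap_free r V\<^sub>1 E\<^sub>1"
        using Con by (intro gap_free_induced[OF disjoint_union.prems(1)]) (auto simp: Con_def)
      then show ?thesis
        using disjoint_union True by (intro eliminable_union) auto
    next
      case False
      then have 1: "Con r V\<^sub>1 E\<^sub>1 = {}"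
        using gap_free_union disjoint_union.prems fin by blast
      then have "gap_free r V\<^sub>2 E\<^sub>2"
        using Con by (intro gap_free_induced[OF disjoint_union.prems(1)]) (auto simp: Con_def)
      then have "eliminable r (E\<^sub>2 \<union> E\<^sub>1) (V\<^sub>2 \<union> V\<^sub>1)"
        using disjoint_union 1 by (intro graph_pair.eliminable_union[OF swap]) auto
      then show ?thesis
        by (simp add: Un_commute)
    qed
  next
    case (join V\<^sub>1 E\<^sub>1 V\<^sub>2 E\<^sub>2)
    interpret graph_pair V\<^sub>1 V\<^sub>2 E\<^sub>1 E\<^sub>2
      using join by (intro cograph_graph_pair)
    have G: "gap_free r (V\<^sub>1 \<union> V\<^sub>2) join_E"
      using join.prems by (simp add: join_edges_def)
    have "gap_free r V\<^sub>1 E\<^sub>1"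
      using Con_join_left[of V\<^sub>1 r] by (intro gap_free_induced[OF G]) (auto simp: Con_def)
    moreover have "gap_free r V\<^sub>2 E\<^sub>2"
      using graph_pair.Con_join_left[OF swap, of V\<^sub>2 r]
      by (intro gap_free_induced[OF G]) (auto simp: Con_def join_E_commute)
    ultimately have "eliminable r join_E (V\<^sub>1 \<union> V\<^sub>2)"
      using join cograph_finite by (intro eliminable_join) auto
    then show ?case
      by (simp add: join_edges_def)
  qed
  then show ?thesis
    using eliminable_imp_splittable[OF assms(1), of "r - 1" V] assms(3) by simp
qed

section \<open>Isolated pairs of circuits\<close>

definition isolated_pair :: "'a set set \<Rightarrow> 'a set \<Rightarrow> 'a set \<Rightarrow> bool" where
  "isolated_pair C W\<^sub>1 W\<^sub>2 \<longleftrightarrow>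
     W\<^sub>1 \<inter> W\<^sub>2 = {} \<and> {c \<in> C. c \<subseteq> W\<^sub>1 \<union> W\<^sub>2} = {W\<^sub>1, W\<^sub>2}"

text \<open>Any two members of the matching already form an induced one: a circuit inside their
  union belongs to \<open>M\<close>, and as it is nonempty and disjoint from all other members it is
  one of the two.\<close>

lemma not_gap_free_imp_isolated_pair:
  assumes "\<not> gap_free r V E"
  obtains W\<^sub>1 W\<^sub>2 where "isolated_pair (Con r V E) W\<^sub>1 W\<^sub>2"
proof -
  obtain M where M: "induced_matching (Con r V E) M" "\<not> (finite M \<and> card M \<le> 1)"
    using assms by (auto simp: gap_free_def)
  \<comment> \<open>An infinite \<open>M\<close> has \<open>card M = 0\<close>, so the finiteness
    clause matters; either failure yields two members.\<close>
  have "\<exists>W\<^sub>1\<in>M. \<exists>W\<^sub>2\<in>M. W\<^sub>1 \<noteq> W\<^sub>2"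
  proof (rule ccontr)
    assume "\<not> ?thesis"
    then have "M = {} \<or> (\<exists>W. M = {W})"
      by blast
    then show False
      using M(2) by auto
  qed
  then obtain W\<^sub>1 W\<^sub>2 where W: "W\<^sub>1 \<in> M" "W\<^sub>2 \<in> M" "W\<^sub>1 \<noteq> W\<^sub>2"
    by blast
  have disj: "c \<inter> d = {}" if "c \<in> M" "d \<in> M" "c \<noteq> d" for c d
    using M(1) that by (auto simp: induced_matching_def disjoint_def)
  have "c = W\<^sub>1 \<or> c = W\<^sub>2" if c: "c \<in> Con r V E" "c \<subseteq> W\<^sub>1 \<union> W\<^sub>2" for c
  proof -
    have "c \<in> M"
      using M(1) c W unfolding induced_matching_def by blast
    moreover have "c \<noteq> {}"
      using c by (auto simp: Con_def induced_connected_def)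
    ultimately show ?thesis
      using disj[of c W\<^sub>1] disj[of c W\<^sub>2] W c(2) by blast
  qed
  moreover have "W\<^sub>1 \<in> Con r V E" "W\<^sub>2 \<in> Con r V E"
    using W M(1) by (auto simp: induced_matching_def)
  ultimately have "isolated_pair (Con r V E) W\<^sub>1 W\<^sub>2"
    using disj W unfolding isolated_pair_def by auto
  then show ?thesis
    by (rule that)
qed

section \<open>Pairs of facets in vertex decomposable complexes\<close>

lemma facet_above:
  assumes "finite \<Delta>" "\<sigma> \<in> \<Delta>"
  obtains F where "F \<in> facets \<Delta>" "\<sigma> \<subseteq> F"
proof -
  obtain F where "F \<in> \<Delta>" "\<sigma> \<subseteq> F" "\<forall>G\<in>\<Delta>. F \<subseteq> G \<longrightarrow> F = G"
    using finite_has_maximal2[OF assms] by blast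
  then have "F \<in> facets \<Delta>"
    unfolding facets_def by auto
  then show ?thesis
    using \<open>\<sigma> \<subseteq> F\<close> that by blast
qed

text \<open>The shedding condition in its other familiar form: deleting \<open>v\<close> creates no
  new facets.\<close>

lemma facet_vertex_deletion:
  assumes "shedding_vertex \<Delta> v" and closed: "\<And>\<sigma> \<tau>. \<lbrakk>\<sigma> \<in> \<Delta>; \<tau> \<subseteq> \<sigma>\<rbrakk> \<Longrightarrow> \<tau> \<in> \<Delta>"
    and F: "F \<in> facets (vertex_deletion \<Delta> v)"
  shows "F \<in> facets \<Delta>"
proof -
  have "G = F" if G: "G \<in> \<Delta>" "F \<subseteq> G" for G
  proof (cases "v \<in> G")
    case True
    have "insert v F \<in> \<Delta>"
      using closed[OF G(1)] G(2) True by blast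
    then have "F \<in> vertex_link \<Delta> v"
      using F by (auto simp: vertex_link_def facets_def vertex_deletion_def)
    then show ?thesis
      using assms(1) F by (auto simp: shedding_vertex_def)
  next
    case False
    then show ?thesis
      using F G by (auto simp: facets_def vertex_deletion_def)
  qed
  then show ?thesis
    using F by (auto simp: facets_def vertex_deletion_def)
qed

text \<open>The link of \<open>F \<inter> F'\<close> is the disjoint union of the simplices on \<open>F - F'\<close> and \<open>F' - F\<close>.
  Shedding a vertex of one of them leaves a face that must lie in the other, so this simplex is a
  single vertex.\<close>

lemma vertex_decomposable_facet_pair:
  assumes "vertex_decomposable \<Delta>" "finite \<Delta>" "\<And>\<sigma> \<tau>. \<lbrakk>\<sigma> \<in> \<Delta>; \<tau> \<subseteq> \<sigma>\<rbrakk> \<Longrightarrow> \<tau> \<in> \<Delta>"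
    and "F \<in> facets \<Delta>" "F' \<in> facets \<Delta>" "F \<noteq> F'"
    and "\<And>H. \<lbrakk>H \<in> facets \<Delta>; F \<inter> F' \<subseteq> H\<rbrakk> \<Longrightarrow> H = F \<or> H = F'"
  shows "card (F - F') = 1 \<or> card (F' - F) = 1"
  using assms
proof (induction arbitrary: F F')
  case void
  then show ?case
    by (simp add: facets_def)
next
  case (simplex G)
  have "facets (Pow G) = {G}"
    by (auto simp: facets_def)
  then show ?case
    using simplex.prems by simp
next
  case (shed \<Delta> v)
  note closed = shed.prems(2)
  let ?L = "vertex_link \<Delta> v" and ?D = "vertex_deletion \<Delta> v"
  have F: "F \<in> \<Delta>" "\<And>G. \<lbrakk>G \<in> \<Delta>; F \<subseteq> G\<rbrakk> \<Longrightarrow> G = F"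
    and F': "F' \<in> \<Delta>" "\<And>G. \<lbrakk>G \<in> \<Delta>; F' \<subseteq> G\<rbrakk> \<Longrightarrow> G = F'"
    using shed.prems by (auto simp: facets_def)
  have sub: "?L \<subseteq> \<Delta>" "?D \<subseteq> \<Delta>"
    using closed by (auto simp: vertex_link_def vertex_deletion_def)
  have closedL: "\<tau> \<in> ?L" if "\<sigma> \<in> ?L" "\<tau> \<subseteq> \<sigma>" for \<sigma> \<tau>
    using that closed[of "insert v \<sigma>" "insert v \<tau>"] by (auto simp: vertex_link_def)
  have closedD: "\<tau> \<in> ?D" if "\<sigma> \<in> ?D" "\<tau> \<subseteq> \<sigma>" for \<sigma> \<tau>
    using that closed[of \<sigma> \<tau>] by (auto simp: vertex_deletion_def)
  have one_sided: "G - G' = {v}"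
    if "v \<in> G" "v \<notin> G'" and G: "G \<in> facets \<Delta>"
      and H: "\<And>H. \<lbrakk>H \<in> facets \<Delta>; G \<inter> G' \<subseteq> H\<rbrakk> \<Longrightarrow> H = G \<or> H = G'" for G G'
  proof -
    have "G - {v} \<in> ?L"
      using that by (auto simp: vertex_link_def facets_def insert_absorb)
    moreover have "G - {v} \<in> ?D"
      using G closed[of G "G - {v}"] by (auto simp: vertex_deletion_def facets_def)
    ultimately obtain K where K: "K \<in> facets ?D" "G - {v} \<subseteq> K"
      using facet_above[of ?D "G - {v}"] finite_subset[OF sub(2) shed.prems(1)] by blast
    then have "K = G \<or> K = G'"
      using facet_vertex_deletion[OF shed.hyps(1) closed K(1)] that(2) by (intro H) auto
    moreover have "v \<notin> K"
      using K(1) by (simp add: facets_def vertex_deletion_def)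
    ultimately have "G - {v} \<subseteq> G'"
      using K(2) that(1) by auto
    then show ?thesis
      using that(1,2) by blast
  qed
  consider "v \<in> F" "v \<in> F'" | "v \<notin> F" "v \<notin> F'" | "v \<in> F" "v \<notin> F'" | "v \<notin> F" "v \<in> F'"
    by blast
  then show ?case
  proof cases
    case 1
    have link_facet: "G - {v} \<in> facets ?L" if "G \<in> facets \<Delta>" "v \<in> G" for G
    proof -
      have "K = G - {v}" if "K \<in> ?L" "G - {v} \<subseteq> K" for K
      proof -
        have "insert v K = G"
          using \<open>G \<in> facets \<Delta>\<close> \<open>v \<in> G\<close> that by (auto simp: facets_def vertex_link_def)
        then show ?thesis
          using that(1) by (auto simp: vertex_link_def)
      qed
      then show ?thesis
        using that by (auto simp: facets_def vertex_link_def insert_absorb)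
    qed
    have lift_facet: "insert v H \<in> facets \<Delta>" "v \<notin> H" if "H \<in> facets ?L" for H
    proof -
      have "K = insert v H" if "K \<in> \<Delta>" "insert v H \<subseteq> K" for K
      proof -
        have "K - {v} \<in> ?L" "H \<subseteq> K - {v}"
          using that \<open>H \<in> facets ?L\<close> by (auto simp: vertex_link_def facets_def insert_absorb)
        then have "K - {v} = H"
          using \<open>H \<in> facets ?L\<close> by (auto simp: facets_def)
        then show ?thesis
          using that by blast
      qed
      then show "insert v H \<in> facets \<Delta>" "v \<notin> H"
        using that by (auto simp: facets_def vertex_link_def)
    qed
    have "card (F - {v} - (F' - {v})) = 1 \<or> card (F' - {v} - (F - {v})) = 1"
    proof (rule shed.IH(1))
      show "finite ?L"
        using sub(1) shed.prems(1) finite_subset by blast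
      show "F - {v} \<noteq> F' - {v}"
        using 1 shed.prems(5) by blast
      fix H assume H: "H \<in> facets ?L" "(F - {v}) \<inter> (F' - {v}) \<subseteq> H"
      have "insert v H = F \<or> insert v H = F'"
        using lift_facet[OF H(1)] H(2) by (intro shed.prems(6)) auto
      then show "H = F - {v} \<or> H = F' - {v}"
        using lift_facet(2)[OF H(1)] by blast
    qed (use closedL link_facet 1 shed.prems in auto)
    moreover have "F - {v} - (F' - {v}) = F - F'" "F' - {v} - (F - {v}) = F' - F"
      using 1 by auto
    ultimately show ?thesis
      by simp
  next
    case 2
    have del_facet: "G \<in> facets ?D" if "G \<in> facets \<Delta>" "v \<notin> G" for G
      using that by (auto simp: facets_def vertex_deletion_def)
    show ?thesis
    proof (rule shed.IH(2))
      show "finite ?D"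
        using sub(2) shed.prems(1) finite_subset by blast
      show "F \<noteq> F'"
        by (rule shed.prems(5))
      fix H assume "H \<in> facets ?D" "F \<inter> F' \<subseteq> H"
      then show "H = F \<or> H = F'"
        using facet_vertex_deletion[OF shed.hyps(1) closed] by (intro shed.prems(6)) auto
    qed (use closedD del_facet 2 shed.prems in auto)
  next
    case 3
    then show ?thesis
      using one_sided[OF 3 shed.prems(3,6)] by simp
  next
    case 4
    have "F' - F = {v}"
      using shed.prems(6) by (intro one_sided[OF 4(2,1) shed.prems(4)]) (auto simp: Int_commute)
    then show ?thesis
      by simp
  qed
qed

text \<open>Graphs are left aside from here on: the negative results concern any uniform clutter
  with an isolated pair.\<close>

locale isolated_circuits =
  fixes U :: "'a set" and C :: "'a set set" and d :: nat and W\<^sub>1 W\<^sub>2 :: "'a set"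
  assumes fin: "finite U" and uniform: "\<And>c. c \<in> C \<Longrightarrow> c \<subseteq> U \<and> card c = d"
    and d: "2 \<le> d" and pair: "isolated_pair C W\<^sub>1 W\<^sub>2"
begin

lemma circuits: "W\<^sub>1 \<in> C" "W\<^sub>2 \<in> C" "W\<^sub>1 \<inter> W\<^sub>2 = {}"
  using pair by (auto simp: isolated_pair_def)

lemma isolated: "c \<in> C \<Longrightarrow> c \<subseteq> W\<^sub>1 \<union> W\<^sub>2 \<Longrightarrow> c = W\<^sub>1 \<or> c = W\<^sub>2"
  using pair by (auto simp: isolated_pair_def)

lemma subsets: "W\<^sub>1 \<subseteq> U" "W\<^sub>2 \<subseteq> U" "card W\<^sub>1 = d" "card W\<^sub>2 = d" "finite W\<^sub>1" "finite W\<^sub>2"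
  using uniform[OF circuits(1)] uniform[OF circuits(2)] finite_subset[OF _ fin] by simp_all

lemma swap: "isolated_circuits U C d W\<^sub>2 W\<^sub>1"
  using fin uniform d pair by unfold_locales (auto simp: isolated_pair_def Un_commute insert_commute)

lemma facets: "facets (cocomplex U C) = (\<lambda>c. U - c) ` C"
  using fin uniform by (intro facets_cocomplex) auto

lemma facet_pair:
  assumes "c \<in> C" "U - (W\<^sub>1 \<union> W\<^sub>2) \<subseteq> U - c"
  shows "U - c = U - W\<^sub>1 \<or> U - c = U - W\<^sub>2"
  using assms isolated[of c] uniform[of c] by blast

lemma diff: "U - W\<^sub>1 - (U - W\<^sub>2) = W\<^sub>2" "U - W\<^sub>2 - (U - W\<^sub>1) = W\<^sub>1"
  "(U - W\<^sub>1) \<inter> (U - W\<^sub>2) = U - (W\<^sub>1 \<union> W\<^sub>2)"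
  using subsets circuits by auto

lemma nonempty: "W\<^sub>1 \<noteq> {}" "W\<^sub>2 \<noteq> {}"
  using subsets d by auto

lemma facets_distinct: "U - W\<^sub>1 \<noteq> U - W\<^sub>2"
  using subsets nonempty circuits(3) by blast

lemma not_vertex_decomposable: "\<not> vertex_decomposable (cocomplex U C)"
proof
  assume VD: "vertex_decomposable (cocomplex U C)"
  have "card (U - W\<^sub>1 - (U - W\<^sub>2)) = 1 \<or> card (U - W\<^sub>2 - (U - W\<^sub>1)) = 1"
  proof (rule vertex_decomposable_facet_pair[OF VD])
    show "finite (cocomplex U C)"
      using fin by (rule_tac finite_subset[of _ "Pow U"]) (auto simp: cocomplex_def)
    show "\<tau> \<in> cocomplex U C" if "\<sigma> \<in> cocomplex U C" "\<tau> \<subseteq> \<sigma>" for \<sigma> \<tau>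
      using that by (auto simp: cocomplex_def)
    show "H = U - W\<^sub>1 \<or> H = U - W\<^sub>2"
      if H: "H \<in> facets (cocomplex U C)" "(U - W\<^sub>1) \<inter> (U - W\<^sub>2) \<subseteq> H" for H
    proof -
      obtain c where "c \<in> C" "H = U - c"
        using H facets by blast
      then show ?thesis
        using H facet_pair unfolding diff by blast
    qed
  qed (use facets circuits facets_distinct in auto)
  then show False
    using d subsets by (simp add: diff)
qed

text \<open>By isolation, \<open>U - W\<^sub>2\<close> is the only earlier facet above
  \<open>U - (W\<^sub>1 \<union> W\<^sub>2)\<close>. So that intersection is itself maximal among
  the old faces of \<open>U - W\<^sub>1\<close>, where its codimension is \<open>d \<ge> 2\<close>
  instead of 1.\<close>

lemma not_later_in_shelling:
  assumes dist: "distinct Fs" and Fs: "set Fs = Defs.facets (cocomplex U C)"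
    and shell: "\<forall>i<length Fs. 0 < i \<longrightarrow>
       (\<forall>\<sigma>\<in>Defs.facets (Pow (Fs ! i) \<inter> (\<Union>j<i. Pow (Fs ! j))). card \<sigma> + 1 = card (Fs ! i))"
    and i: "i < length Fs" "Fs ! i = U - W\<^sub>1" and j: "j < i" "Fs ! j = U - W\<^sub>2"
  shows False
proof -
  let ?S = "Pow (Fs ! i) \<inter> (\<Union>j<i. Pow (Fs ! j))"
  have "U - (W\<^sub>1 \<union> W\<^sub>2) \<in> ?S"
    using i j by auto
  moreover have "finite ?S"
    using i(2) fin by simp
  ultimately obtain \<tau> where \<tau>: "\<tau> \<in> Defs.facets ?S" "U - (W\<^sub>1 \<union> W\<^sub>2) \<subseteq> \<tau>"
    using facet_above by metis
  then have card: "card \<tau> + 1 = card (U - W\<^sub>1)"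
    using shell i j(1) by (metis bot_nat_0.not_eq_extremum not_less_zero)
  obtain k where k: "k < i" "\<tau> \<subseteq> Fs ! k" "\<tau> \<subseteq> U - W\<^sub>1"
    using \<tau>(1) i(2) by (auto simp: facets_def)
  then obtain c where c: "c \<in> C" "Fs ! k = U - c"
    using Fs i(1) facets nth_mem[of k Fs] by auto
  have "U - (W\<^sub>1 \<union> W\<^sub>2) \<subseteq> U - c"
    using \<tau>(2) k(2) c(2) by (metis subset_trans)
  then have "Fs ! k = U - W\<^sub>1 \<or> Fs ! k = U - W\<^sub>2"
    using facet_pair c by metis
  moreover have "Fs ! k \<noteq> Fs ! i"
    using dist i(1) k(1) by (simp add: nth_eq_iff_index_eq)
  ultimately have "\<tau> \<subseteq> U - (W\<^sub>1 \<union> W\<^sub>2)"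
    using k(2,3) i(2) by auto
  then have "\<tau> = U - W\<^sub>1 - W\<^sub>2"
    using \<tau>(2) by blast
  then have "card \<tau> = card (U - W\<^sub>1) - card W\<^sub>2"
    using subsets circuits(3) by (subst \<open>\<tau> = _\<close>, intro card_Diff_subset) auto
  moreover have "card W\<^sub>2 \<le> card (U - W\<^sub>1)"
    using subsets circuits(3) fin by (intro card_mono) auto
  ultimately show False
    using card subsets(4) d by simp
qed

lemma not_shellable: "\<not> shellable (cocomplex U C)"
proof
  assume "shellable (cocomplex U C)"
  then obtain Fs where Fs: "distinct Fs" "set Fs = facets (cocomplex U C)"
    and shell: "\<forall>i<length Fs. 0 < i \<longrightarrow>
       (\<forall>\<sigma>\<in>Defs.facets (Pow (Fs ! i) \<inter> (\<Union>j<i. Pow (Fs ! j))). card \<sigma> + 1 = card (Fs ! i))"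
    unfolding shellable_def by blast
  have "U - W\<^sub>1 \<in> set Fs" "U - W\<^sub>2 \<in> set Fs"
    using Fs(2) facets circuits by auto
  then obtain i j where ij: "i < length Fs" "Fs ! i = U - W\<^sub>1" "j < length Fs" "Fs ! j = U - W\<^sub>2"
    by (metis in_set_conv_nth)
  then have "i \<noteq> j"
    using facets_distinct by auto
  then show False
    using not_later_in_shelling[OF Fs shell ij(1,2)] ij
      isolated_circuits.not_later_in_shelling[OF swap Fs shell ij(3,4)]
    by (metis linorder_neqE_nat)
qed

end

section \<open>Chordality and induced subclutters\<close>

text \<open>A subcircuit not contained in \<open>V\<close> deletes no circuit inside
  \<open>V\<close>; the other steps of the elimination restrict, since closed neighbourhoods only
  shrink.\<close>

lemma chordal_clutter_induced:
  assumes "chordal_clutter d U C" "V \<subseteq> U"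
  shows "chordal_clutter d V {c \<in> C. c \<subseteq> V}"
  using assms
proof induction
  case no_circuits
  then show ?case
    using chordal_clutter.no_circuits by simp
next
  case (delete C Z)
  have eq: "{c \<in> {c \<in> C. c \<subseteq> V}. \<not> Z \<subseteq> c} = {c \<in> {c \<in> C. \<not> Z \<subseteq> c}. c \<subseteq> V}"
    by blast
  show ?case
  proof (cases "Z \<subseteq> V")
    case True
    have "closed_nbhd {c \<in> C. c \<subseteq> V} Z \<subseteq> closed_nbhd C Z" "closed_nbhd {c \<in> C. c \<subseteq> V} Z \<subseteq> V"
      using True by (auto simp: closed_nbhd_def)
    moreover from this have "clutter_clique d {c \<in> C. c \<subseteq> V} (closed_nbhd {c \<in> C. c \<subseteq> V} Z)"
      using delete.hyps(1) unfolding simplicial_subcircuit_def clutter_clique_def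
      by (metis (no_types, lifting) mem_Collect_eq subset_trans)
    ultimately have "simplicial_subcircuit d V {c \<in> C. c \<subseteq> V} Z"
      using delete.hyps(1) True unfolding simplicial_subcircuit_def by blast
    then show ?thesis
      using delete.IH[OF delete.prems] unfolding eq[symmetric] by (rule chordal_clutter.delete)
  next
    case False
    then have "{c \<in> {c \<in> C. \<not> Z \<subseteq> c}. c \<subseteq> V} = {c \<in> C. c \<subseteq> V}"
      by blast
    then show ?thesis
      using delete.IH[OF delete.prems] by simp
  qed
qed

context isolated_circuits
begin

text \<open>For \<open>x \<in> W\<^sub>2\<close> the set \<open>insert x Z\<close> is neither
  \<open>W\<^sub>1\<close> nor \<open>W\<^sub>2\<close>, so all of \<open>W\<^sub>2\<close> lies in
  the neighbourhood of \<open>Z\<close> in the complementary clutter. A clique there would make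
  \<open>W\<^sub>2\<close> a non-circuit.\<close>

lemma not_subset_imp_not_simplicial:
  assumes Z: "simplicial_subcircuit d V {e. e \<subseteq> W\<^sub>1 \<union> W\<^sub>2 \<and> card e = d \<and> e \<notin> C} Z"
    and "Z \<subseteq> W\<^sub>1 \<union> W\<^sub>2" "\<not> Z \<subseteq> W\<^sub>2"
  shows False
proof -
  let ?D = "{e. e \<subseteq> W\<^sub>1 \<union> W\<^sub>2 \<and> card e = d \<and> e \<notin> C}"
  have Z': "finite Z" "card Z + 1 = d" "clutter_clique d ?D (closed_nbhd ?D Z)"
    using Z by (auto simp: simplicial_subcircuit_def)
  have "x \<in> closed_nbhd ?D Z" if x: "x \<in> W\<^sub>2" for x
  proof (cases "x \<in> Z")
    case True
    then show ?thesis
      by (simp add: closed_nbhd_def)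
  next
    case False
    have "insert x Z \<noteq> W\<^sub>1"
      using x circuits(3) by blast
    moreover have "insert x Z \<noteq> W\<^sub>2"
      using assms(3) by blast
    ultimately have "insert x Z \<notin> C"
      using isolated[of "insert x Z"] x assms(2) by blast
    then have "insert x Z \<in> ?D"
      using x assms(2) False Z' by simp
    then show ?thesis
      using False unfolding closed_nbhd_def by blast
  qed
  then have "W\<^sub>2 \<in> ?D"
    using Z'(3) subsets(4) unfolding clutter_clique_def by blast
  then show False
    using circuits by blast
qed

lemma not_co_chordal: "\<not> co_chordal d U C"
proof
  let ?W = "W\<^sub>1 \<union> W\<^sub>2"
  let ?D = "{e. e \<subseteq> ?W \<and> card e = d \<and> e \<notin> C}"
  assume "co_chordal d U C"
  then have "chordal_clutter d ?W {c \<in> {e. e \<subseteq> U \<and> card e = d \<and> e \<notin> C}. c \<subseteq> ?W}"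
    unfolding co_chordal_def using subsets by (intro chordal_clutter_induced) auto
  moreover have "{c \<in> {e. e \<subseteq> U \<and> card e = d \<and> e \<notin> C}. c \<subseteq> ?W} = ?D"
    using subsets by auto
  ultimately have "chordal_clutter d ?W ?D"
    by simp
  then show False
  proof cases
    case no_circuits
    \<comment> \<open>Trading one vertex of \<open>W\<^sub>1\<close> for one of
      \<open>W\<^sub>2\<close> gives a non-circuit, because \<open>d \<ge> 2\<close> leaves a second
      vertex of \<open>W\<^sub>1\<close> in it.\<close>
    obtain a b where ab: "a \<in> W\<^sub>1" "b \<in> W\<^sub>2"
      using nonempty by blast
    let ?e = "insert b (W\<^sub>1 - {a})"
    have b: "b \<notin> W\<^sub>1"
      using ab circuits(3) by blast
    have card: "card ?e = d"
      using b ab subsets card_Suc_Diff1[of W\<^sub>1 a] by simp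
    have "card (W\<^sub>1 - {a}) \<noteq> 0"
      using ab subsets d by simp
    then obtain a' where "a' \<in> W\<^sub>1 - {a}"
      by (metis card.empty ex_in_conv)
    then have "a' \<in> ?e" "a' \<notin> W\<^sub>2"
      using circuits(3) by auto
    then have "?e \<noteq> W\<^sub>1" "?e \<noteq> W\<^sub>2"
      using b by blast+
    then have "?e \<in> ?D"
      using isolated[of ?e] card ab by auto
    then show False
      using no_circuits by blast
  next
    case (delete Z)
    then have Z: "Z \<subseteq> W\<^sub>1 \<union> W\<^sub>2" "card Z + 1 = d"
      by (auto simp: simplicial_subcircuit_def)
    then have "Z \<noteq> {}"
      using d by auto
    \<comment> \<open>Since \<open>d \<ge> 2\<close> makes \<open>Z\<close> nonempty, it cannot lie
      in both of two disjoint sets.\<close>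
    then have "\<not> Z \<subseteq> W\<^sub>1 \<or> \<not> Z \<subseteq> W\<^sub>2"
      using circuits(3) by blast
    then show False
    proof
      assume "\<not> Z \<subseteq> W\<^sub>1"
      moreover have "simplicial_subcircuit d ?W {e. e \<subseteq> W\<^sub>2 \<union> W\<^sub>1 \<and> card e = d \<and> e \<notin> C} Z"
        using delete(1) by (simp add: Un_commute)
      ultimately show False
        using isolated_circuits.not_subset_imp_not_simplicial[OF swap, of ?W Z] Z(1) by blast
    qed (rule not_subset_imp_not_simplicial[OF delete(1) Z(1)])
  qed
qed

end

section \<open>Weakly regular sequences\<close>

text \<open>Ideals are plain subsets of a ring type here, so that its sums and simplification rules
  apply; \<open>ideal_type_algebra_iff\<close> leads back to carriers.\<close>

definition is_ideal :: "'r::comm_ring_1 set \<Rightarrow> bool" where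
  "is_ideal I \<longleftrightarrow> 0 \<in> I \<and> (\<forall>a\<in>I. \<forall>b\<in>I. a + b \<in> I) \<and> (\<forall>a\<in>I. \<forall>r. r * a \<in> I)"

definition adjoin :: "'r::comm_ring_1 set \<Rightarrow> 'r \<Rightarrow> 'r set" where
  "adjoin I x = {a. \<exists>b. a - x * b \<in> I}"

definition colon :: "'r::comm_ring_1 set \<Rightarrow> 'r \<Rightarrow> 'r set" where
  "colon I x = {a. x * a \<in> I}"

text \<open>Properness is kept apart, so that the unit ideal, the face ideal of the void complex,
  can end a recursion. It returns in \<open>regular_sequence_iff\<close>.\<close>

fun weakly_regular :: "'r::comm_ring_1 set \<Rightarrow> 'r list \<Rightarrow> bool" where
  "weakly_regular I [] \<longleftrightarrow> True"
| "weakly_regular I (y # ys) \<longleftrightarrow> colon I y \<subseteq> I \<and> weakly_regular (adjoin I y) ys"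

lemma is_idealI:
  assumes "0 \<in> I" "\<And>a b. \<lbrakk>a \<in> I; b \<in> I\<rbrakk> \<Longrightarrow> a + b \<in> I" "\<And>a r. a \<in> I \<Longrightarrow> r * a \<in> I"
  shows "is_ideal I"
  using assms by (auto simp: is_ideal_def)

context
  fixes I :: "'r::comm_ring_1 set"
  assumes I: "is_ideal I"
begin

lemma ideal_0: "0 \<in> I"
  using I by (simp add: is_ideal_def)

lemma ideal_add: "a \<in> I \<Longrightarrow> b \<in> I \<Longrightarrow> a + b \<in> I"
  using I by (simp add: is_ideal_def)

lemma ideal_mult_left: "a \<in> I \<Longrightarrow> r * a \<in> I"
  using I by (simp add: is_ideal_def)

lemma ideal_mult_right: "a \<in> I \<Longrightarrow> a * r \<in> I"
  using ideal_mult_left[of a r] by (simp add: mult.commute)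

lemma ideal_uminus: "a \<in> I \<Longrightarrow> - a \<in> I"
  using ideal_mult_left[of a "-1"] by simp

lemma ideal_diff: "a \<in> I \<Longrightarrow> b \<in> I \<Longrightarrow> a - b \<in> I"
  using ideal_add[of a "- b"] ideal_uminus[of b] by simp

lemma ideal_sum: "(\<And>x. x \<in> A \<Longrightarrow> f x \<in> I) \<Longrightarrow> sum f A \<in> I"
  by (induction A rule: infinite_finite_induct) (auto intro: ideal_0 ideal_add)

lemma ideal_cong: "a - b \<in> I \<Longrightarrow> a \<in> I \<longleftrightarrow> b \<in> I"
  using ideal_add[of "a - b" b] ideal_diff[of a "a - b"] by auto

lemma ideal_eq_UNIV: "1 \<in> I \<Longrightarrow> I = UNIV"
  using ideal_mult_left[of 1] by auto

lemma adjoin_subset: "I \<subseteq> adjoin I x"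
  by (auto simp: adjoin_def intro!: exI[of _ 0])

lemma adjoin_mult: "x * b \<in> adjoin I x"
  by (auto simp: adjoin_def ideal_0 intro!: exI[of _ b])

lemma adjoin_self: "x \<in> adjoin I x"
  using adjoin_mult[of x 1] by simp

lemma adjoin_is_ideal: "is_ideal (adjoin I x)"
proof (rule is_idealI)
  show "0 \<in> adjoin I x"
    using ideal_0 adjoin_subset by blast
next
  fix a b assume "a \<in> adjoin I x" "b \<in> adjoin I x"
  then obtain c d where "a - x * c \<in> I" "b - x * d \<in> I"
    by (auto simp: adjoin_def)
  then have "(a + b) - x * (c + d) \<in> I"
    using ideal_add[of "a - x * c" "b - x * d"] by (simp add: algebra_simps)
  then show "a + b \<in> adjoin I x"
    unfolding adjoin_def by blast
next
  fix a r assume "a \<in> adjoin I x"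
  then obtain c where "a - x * c \<in> I"
    by (auto simp: adjoin_def)
  then have "r * a - x * (r * c) \<in> I"
    using ideal_mult_left[of "a - x * c" r] by (simp add: algebra_simps)
  then show "r * a \<in> adjoin I x"
    unfolding adjoin_def by blast
qed

lemma adjoin_cong:
  assumes "x - y \<in> I"
  shows "adjoin I x = adjoin I y"
proof -
  have "a - x * b \<in> I \<longleftrightarrow> a - y * b \<in> I" for a b
  proof (rule ideal_cong)
    show "a - x * b - (a - y * b) \<in> I"
      using ideal_mult_right[OF ideal_uminus[OF assms], of b] by (simp add: algebra_simps)
  qed
  then show ?thesis
    by (simp add: adjoin_def)
qed

lemma colon_cong:
  assumes "x - y \<in> I"
  shows "colon I x = colon I y"
proof -
  have "x * a \<in> I \<longleftrightarrow> y * a \<in> I" for a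
    using ideal_mult_right[OF assms, of a] by (intro ideal_cong) (simp add: algebra_simps)
  then show ?thesis
    by (simp add: colon_def)
qed

end

lemma adjoin_least:
  assumes "is_ideal J" "I \<subseteq> J" "x \<in> J"
  shows "adjoin I x \<subseteq> J"
proof
  fix a assume "a \<in> adjoin I x"
  then obtain b where "a - x * b \<in> J"
    using assms(2) by (auto simp: adjoin_def)
  then show "a \<in> J"
    using ideal_cong[OF assms(1)] ideal_mult_right[OF assms(1,3)] by blast
qed

lemma adjoin_mono: "I \<subseteq> J \<Longrightarrow> adjoin I x \<subseteq> adjoin J x"
  by (auto simp: adjoin_def)

lemma adjoin_commute: "adjoin (adjoin I x) y = adjoin (adjoin I y) x"
proof -
  have "adjoin (adjoin I x) y \<subseteq> adjoin (adjoin I y) x" for x y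
  proof
    fix a assume "a \<in> adjoin (adjoin I x) y"
    then obtain b c where "a - y * b - x * c \<in> I"
      by (auto simp: adjoin_def)
    then have "a - x * c - y * b \<in> I"
      by (simp add: algebra_simps)
    then show "a \<in> adjoin (adjoin I y) x"
      unfolding adjoin_def by blast
  qed
  then show ?thesis
    by blast
qed

lemma adjoin_UNIV: "adjoin UNIV x = UNIV"
  by (simp add: adjoin_def)

lemma weakly_regular_UNIV: "weakly_regular UNIV ys"
  by (induction ys) (simp_all add: adjoin_UNIV)

text \<open>The regular sequences on both ends of
  \<open>0 \<rightarrow> S/(I : x) \<rightarrow> S/I \<rightarrow> S/(I + (x)) \<rightarrow> 0\<close> are regular in the middle.\<close>

lemma weakly_regular_split:
  assumes "is_ideal I" "weakly_regular (colon I x) ys" "weakly_regular (adjoin I x) ys"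
  shows "weakly_regular I ys"
  using assms
proof (induction ys arbitrary: I)
  case (Cons y ys)
  note I = Cons.prems(1)

  have "a \<in> I" if a: "y * a \<in> I" for a
  proof -
    have "y * a \<in> adjoin I x"
      using a adjoin_subset[OF I] by blast
    then have "a \<in> adjoin I x"
      using Cons.prems(3) by (auto simp: colon_def)
    then obtain b where b: "a - x * b \<in> I"
      by (auto simp: adjoin_def)
    have "y * a - y * (a - x * b) \<in> I"
      by (intro ideal_diff[OF I] a ideal_mult_left[OF I] b)
    then have "b \<in> colon (colon I x) y"
      by (simp add: colon_def algebra_simps)
    then have "x * b \<in> I"
      using Cons.prems(2) by (auto simp: colon_def)
    then show ?thesis
      using ideal_cong[OF I b] by simp
  qed
  moreover have "weakly_regular (adjoin I y) ys"
  proof (rule Cons.IH)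
    show "is_ideal (adjoin I y)"
      by (rule adjoin_is_ideal[OF I])
    \<comment> \<open>The exact sequence stays exact modulo \<open>y\<close> because
      \<open>y\<close> is regular on the quotient by \<open>adjoin I x\<close>.\<close>
    have "colon (adjoin I y) x = adjoin (colon I x) y"
    proof
      show "adjoin (colon I x) y \<subseteq> colon (adjoin I y) x"
      proof
        fix a assume "a \<in> adjoin (colon I x) y"
        then obtain c where "x * (a - y * c) \<in> I"
          by (auto simp: adjoin_def colon_def)
        then have "x * a - y * (x * c) \<in> I"
          by (simp add: algebra_simps)
        then show "a \<in> colon (adjoin I y) x"
          unfolding adjoin_def colon_def by blast
      qed
      show "colon (adjoin I y) x \<subseteq> adjoin (colon I x) y"
      proof
        fix a assume "a \<in> colon (adjoin I y) x"
        then obtain b where b: "x * a - y * b \<in> I"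
          by (auto simp: adjoin_def colon_def)
        then have "y * b - x * a \<in> I"
          using ideal_uminus[OF I b] by simp
        then have "b \<in> adjoin I x"
          using Cons.prems(3) by (auto simp: colon_def adjoin_def)
        then obtain c where c: "b - x * c \<in> I"
          by (auto simp: adjoin_def)
        have "x * a - y * b + y * (b - x * c) \<in> I"
          by (intro ideal_add[OF I] b ideal_mult_left[OF I] c)
        then have "x * (a - y * c) \<in> I"
          by (simp add: algebra_simps)
        then show "a \<in> adjoin (colon I x) y"
          unfolding adjoin_def colon_def by blast
      qed
    qed
    then show "weakly_regular (colon (adjoin I y) x) ys"
      using Cons.prems(2) by simp
    show "weakly_regular (adjoin (adjoin I y) x) ys"
      using Cons.prems(3) by (simp add: adjoin_commute[of I y])
  qed
  ultimately show ?case
    by (auto simp: colon_def)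
qed simp

text \<open>Induction by \<open>weakly_regular_split\<close> along \<open>y\<close> itself: for
  regular \<open>y\<close>, the colon lowers the power by one and adjoining \<open>y\<close> leaves
  \<open>adjoin I y\<close>. The start is the unit ideal, as \<open>y ^ 0 = 1\<close>.\<close>

lemma weakly_regular_adjoin_power:
  assumes I: "is_ideal I" and y: "colon I y \<subseteq> I" and ys: "weakly_regular (adjoin I y) ys"
  shows "weakly_regular (adjoin I (y ^ n)) ys"
proof (induction n)
  case 0
  have "adjoin I (y ^ 0) = UNIV"
    using ideal_eq_UNIV[OF adjoin_is_ideal[OF I], of 1] adjoin_self[OF I, of 1] by simp
  then show ?case
    by (simp only: weakly_regular_UNIV)
next
  case (Suc n)
  have "colon (adjoin I (y ^ Suc n)) y = adjoin I (y ^ n)"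
  proof -
    have "y * a - y ^ Suc n * b \<in> I \<longleftrightarrow> a - y ^ n * b \<in> I" for a b
    proof -
      have "y * a - y ^ Suc n * b = y * (a - y ^ n * b)"
        by (simp add: algebra_simps)
      then show ?thesis
        using y ideal_mult_left[OF I, of _ y] by (auto simp: colon_def)
    qed
    then show ?thesis
      by (simp add: colon_def adjoin_def)
  qed
  moreover have "adjoin (adjoin I (y ^ Suc n)) y = adjoin I y"
  proof
    have "y ^ Suc n \<in> adjoin I y"
      using adjoin_mult[OF I, of y "y ^ n"] by simp
    then show "adjoin (adjoin I (y ^ Suc n)) y \<subseteq> adjoin I y"
      by (intro adjoin_least adjoin_is_ideal[OF I] adjoin_subset[OF I] adjoin_self[OF I])
    show "adjoin I y \<subseteq> adjoin (adjoin I (y ^ Suc n)) y"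
      by (intro adjoin_mono adjoin_subset[OF I])
  qed
  ultimately show ?case
    using weakly_regular_split[OF adjoin_is_ideal[OF I, of "y ^ Suc n"], of y ys] Suc ys
    by (simp only:)
qed

lemma colon_power_subset:
  assumes "is_ideal I" "colon I y \<subseteq> I"
  shows "colon I (y ^ n) \<subseteq> I"
proof (induction n)
  case (Suc n)
  have "a \<in> I" if "y ^ Suc n * a \<in> I" for a
  proof -
    have "y * (y ^ n * a) \<in> I"
      using that by (simp add: mult.assoc)
    then have "y ^ n * a \<in> I"
      using assms(2) by (auto simp: colon_def)
    then show ?thesis
      using Suc by (auto simp: colon_def)
  qed
  then show ?case
    by (auto simp: colon_def)
qed (simp add: colon_def)

text \<open>Powers push a regular sequence as deep into the irrelevant ideal as the Koszul argument
  over squares of variables requires.\<close>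

lemma weakly_regular_power:
  assumes "is_ideal I" "weakly_regular I ys"
  shows "weakly_regular I (map (\<lambda>y. y ^ n) ys)"
  using assms
proof (induction ys arbitrary: I)
  case (Cons y ys)
  have "weakly_regular (adjoin I y) (map (\<lambda>y. y ^ n) ys)"
    using Cons.prems by (intro Cons.IH adjoin_is_ideal) auto
  then have "weakly_regular (adjoin I (y ^ n)) (map (\<lambda>y. y ^ n) ys)"
    using Cons.prems by (intro weakly_regular_adjoin_power) auto
  then show ?case
    using Cons.prems colon_power_subset[of I y n] by simp
qed simp

section \<open>Independence along chains of ideals\<close>

definition exponents :: "nat \<Rightarrow> nat \<Rightarrow> nat list set" where
  "exponents N n = {es. length es = n \<and> set es \<subseteq> {..<N}}"

lemma finite_exponents: "finite (exponents N n)"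
  using finite_lists_length_eq[of "{..<N}" n] by (simp add: exponents_def conj_commute)

lemma card_exponents: "card (exponents N n) = N ^ n"
  using card_lists_length_eq[of "{..<N}" n] by (simp add: exponents_def conj_commute)

lemma exponents_0: "exponents N 0 = {[]}"
  by (auto simp: exponents_def)

lemma sum_exponents_Suc:
  "(\<Sum>es\<in>exponents N (Suc n). f es) = (\<Sum>e<N. \<Sum>es\<in>exponents N n. f (e # es))"
proof -
  have "exponents N (Suc n) = (\<lambda>(e, es). e # es) ` ({..<N} \<times> exponents N n)"
    by (auto simp: exponents_def length_Suc_conv image_iff)
  moreover have "inj_on (\<lambda>(e, es). e # es) ({..<N} \<times> exponents N n)"
    by (auto simp: inj_on_def)
  ultimately show ?thesis
    by (simp add: sum.reindex sum.cartesian_product case_prod_unfold)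
qed

fun power_product :: "'r::comm_ring_1 list \<Rightarrow> nat list \<Rightarrow> 'r" where
  "power_product (y # ys) (e # es) = y ^ e * power_product ys es"
| "power_product _ _ = 1"

text \<open>Both a chain of primes with \<open>ys ! i \<in> P (Suc i) - P i\<close> and the ideals generated by the
  initial segments of a regular sequence satisfy the assumptions: in either case the length is
  bounded by the growth of the ring modulo \<open>J 0\<close>. The relation is peeled off by its lowest power
  of the first element.\<close>

lemma chain_independent:
  assumes "\<And>i. i \<le> length ys \<Longrightarrow> is_ideal (J i)"
    and "\<And>i. i < length ys \<Longrightarrow> J i \<subseteq> J (Suc i) \<and> ys ! i \<in> J (Suc i) \<and> colon (J i) (ys ! i) \<subseteq> J i"
    and "1 \<notin> J (length ys)"
    and "\<And>es. c es = 0 \<or> c es dvd 1"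
    and "(\<Sum>es\<in>exponents N (length ys). c es * power_product ys es) \<in> J 0"
    and "es \<in> exponents N (length ys)"
  shows "c es = 0"
  using assms
proof (induction ys arbitrary: J c es)
  case Nil
  have "c [] \<in> J 0"
    using Nil.prems(5) by (simp add: exponents_0)
  then have "\<not> c [] dvd 1"
    using Nil.prems(1)[of 0] Nil.prems(3) ideal_mult_right by (metis dvdE le0 list.size(3))
  then show ?case
    using Nil.prems(4,6) by (auto simp: exponents_0)
next
  case (Cons y ys)
  define n where "n = length ys"
  define s where "s e = (\<Sum>es\<in>exponents N n. c (e # es) * power_product ys es)" for e
  have J0: "is_ideal (J 0)" and J1: "is_ideal (J 1)"
    using Cons.prems(1)[of 0] Cons.prems(1)[of 1] by auto
  have y: "y \<in> J 1" "colon (J 0) y \<subseteq> J 0" "J 0 \<subseteq> J 1"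
    using Cons.prems(2)[of 0] by auto
  have "(\<Sum>es\<in>exponents N (length (y # ys)). c es * power_product (y # ys) es) =
      (\<Sum>e<N. y ^ e * s e)"
    by (simp add: sum_exponents_Suc s_def n_def sum_distrib_left algebra_simps)
  then have sum: "(\<Sum>e<N. y ^ e * s e) \<in> J 0"
    using Cons.prems(5) by simp
  show ?case
  proof (rule ccontr)
    assume "c es \<noteq> 0"
    then obtain e es' where e: "e < N" "es' \<in> exponents N n" "c (e # es') \<noteq> 0"
      using Cons.prems(6) by (cases es) (auto simp: exponents_def n_def)
    define k where "k = (LEAST e. e < N \<and> (\<exists>es\<in>exponents N n. c (e # es) \<noteq> 0))"
    have k: "k < N \<and> (\<exists>es\<in>exponents N n. c (k # es) \<noteq> 0)"
      unfolding k_def by (rule LeastI[of _ e]) (use e in blast)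
    have s0: "s e = 0" if "e < k" for e
    proof -
      have "c (e # es) = 0" if "es \<in> exponents N n" for es
        using not_less_Least[of e "\<lambda>e. e < N \<and> (\<exists>es\<in>exponents N n. c (e # es) \<noteq> 0)"]
          \<open>e < k\<close> k that less_trans unfolding k_def by blast
      then show ?thesis
        by (simp add: s_def)
    qed
    have split: "{..<N} = {..<k} \<union> {k..<N}" "{..<k} \<inter> {k..<N} = {}" "{k..<N} = insert k {Suc k..<N}"
      using k by auto
    have "(\<Sum>e<N. y ^ e * s e) = (\<Sum>e=k..<N. y ^ e * s e)"
      using split s0 by (simp add: sum.union_disjoint)
    also have "\<dots> = y ^ k * (\<Sum>e=k..<N. y ^ (e - k) * s e)"
      unfolding sum_distrib_left
      by (intro sum.cong refl) (simp flip: power_add mult.assoc)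
    finally have "(\<Sum>e=k..<N. y ^ (e - k) * s e) \<in> J 0"
      using sum colon_power_subset[OF J0 y(2), of k] by (auto simp: colon_def)
    moreover have "(\<Sum>e=k..<N. y ^ (e - k) * s e) = s k + (\<Sum>e=Suc k..<N. y ^ (e - k) * s e)"
      unfolding split(3) by (subst sum.insert) auto
    \<comment> \<open>All terms but the lowest carry a factor \<open>y\<close> and vanish modulo
      \<open>J 1\<close>. So \<open>s k\<close> is a relation among the remaining elements, one
      ideal further up.\<close>
    moreover have "y ^ (e - k) * s e \<in> J 1" if "e \<in> {Suc k..<N}" for e
    proof -
      have "y ^ (e - k) = y * y ^ (e - Suc k)"
        using that by (metis Suc_diff_le atLeastLessThan_iff diff_Suc_Suc power_Suc Suc_le_D Suc_leD)
      then show ?thesis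
        using y(1) ideal_mult_right[OF J1] by simp
    qed
    then have "(\<Sum>e=Suc k..<N. y ^ (e - k) * s e) \<in> J 1"
      by (intro ideal_sum[OF J1])
    ultimately have sk: "s k \<in> J 1"
      using y(3) ideal_cong[OF J1, of "s k + (\<Sum>e=Suc k..<N. y ^ (e - k) * s e)" "s k"] by auto
    have "c (k # es) = 0" if "es \<in> exponents N n" for es
    proof (rule Cons.IH[where J = "\<lambda>i. J (Suc i)" and c = "\<lambda>es. c (k # es)"])
      show "is_ideal (J (Suc i))" if "i \<le> length ys" for i
        using Cons.prems(1) that by simp
      show "J (Suc i) \<subseteq> J (Suc (Suc i)) \<and> ys ! i \<in> J (Suc (Suc i)) \<and>
          colon (J (Suc i)) (ys ! i) \<subseteq> J (Suc i)" if "i < length ys" for i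
        using Cons.prems(2)[of "Suc i"] that by simp
      show "(\<Sum>es\<in>exponents N (length ys). c (k # es) * power_product ys es) \<in> J (Suc 0)"
        using sk by (simp add: s_def n_def)
    qed (use Cons.prems(3,4) that n_def in auto)
    then show False
      using k by blast
  qed
qed

section \<open>Koszul cochains on lists\<close>

text \<open>Cochains of degree \<open>i\<close> are arbitrary functions on lists of length \<open>i\<close>; they need not be
  alternating. The Koszul differential is then defined by recursion along the list, and
  contraction with the first entry is a homotopy.\<close>

fun delta :: "('v \<Rightarrow> 'r::comm_ring_1) \<Rightarrow> ('v list \<Rightarrow> 'r) \<Rightarrow> 'v list \<Rightarrow> 'r" where
  "delta a z [] = 0"
| "delta a z (v # L) = a v * z L - delta a (\<lambda>M. z (v # M)) L"

lemma delta_diff: "delta a (\<lambda>M. z M - w M) L = delta a z L - delta a w L"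
  by (induction L arbitrary: z w) (simp_all add: algebra_simps)

lemma delta_scale: "delta a (\<lambda>M. r * z M) L = r * delta a z L"
  by (induction L arbitrary: z) (simp_all add: algebra_simps)

lemma delta_zero: "delta a (\<lambda>M. 0) L = 0"
  by (induction L) simp_all

lemma delta_add: "delta a (\<lambda>M. z M + w M) L = delta a z L + delta a w L"
  by (induction L arbitrary: z w) (simp_all add: algebra_simps)

lemma delta_sum: "delta a (\<lambda>M. \<Sum>v\<in>A. f v * z v M) L = (\<Sum>v\<in>A. f v * delta a (z v) L)"
  by (induction A rule: infinite_finite_induct) (simp_all add: delta_zero delta_add delta_scale)

lemma delta_add_left: "delta (\<lambda>v. a v + b v) z L = delta a z L + delta b z L"
  by (induction L arbitrary: z) (simp_all add: algebra_simps)

lemma delta_scale_left: "delta (\<lambda>v. r * a v) z L = r * delta a z L"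
  by (induction L arbitrary: z) (simp_all add: algebra_simps)

lemma delta_zero_left: "delta (\<lambda>v. 0) z L = 0"
  by (induction L arbitrary: z) simp_all

lemma delta_sum_left: "delta (\<lambda>v. \<Sum>t\<in>A. r t * a t v) z L = (\<Sum>t\<in>A. r t * delta (a t) z L)"
  by (induction A rule: infinite_finite_induct)
    (simp_all add: delta_zero_left delta_add_left delta_scale_left)

text \<open>For \<open>a = b\<close> the first two terms cancel, and exchanging \<open>a\<close> and
  \<open>b\<close> changes their sign: one recursion yields both \<open>delta_delta\<close> and
  \<open>delta_anticommute\<close>.\<close>

lemma delta_delta_Cons:
  "delta a (delta b z) (v # L) =
     a v * delta b z L - b v * delta a z L + delta a (delta b (\<lambda>M. z (v # M))) L"
  by (simp add: delta_diff delta_scale)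

lemma delta_delta: "delta a (delta a z) L = 0"
proof (induction L arbitrary: z)
  case (Cons v L)
  then show ?case
    by (simp only: delta_delta_Cons) simp
qed simp

lemma delta_anticommute: "delta a (delta b z) L = - delta b (delta a z) L"
proof (induction L arbitrary: z)
  case (Cons v L)
  show ?case
    unfolding delta_delta_Cons Cons.IH by simp
qed simp

lemma delta_in_ideal:
  assumes "is_ideal I" "\<And>M. \<lbrakk>M \<in> lists V; length M = n\<rbrakk> \<Longrightarrow> z M \<in> I"
    and "L \<in> lists V" "length L = Suc n"
  shows "delta a z L \<in> I"
  using assms(2-)
proof (induction L arbitrary: z n)
  case Nil
  then show ?case
    by simp
next
  case (Cons v L)
  have "delta a (\<lambda>M. z (v # M)) L \<in> I"
  proof (cases n)
    case 0
    then show ?thesis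
      using Cons.prems ideal_0[OF assms(1)] by simp
  next
    case (Suc m)
    then show ?thesis
      using Cons.prems by (intro Cons.IH) auto
  qed
  then show ?case
    using Cons.prems ideal_diff[OF assms(1)] ideal_mult_left[OF assms(1)] by simp
qed

lemma delta_coefficient_in_ideal:
  assumes "is_ideal I" "\<And>v. v \<in> set L \<Longrightarrow> m * b v \<in> I"
  shows "m * delta b z L \<in> I"
  using assms(2)
proof (induction L arbitrary: z)
  case Nil
  then show ?case
    using ideal_0[OF assms(1)] by simp
next
  case (Cons v L)
  have "m * b v * z L \<in> I"
    using Cons.prems ideal_mult_right[OF assms(1)] by simp
  then have "m * b v * z L - m * delta b (\<lambda>M. z (v # M)) L \<in> I"
    using Cons by (intro ideal_diff[OF assms(1)]) auto
  then show ?case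
    by (simp add: algebra_simps)
qed

lemma delta_delta_coefficient_in_ideal:
  assumes "is_ideal I" "\<And>v w. m * (a v * b w) \<in> I"
  shows "m * delta a (delta b z) L \<in> I"
proof (induction L arbitrary: z)
  case Nil
  then show ?case
    using ideal_0[OF assms(1)] by simp
next
  case (Cons v L)
  have "m * a v * b w \<in> I" "m * b v * a w \<in> I" for w
    using assms(2)[of v w] assms(2)[of w v] by (simp_all add: mult.assoc mult.commute[of "b v"])
  then have "m * a v * delta b z L \<in> I" "m * b v * delta a z L \<in> I"
    by (auto intro!: delta_coefficient_in_ideal[OF assms(1)])
  then have "m * a v * delta b z L - m * b v * delta a z L + m * delta a (delta b (\<lambda>M. z (v # M))) L \<in> I"
    using Cons.IH by (intro ideal_add[OF assms(1)] ideal_diff[OF assms(1)])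
  then show ?case
    unfolding delta_delta_Cons by (simp add: algebra_simps)
qed

text \<open>Cartan's formula for the contraction with \<open>f\<close>: multiplication by an element
  of the ideal generated by the \<open>a v\<close> is homotopic to zero.\<close>

lemma koszul_homotopy:
  "delta a (\<lambda>M. \<Sum>v\<in>V. f v * z (v # M)) L + (\<Sum>v\<in>V. f v * delta a z (v # L)) =
     (\<Sum>v\<in>V. f v * a v) * z L"
  unfolding delta_sum by (simp add: algebra_simps sum_subtractf sum_distrib_left)

text \<open>Depth sensitivity of Koszul cohomology. The homotopy gives
  \<open>y * z = delta a h\<close> modulo \<open>I\<close>, so \<open>h\<close> is a cocycle modulo
  \<open>y\<close>, and by induction a coboundary plus \<open>y * b\<close>. Applying
  \<open>delta a\<close> kills the coboundary, and cancelling the regular \<open>y\<close> leaves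
  \<open>z = delta a b\<close>.\<close>

lemma koszul_acyclic:
  assumes "is_ideal I" "weakly_regular I ys"
    and "\<And>y. y \<in> set ys \<Longrightarrow> \<exists>f. y - (\<Sum>v\<in>V. f v * a v) \<in> I"
    and "i < length ys"
    and "\<And>L. \<lbrakk>L \<in> lists V; length L = Suc i\<rbrakk> \<Longrightarrow> delta a z L \<in> I"
  shows "\<exists>u. \<forall>L\<in>lists V. length L = i \<longrightarrow> z L - delta a u L \<in> I"
  using assms
proof (induction ys arbitrary: I i z)
  case (Cons y ys)
  note I = Cons.prems(1)
  have reg: "c \<in> I" if "y * c \<in> I" for c
    using that Cons.prems(2) by (auto simp: colon_def)
  obtain f where f: "y - (\<Sum>v\<in>V. f v * a v) \<in> I"
    using Cons.prems(3)[of y] by auto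
  define h where "h M = (\<Sum>v\<in>V. f v * z (v # M))" for M
  have h: "y * z L - delta a h L \<in> I" if L: "L \<in> lists V" "length L = i" for L
  proof -
    have "(\<Sum>v\<in>V. f v * delta a z (v # L)) \<in> I"
      using Cons.prems(5)[of "_ # L"] L
      by (intro ideal_sum[OF I] ideal_mult_left[OF I]) (simp del: delta.simps)
    then have "(y - (\<Sum>v\<in>V. f v * a v)) * z L + (\<Sum>v\<in>V. f v * delta a z (v # L)) \<in> I"
      by (intro ideal_add[OF I] ideal_mult_right[OF I f])
    moreover have "(y - (\<Sum>v\<in>V. f v * a v)) * z L + (\<Sum>v\<in>V. f v * delta a z (v # L)) =
        y * z L - delta a h L"
      unfolding h_def left_diff_distrib using koszul_homotopy[of a f z V L] by (simp add: algebra_simps)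
    ultimately show ?thesis
      by simp
  qed
  show ?case
  proof (cases i)
    case 0
    have "z [] \<in> I"
      using h[of "[]"] 0 reg[of "z []"] by simp
    then show ?thesis
      using 0 by (intro exI[of _ "\<lambda>_. 0"]) simp
  next
    case (Suc j)
    let ?J = "adjoin I y"
    have J: "I \<subseteq> ?J"
      by (rule adjoin_subset[OF I])
    have "\<exists>w. \<forall>L\<in>lists V. length L = j \<longrightarrow> h L - delta a w L \<in> ?J"
    proof (rule Cons.IH)
      show "is_ideal ?J"
        by (rule adjoin_is_ideal[OF I])
      show "weakly_regular ?J ys"
        using Cons.prems(2) by simp
      show "\<exists>f. y' - (\<Sum>v\<in>V. f v * a v) \<in> ?J" if "y' \<in> set ys" for y'
        using Cons.prems(3)[of y'] that J by auto
      show "j < length ys"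
        using Cons.prems(4) Suc by simp
      fix L assume L: "L \<in> lists V" "length L = Suc j"
      have "y * z L \<in> ?J"
        by (rule adjoin_mult[OF I])
      moreover have "y * z L - delta a h L \<in> ?J"
        using h[of L] L Suc J by blast
      ultimately show "delta a h L \<in> ?J"
        using ideal_cong[OF adjoin_is_ideal[OF I]] by blast
    qed
    then obtain w where w: "\<And>L. \<lbrakk>L \<in> lists V; length L = j\<rbrakk> \<Longrightarrow> h L - delta a w L \<in> ?J"
      by blast
    then have "\<forall>L. \<exists>b. L \<in> lists V \<longrightarrow> length L = j \<longrightarrow> h L - delta a w L - y * b \<in> I"
      by (simp add: adjoin_def)
    then obtain b where
      b: "\<And>L. \<lbrakk>L \<in> lists V; length L = j\<rbrakk> \<Longrightarrow> h L - delta a w L - y * b L \<in> I"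
      by metis
    have "z L - delta a b L \<in> I" if L: "L \<in> lists V" "length L = i" for L
    proof (rule reg)
      have "delta a (\<lambda>L. h L - delta a w L - y * b L) L \<in> I"
        using L Suc by (intro delta_in_ideal[OF I b]) auto
      then have "delta a h L - y * delta a b L \<in> I"
        by (simp add: delta_diff delta_scale delta_delta)
      then have "y * z L - delta a h L + (delta a h L - y * delta a b L) \<in> I"
        by (rule ideal_add[OF I h[OF L]])
      then show "y * (z L - delta a b L) \<in> I"
        by (simp add: algebra_simps)
    qed
    then show ?thesis
      by blast
  qed
qed simp

text \<open>The exterior product of the unit covectors of \<open>ts\<close>, as a determinant on
  lists: \<open>delta\<close> with a unit coefficient family is exterior multiplication.\<close>

fun det_cochain :: "'v list \<Rightarrow> 'v list \<Rightarrow> 'r::comm_ring_1" where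
  "det_cochain [] = (\<lambda>L. if L = [] then 1 else 0)"
| "det_cochain (t # ts) = delta (\<lambda>v. if v = t then 1 else 0) (det_cochain ts)"

lemma delta_unit_det_cochain:
  "t \<in> set ts \<Longrightarrow> delta (\<lambda>v. if v = t then 1 else 0) (det_cochain ts) L = (0::'r::comm_ring_1)"
proof (induction ts arbitrary: L)
  case (Cons s ts)
  show ?case
  proof (cases "t = s")
    case True
    then show ?thesis
      by (simp add: delta_delta)
  next
    case False
    then have "delta (\<lambda>v. if v = t then 1 else 0) (det_cochain ts) = (\<lambda>_. 0::'r)"
      using Cons by auto
    then show ?thesis
      using delta_anticommute[of "\<lambda>v. if v = t then 1 else 0" "\<lambda>v. if v = s then 1 else 0"
          "det_cochain ts :: _ \<Rightarrow> 'r" L]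
      by (simp add: delta_zero)
  qed
qed simp

lemma det_cochain_notin: "v \<notin> set ts \<Longrightarrow> det_cochain ts (v # L) = (0::'r::comm_ring_1)"
proof (induction ts arbitrary: L)
  case (Cons t ts)
  then have "(\<lambda>M. det_cochain ts (v # M)) = (\<lambda>_. 0::'r)"
    by auto
  then show ?case
    using Cons.prems by (simp add: delta_zero)
qed simp

lemma det_cochain_self: "distinct ts \<Longrightarrow> det_cochain ts ts = (1::'r::comm_ring_1)"
proof (induction ts)
  case (Cons t ts)
  then have "(\<lambda>M. det_cochain ts (t # M)) = (\<lambda>_. 0::'r)"
    by (intro ext det_cochain_notin) simp
  then show ?case
    using Cons by (simp add: delta_zero)
qed simp

section \<open>Monomial ideals\<close>

abbreviation "supp \<equiv> Poly_Mapping.keys"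
abbreviation "coeff_at \<equiv> Poly_Mapping.lookup"
abbreviation "monomial \<equiv> Poly_Mapping.single"

type_synonym ('a, 'k) mpoly = "('a \<Rightarrow>\<^sub>0 nat) \<Rightarrow>\<^sub>0 'k"

lemma mpoly_expand: "p = (\<Sum>m\<in>supp p. monomial m (coeff_at p m))"
  by (rule poly_mapping_eqI)
    (auto simp: lookup_sum lookup_single when_def sum.delta in_keys_iff split: if_splits)

lemma mpoly_mult_expand:
  "p * q = (\<Sum>m\<in>supp p. \<Sum>n\<in>supp q. monomial (m + n) (coeff_at p m * coeff_at q n))"
  for p q :: "('a, 'k::comm_ring_1) mpoly"
proof -
  have "p * q = (\<Sum>m\<in>supp p. monomial m (coeff_at p m)) * (\<Sum>n\<in>supp q. monomial n (coeff_at q n))"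
    using mpoly_expand by metis
  then show ?thesis
    by (simp add: sum_product mult_single)
qed

lemma lookup_mpoly_mult:
  "coeff_at (p * q) k = (\<Sum>m\<in>supp p. \<Sum>n\<in>supp q. if m + n = k then coeff_at p m * coeff_at q n else 0)"
  for p q :: "('a, 'k::comm_ring_1) mpoly"
  by (subst mpoly_mult_expand) (simp add: lookup_sum lookup_single when_def)

lemma supp_add_nat: "supp (m + n) = supp m \<union> supp n"
  for m n :: "'a \<Rightarrow>\<^sub>0 nat"
  by (auto simp: in_keys_iff lookup_add)

lemma lookup_monomial_mult:
  "coeff_at (monomial m 1 * p) (m + n) = coeff_at p n"
  for p :: "('a, 'k::comm_ring_1) mpoly"
proof -
  have "coeff_at (monomial m 1 * p) (m + n) = (\<Sum>k\<in>supp p. if k = n then coeff_at p k else 0)"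
    by (simp add: lookup_mpoly_mult)
  also have "\<dots> = coeff_at p n"
    by (simp add: sum.delta in_keys_iff)
  finally show ?thesis .
qed

lemma supp_monomial_mult:
  "supp (monomial m 1 * p) = (+) m ` supp p"
  for p :: "('a, 'k::comm_ring_1) mpoly"
proof
  show "supp (monomial m 1 * p) \<subseteq> (+) m ` supp p"
    using keys_mult[of "monomial m 1" p] by auto
  show "(+) m ` supp p \<subseteq> supp (monomial m 1 * p)"
    by (auto simp: in_keys_iff lookup_monomial_mult)
qed

text \<open>Membership is read off the support, so colon and adjunction by a monomial become
  operations on predicates.\<close>

definition monomial_ideal :: "(('a \<Rightarrow>\<^sub>0 nat) \<Rightarrow> bool) \<Rightarrow> ('a, 'k::comm_ring_1) mpoly set" where
  "monomial_ideal P = {p. \<forall>m\<in>supp p. P m}"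

lemma monomial_in_monomial_ideal: "P m \<Longrightarrow> monomial m c \<in> monomial_ideal P"
  by (auto simp: monomial_ideal_def)

lemma monomial_ideal_is_ideal:
  assumes "\<And>m n. P m \<Longrightarrow> P (n + m)"
  shows "is_ideal (monomial_ideal P :: ('a, 'k::comm_ring_1) mpoly set)"
proof (rule is_idealI)
  fix a b :: "('a, 'k) mpoly"
  show "a + b \<in> monomial_ideal P" if "a \<in> monomial_ideal P" "b \<in> monomial_ideal P"
    using that keys_add[of a b] by (auto simp: monomial_ideal_def)
  show "b * a \<in> monomial_ideal P" if "a \<in> monomial_ideal P"
    using that keys_mult[of b a] assms by (fastforce simp: monomial_ideal_def)
qed (simp add: monomial_ideal_def)

lemma monomial_ideal_subset:
  fixes J :: "('a, 'k::comm_ring_1) mpoly set"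
  assumes "is_ideal J" "\<And>m c. P m \<Longrightarrow> monomial m c \<in> J"
  shows "monomial_ideal P \<subseteq> J"
proof
  fix p :: "('a, 'k) mpoly" assume "p \<in> monomial_ideal P"
  then have "(\<Sum>m\<in>supp p. monomial m (coeff_at p m)) \<in> J"
    using assms by (intro ideal_sum) (auto simp: monomial_ideal_def)
  then show "p \<in> J"
    using mpoly_expand[of p] by simp
qed

lemma colon_monomial_ideal:
  "colon (monomial_ideal P) (monomial m 1) = monomial_ideal (\<lambda>n. P (m + n))"
  by (simp add: colon_def monomial_ideal_def supp_monomial_mult)

lemma adjoin_monomial_ideal:
  assumes P: "\<And>m n. P m \<Longrightarrow> P (n + m)"
  shows "adjoin (monomial_ideal P) (monomial m 1) =
    (monomial_ideal (\<lambda>n. P n \<or> (\<exists>k. n = m + k)) :: ('a, 'k::comm_ring_1) mpoly set)"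
    (is "_ = monomial_ideal ?Q")
proof
  have I: "is_ideal (monomial_ideal P :: ('a, 'k) mpoly set)"
    using P by (rule monomial_ideal_is_ideal)
  have Q: "?Q (n + k)" if "?Q k" for n k
    using that P by (metis add.left_commute)
  show "adjoin (monomial_ideal P) (monomial m 1) \<subseteq> (monomial_ideal ?Q :: ('a, 'k) mpoly set)"
  proof (rule adjoin_least)
    show "is_ideal (monomial_ideal ?Q :: ('a, 'k) mpoly set)"
      using Q by (rule monomial_ideal_is_ideal)
    have "?Q m"
      by (metis add.right_neutral)
    then show "monomial m 1 \<in> (monomial_ideal ?Q :: ('a, 'k) mpoly set)"
      by (rule monomial_in_monomial_ideal)
  qed (auto simp: monomial_ideal_def)
  show "(monomial_ideal ?Q :: ('a, 'k) mpoly set) \<subseteq> adjoin (monomial_ideal P) (monomial m 1)"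
  proof (rule monomial_ideal_subset[OF adjoin_is_ideal[OF I]])
    fix n and c :: 'k assume "?Q n"
    then show "monomial n c \<in> adjoin (monomial_ideal P) (monomial m 1)"
    proof
      assume "P n"
      then show ?thesis
        using adjoin_subset[OF I] monomial_in_monomial_ideal by blast
    next
      assume "\<exists>k. n = m + k"
      then obtain k where "n = m + k"
        by blast
      then have "monomial n c = monomial m 1 * monomial k c"
        by (simp add: mult_single)
      then show ?thesis
        by (simp add: adjoin_mult[OF I])
    qed
  qed
qed

section \<open>Squarefree monomials and face ideals\<close>

definition squarefree_exp :: "'a set \<Rightarrow> 'a \<Rightarrow>\<^sub>0 nat" where
  "squarefree_exp A = (\<Sum>v\<in>A. monomial v 1)"

lemma lookup_squarefree_exp:
  "finite A \<Longrightarrow> coeff_at (squarefree_exp A) v = (if v \<in> A then 1 else 0)"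
  by (simp add: squarefree_exp_def lookup_sum lookup_single when_def sum.delta')

lemma supp_squarefree_exp: "finite A \<Longrightarrow> supp (squarefree_exp A) = A"
  by (auto simp: in_keys_iff lookup_squarefree_exp split: if_splits)

lemma squarefree_exp_divides_iff:
  assumes "finite A"
  shows "(\<exists>k. n = squarefree_exp A + k) \<longleftrightarrow> A \<subseteq> supp n"
proof
  assume "\<exists>k. n = squarefree_exp A + k"
  then show "A \<subseteq> supp n"
    using assms by (auto simp: supp_add_nat supp_squarefree_exp)
next
  assume "A \<subseteq> supp n"
  then have "n = squarefree_exp A + (n - squarefree_exp A)"
    using assms
    by (intro poly_mapping_eqI) (auto simp: lookup_add lookup_minus lookup_squarefree_exp in_keys_iff subset_iff)
  then show "\<exists>k. n = squarefree_exp A + k"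
    by blast
qed

lemma prod_poly_var:
  assumes "finite A"
  shows "(\<Prod>v\<in>A. poly_var v) = (monomial (squarefree_exp A) 1 :: ('a, 'k::field) mpoly)"
  using assms
  by induction (simp_all add: poly_var_def squarefree_exp_def mult_single)

abbreviation sqfree :: "'a set \<Rightarrow> ('a, 'k::field) mpoly" where
  "sqfree A \<equiv> monomial (squarefree_exp A) 1"

text \<open>The Stanley--Reisner ideal by supports instead of generators;
  \<open>stanley_reisner_ideal_eq\<close> identifies the two.\<close>

definition face_ideal :: "'a set set \<Rightarrow> ('a, 'k::field) mpoly set" where
  "face_ideal \<Delta> = monomial_ideal (\<lambda>m. supp m \<notin> \<Delta>)"

definition subset_closed :: "'a set set \<Rightarrow> bool" where
  "subset_closed \<Delta> \<longleftrightarrow> (\<forall>\<sigma>\<in>\<Delta>. Pow \<sigma> \<subseteq> \<Delta>)"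

lemma subset_closed_supp:
  fixes m n :: "'a \<Rightarrow>\<^sub>0 nat"
  assumes "subset_closed \<Delta>" "supp m \<notin> \<Delta>"
  shows "supp (n + m) \<notin> \<Delta>"
  using assms unfolding subset_closed_def supp_add_nat by (meson PowI Un_upper2 subsetD)

lemma face_ideal_is_ideal:
  assumes "subset_closed \<Delta>"
  shows "is_ideal (face_ideal \<Delta>)"
  unfolding face_ideal_def using subset_closed_supp[OF assms] by (rule monomial_ideal_is_ideal)

lemma face_ideal_empty: "face_ideal {} = UNIV"
  by (simp add: face_ideal_def monomial_ideal_def)

text \<open>For a face \<open>A\<close> this is the star and not the link: the variables of
  \<open>A\<close> stay in the ring as free variables.\<close>

lemma colon_face_ideal:
  assumes "finite A"
  shows "colon (face_ideal \<Delta>) (sqfree A) = face_ideal {\<sigma>. A \<union> \<sigma> \<in> \<Delta>}"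
  using assms by (simp add: face_ideal_def colon_monomial_ideal supp_add_nat supp_squarefree_exp)

lemma adjoin_face_ideal:
  assumes "finite A" "subset_closed \<Delta>"
  shows "adjoin (face_ideal \<Delta>) (sqfree A) = face_ideal {\<sigma> \<in> \<Delta>. \<not> A \<subseteq> \<sigma>}"
proof -
  have "adjoin (face_ideal \<Delta>) (sqfree A) =
      monomial_ideal (\<lambda>n. supp n \<notin> \<Delta> \<or> (\<exists>k. n = squarefree_exp A + k))"
    unfolding face_ideal_def using subset_closed_supp[OF assms(2)] by (rule adjoin_monomial_ideal)
  also have "\<dots> = face_ideal {\<sigma> \<in> \<Delta>. \<not> A \<subseteq> \<sigma>}"
    unfolding squarefree_exp_divides_iff[OF assms(1)] face_ideal_def
    by (rule arg_cong[where f = monomial_ideal]) auto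
  finally show ?thesis .
qed

lemma sqfree_in_face_ideal: "finite A \<Longrightarrow> A \<notin> \<Delta> \<Longrightarrow> sqfree A \<in> face_ideal \<Delta>"
  unfolding face_ideal_def by (intro monomial_in_monomial_ideal) (simp add: supp_squarefree_exp)

section \<open>Elementary symmetric systems of parameters\<close>

definition elementary_symmetric :: "'a set \<Rightarrow> nat \<Rightarrow> ('a, 'k::field) mpoly" where
  "elementary_symmetric V i = (\<Sum>A\<in>{A. A \<subseteq> V \<and> card A = i}. sqfree A)"

text \<open>The order matters: with the largest degree first, the quotients of a polynomial ring that
  occur are again Stanley--Reisner rings.\<close>

definition symmetric_sequence :: "'a set \<Rightarrow> nat \<Rightarrow> ('a, 'k::field) mpoly list" where
  "symmetric_sequence V n = map (elementary_symmetric V) (rev [1..<Suc n])"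

lemma symmetric_sequence_0: "symmetric_sequence V 0 = []"
  by (simp add: symmetric_sequence_def)

lemma symmetric_sequence_Suc:
  "symmetric_sequence V (Suc n) = elementary_symmetric V (Suc n) # symmetric_sequence V n"
  by (simp add: symmetric_sequence_def)

lemma length_symmetric_sequence: "length (symmetric_sequence V n) = n"
  by (simp add: symmetric_sequence_def)

text \<open>Among the subsets of size \<open>card F\<close>, only \<open>F\<close> itself is a face
  of the simplex.\<close>

lemma elementary_symmetric_simplex:
  assumes V: "finite V" "F \<subseteq> V"
  shows "elementary_symmetric V (card F) - sqfree F \<in> (face_ideal (Pow F) :: ('a, 'k::field) mpoly set)"
proof -
  let ?S = "{A. A \<subseteq> V \<and> card A = card F}"
  have I: "is_ideal (face_ideal (Pow F) :: ('a, 'k) mpoly set)"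
    by (intro face_ideal_is_ideal) (auto simp: subset_closed_def)
  have fin: "finite ?S" "F \<in> ?S"
    using V by auto
  then have "elementary_symmetric V (card F) - sqfree F = (\<Sum>A\<in>?S - {F}. sqfree A)"
    by (simp add: elementary_symmetric_def sum.remove[OF fin])
  moreover have "sqfree A \<in> (face_ideal (Pow F) :: ('a, 'k) mpoly set)" if "A \<in> ?S - {F}" for A
  proof (rule sqfree_in_face_ideal)
    show "finite A"
      using that V(1) finite_subset by blast
    show "A \<notin> Pow F"
      using that card_subset_eq[of F A] V finite_subset by blast
  qed
  ultimately show ?thesis
    using ideal_sum[OF I] by (metis (no_types, lifting))
qed

text \<open>Modulo the ideal of the simplex, the top polynomial is the product of the variables of
  \<open>F\<close>, a nonzerodivisor. The quotient belongs to the boundary of the simplex and is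
  taken apart variable by variable: \<open>adjoin\<close> gives the simplex on
  \<open>F - {a}\<close>, \<open>colon\<close> a shorter product.\<close>

lemma weakly_regular_simplex:
  assumes "finite V" "F \<subseteq> V"
  shows "weakly_regular (face_ideal (Pow F) :: ('a, 'k::field) mpoly set) (symmetric_sequence V (card F))"
  using assms(2)
proof (induction "card F" arbitrary: F)
  case 0
  then show ?case
    by (simp add: symmetric_sequence_0)
next
  case (Suc n)
  let ?I = "\<lambda>F. face_ideal (Pow F) :: ('a, 'k) mpoly set"
  have fin: "finite F"
    using Suc.prems assms(1) finite_subset by blast
  have closed: "subset_closed (Pow F)" "subset_closed {\<sigma>. \<sigma> \<subseteq> F \<and> \<not> A \<subseteq> \<sigma>}" for A :: "'a set"
    by (auto simp: subset_closed_def)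
  have I: "is_ideal (?I F)"
    by (rule face_ideal_is_ideal[OF closed(1)])
  have "finite A \<Longrightarrow> A \<subseteq> F \<Longrightarrow>
      weakly_regular (face_ideal {\<sigma>. \<sigma> \<subseteq> F \<and> \<not> A \<subseteq> \<sigma>} :: ('a, 'k) mpoly set) (symmetric_sequence V n)" for A
  proof (induction A rule: finite_induct)
    case empty
    then show ?case
      by (simp add: face_ideal_empty weakly_regular_UNIV)
  next
    case (insert a A)
    show ?case
    proof (rule weakly_regular_split)
      have "{\<sigma>. {a} \<union> \<sigma> \<in> {\<sigma>. \<sigma> \<subseteq> F \<and> \<not> insert a A \<subseteq> \<sigma>}} = {\<sigma>. \<sigma> \<subseteq> F \<and> \<not> A \<subseteq> \<sigma>}"
        using insert.hyps insert.prems by auto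
      then show "weakly_regular (colon (face_ideal {\<sigma>. \<sigma> \<subseteq> F \<and> \<not> insert a A \<subseteq> \<sigma>}) (sqfree {a} :: ('a, 'k) mpoly))
          (symmetric_sequence V n)"
        using insert.IH insert.prems by (subst colon_face_ideal) simp_all
      have "{\<sigma> \<in> {\<sigma>. \<sigma> \<subseteq> F \<and> \<not> insert a A \<subseteq> \<sigma>}. \<not> {a} \<subseteq> \<sigma>} = Pow (F - {a})"
        by auto
      then have "adjoin (face_ideal {\<sigma>. \<sigma> \<subseteq> F \<and> \<not> insert a A \<subseteq> \<sigma>}) (sqfree {a} :: ('a, 'k) mpoly) = ?I (F - {a})"
        by (subst adjoin_face_ideal[OF _ closed(2)]) simp_all
      moreover have card: "n = card (F - {a})"
        using Suc.hyps(2) insert.prems fin by simp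
      moreover have "weakly_regular (?I (F - {a})) (symmetric_sequence V (card (F - {a})))"
        using Suc.prems by (intro Suc.hyps(1)[OF card]) blast
      ultimately show "weakly_regular (adjoin (face_ideal {\<sigma>. \<sigma> \<subseteq> F \<and> \<not> insert a A \<subseteq> \<sigma>}) (sqfree {a} :: ('a, 'k) mpoly))
          (symmetric_sequence V n)"
        by (simp only:)
    qed (rule face_ideal_is_ideal[OF closed(2)])
  qed
  from this[OF fin order_refl]
  have "weakly_regular (adjoin (?I F) (sqfree F)) (symmetric_sequence V n)"
    by (subst adjoin_face_ideal[OF fin closed(1)]) simp
  moreover have "colon (?I F) (sqfree F) \<subseteq> ?I F"
    by (subst colon_face_ideal[OF fin]) (auto simp: face_ideal_def monomial_ideal_def)
  moreover have diff: "elementary_symmetric V (Suc n) - sqfree F \<in> ?I F"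
    using elementary_symmetric_simplex[OF assms(1) Suc.prems] Suc.hyps(2) by simp
  ultimately show ?case
    unfolding Suc.hyps(2)[symmetric] symmetric_sequence_Suc
    by (simp add: adjoin_cong[OF I diff] colon_cong[OF I diff])
qed

lemma subset_closed_cocomplex: "subset_closed (cocomplex U C)"
  by (auto simp: subset_closed_def cocomplex_def)

text \<open>The symmetric polynomials are those of the fixed set \<open>V\<close>, and
  \<open>U\<close> enters only through the length. So the same sequence is available for both ideals
  in \<open>weakly_regular_split\<close>.\<close>

theorem splittable_imp_weakly_regular:
  assumes "splittable d C" "finite V" "U \<subseteq> V" "\<Union>C \<subseteq> U"
  shows "weakly_regular (face_ideal (cocomplex U C) :: ('a, 'k::field) mpoly set)
    (symmetric_sequence V (card U - d))"
  using assms
proof (induction arbitrary: U)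
  case (empty d)
  then show ?case
    by (simp add: cocomplex_def face_ideal_empty weakly_regular_UNIV)
next
  case unit
  have "cocomplex U {{}} = Pow U"
    by (auto simp: cocomplex_def)
  then show ?case
    using weakly_regular_simplex[of V U] unit by simp
next
  case (shed C v d)
  let ?\<Delta> = "cocomplex U C"
  show ?case
  proof (cases "C = {}")
    case True
    then show ?thesis
      by (simp add: cocomplex_def face_ideal_empty weakly_regular_UNIV)
  next
    case False
    then have v: "v \<in> U"
      using shed_in_Union[OF shed.hyps(1)] shed.prems by blast
    show ?thesis
    proof (rule weakly_regular_split)
      \<comment> \<open>The colon is the star of \<open>v\<close>, so the ground set remains
        \<open>U\<close> and the length of the sequence is unchanged.\<close>
      have "{\<sigma>. {v} \<union> \<sigma> \<in> ?\<Delta>} = cocomplex U (vertex_deletion C v)"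
        using v by (auto simp: cocomplex_def vertex_deletion_def)
      then have "colon (face_ideal ?\<Delta>) (sqfree {v} :: ('a, 'k) mpoly) =
          face_ideal (cocomplex U (vertex_deletion C v))"
        by (subst colon_face_ideal) simp_all
      moreover have "\<Union>(vertex_deletion C v) \<subseteq> U"
        using shed.prems by (auto simp: vertex_deletion_def)
      ultimately show "weakly_regular (colon (face_ideal ?\<Delta>) (sqfree {v} :: ('a, 'k) mpoly))
          (symmetric_sequence V (card U - Suc d))"
        using shed.IH(1) shed.prems by simp
      have "{\<sigma> \<in> ?\<Delta>. \<not> {v} \<subseteq> \<sigma>} = cocomplex (U - {v}) (vertex_link C v)"
        unfolding vertex_deletion_cocomplex[OF shed.hyps(1), symmetric] by (simp add: vertex_deletion_def)
      then have "adjoin (face_ideal ?\<Delta>) (sqfree {v} :: ('a, 'k) mpoly) =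
          face_ideal (cocomplex (U - {v}) (vertex_link C v))"
        by (subst adjoin_face_ideal) (simp_all add: subset_closed_cocomplex)
      moreover have "weakly_regular (face_ideal (cocomplex (U - {v}) (vertex_link C v)) :: ('a, 'k) mpoly set)
          (symmetric_sequence V (card (U - {v}) - d))"
        using shed.prems by (intro shed.IH(2) Union_vertex_link_subset) auto
      \<comment> \<open>Contraction lowers the ground set and the uniformity by one each, so the
        lengths agree.\<close>
      moreover have "card (U - {v}) - d = card U - Suc d"
        using v by simp
      ultimately show "weakly_regular (adjoin (face_ideal ?\<Delta>) (sqfree {v} :: ('a, 'k) mpoly))
          (symmetric_sequence V (card U - Suc d))"
        by (simp only:)
    qed (rule face_ideal_is_ideal[OF subset_closed_cocomplex])
  qed
qed

section \<open>The dimension bound\<close>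

text \<open>Gaussian elimination by induction on the equations: \<open>M'\<close> is the system
  after eliminating an unknown \<open>l\<close> that occurs in equation \<open>b\<close>, and
  \<open>d\<close> restores its value.\<close>

lemma underdetermined_system:
  fixes M :: "'l \<Rightarrow> 'b \<Rightarrow> 'k::field"
  assumes "finite B" "finite L" "card B < card L"
  shows "\<exists>c. (\<exists>l\<in>L. c l \<noteq> 0) \<and> (\<forall>b\<in>B. (\<Sum>l\<in>L. c l * M l b) = 0)"
  using assms
proof (induction B arbitrary: L M rule: finite_induct)
  case empty
  then obtain l where "l \<in> L"
    by fastforce
  then show ?case
    by (intro exI[of _ "\<lambda>_. 1"]) auto
next
  case (insert b B)
  show ?case
  proof (cases "\<forall>l\<in>L. M l b = 0")
    case True
    obtain c where "\<exists>l\<in>L. c l \<noteq> 0" "\<forall>b\<in>B. (\<Sum>l\<in>L. c l * M l b) = 0"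
      using insert.IH[of L M] insert.prems insert.hyps by auto
    then show ?thesis
      using True by (intro exI[of _ c]) auto
  next
    case False
    then obtain l where l: "l \<in> L" "M l b \<noteq> 0"
      by blast
    let ?L = "L - {l}"
    define M' where "M' k x = M k x - M k b / M l b * M l x" for k x
    have "card B < card ?L"
      using insert.prems insert.hyps l by simp
    then obtain c where c: "\<exists>k\<in>?L. c k \<noteq> 0" "\<And>x. x \<in> B \<Longrightarrow> (\<Sum>k\<in>?L. c k * M' k x) = 0"
      using insert.IH[of ?L M'] insert.prems(1) by blast
    define d where "d = c(l := - (\<Sum>k\<in>?L. c k * M k b) / M l b)"
    have sum: "(\<Sum>k\<in>L. d k * M k x) = (\<Sum>k\<in>?L. c k * M' k x)" for x
    proof -
      have "(\<Sum>k\<in>L. d k * M k x) = d l * M l x + (\<Sum>k\<in>?L. d k * M k x)"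
        using insert.prems(1) l(1) by (rule sum.remove)
      also have "(\<Sum>k\<in>?L. d k * M k x) = (\<Sum>k\<in>?L. c k * M k x)"
        by (intro sum.cong) (auto simp: d_def)
      also have "d l * M l x + (\<Sum>k\<in>?L. c k * M k x) = (\<Sum>k\<in>?L. c k * M' k x)"
      proof -
        have "(\<Sum>k\<in>?L. c k * (M k b / M l b * M l x)) = (\<Sum>k\<in>?L. c k * M k b) / M l b * M l x"
          by (simp add: sum_distrib_right sum_divide_distrib mult.assoc)
        then show ?thesis
          by (simp add: d_def M'_def right_diff_distrib sum_subtractf)
      qed
      finally show ?thesis .
    qed
    have "(\<Sum>k\<in>L. d k * M k b) = 0"
      unfolding sum using l(2) by (intro sum.neutral) (simp add: M'_def)
    moreover have "\<exists>k\<in>L. d k \<noteq> 0"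
      using c(1) by (auto simp: d_def)
    ultimately show ?thesis
      using c(2) sum by (intro exI[of _ d]) auto
  qed
qed

section \<open>Counting monomials supported on faces\<close>

text \<open>Each exponent is bounded separately, so that the monomials over a fixed face lie in a
  box that is easy to count.\<close>

definition exps_le :: "nat \<Rightarrow> ('a, 'k::comm_ring_1) mpoly \<Rightarrow> bool" where
  "exps_le D p \<longleftrightarrow> (\<forall>m\<in>supp p. \<forall>v. coeff_at m v \<le> D)"

lemma exps_le_mult:
  assumes "exps_le D p" "exps_le E q"
  shows "exps_le (D + E) (p * q)"
  using assms keys_mult[of p q] unfolding exps_le_def
  by (fastforce simp: lookup_add intro: add_mono)

lemma exps_le_1: "exps_le 0 (1 :: ('a, 'k::comm_ring_1) mpoly)"
  by (simp add: exps_le_def)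

lemma exps_le_mono: "exps_le D p \<Longrightarrow> D \<le> E \<Longrightarrow> exps_le E p"
  unfolding exps_le_def using order_trans by blast

lemma exps_le_power: "exps_le D p \<Longrightarrow> exps_le (e * D) (p ^ e)"
  by (induction e) (auto simp: exps_le_1 intro: exps_le_mult)

lemma exps_le_power_product:
  "\<lbrakk>length es = length ys; \<forall>y\<in>set ys. exps_le D y; set es \<subseteq> {..<N}\<rbrakk>
    \<Longrightarrow> exps_le (length ys * (N * D)) (power_product ys es)"
proof (induction es ys rule: list_induct2)
  case Nil
  then show ?case
    by (simp add: exps_le_1)
next
  case (Cons e es y ys)
  have "exps_le (e * D) (y ^ e)"
    using Cons.prems by (intro exps_le_power) simp
  then have "exps_le (N * D) (y ^ e)"
    by (rule exps_le_mono) (use Cons.prems in \<open>simp add: mult_le_mono1\<close>)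
  then show ?case
    using Cons exps_le_mult by fastforce
qed

lemma exps_le_exists: "\<exists>D. \<forall>y\<in>set ys. exps_le D y"
proof -
  let ?S = "\<Union>y\<in>set ys. \<Union>m\<in>supp y. Poly_Mapping.range m"
  have fin: "finite (insert 0 ?S)"
    by auto
  have "coeff_at m v \<le> Max (insert 0 ?S)" if "y \<in> set ys" "m \<in> supp y" for y m v
  proof -
    have "coeff_at m v \<in> insert 0 ?S"
    proof (cases "coeff_at m v = 0")
      case False
      then have "coeff_at m v \<in> Poly_Mapping.range m"
        by (intro in_keys_lookup_in_range) (simp add: in_keys_iff)
      then show ?thesis
        using that by blast
    qed simp
    then show ?thesis
      by (rule Max_ge[OF fin])
  qed
  then show ?thesis
    unfolding exps_le_def by blast
qed

definition bounded_exps :: "'a set set \<Rightarrow> nat \<Rightarrow> ('a \<Rightarrow>\<^sub>0 nat) set" where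
  "bounded_exps \<Delta> D = {m. supp m \<in> \<Delta> \<and> (\<forall>v. coeff_at m v \<le> D)}"

lemma card_bounded_exps:
  assumes "finite \<Delta>" and \<Delta>: "\<And>\<sigma>. \<sigma> \<in> \<Delta> \<Longrightarrow> finite \<sigma> \<and> card \<sigma> \<le> d"
  shows "finite (bounded_exps \<Delta> D)" "card (bounded_exps \<Delta> D) \<le> card \<Delta> * (D + 1) ^ d"
proof -
  let ?B = "\<lambda>\<sigma>. {m. supp m = \<sigma> \<and> (\<forall>v. coeff_at m v \<le> D)}"
  have eq: "bounded_exps \<Delta> D = (\<Union>\<sigma>\<in>\<Delta>. ?B \<sigma>)"
    by (auto simp: bounded_exps_def)
  have 1: "finite (?B \<sigma>) \<and> card (?B \<sigma>) \<le> (D + 1) ^ d" if "\<sigma> \<in> \<Delta>" for \<sigma>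
  proof -
    let ?f = "\<lambda>m::'a \<Rightarrow>\<^sub>0 nat. restrict (coeff_at m) \<sigma>" and ?P = "PiE \<sigma> (\<lambda>_. {..D})"
    have "m = n" if "m \<in> ?B \<sigma>" "n \<in> ?B \<sigma>" "?f m = ?f n" for m n
    proof (rule poly_mapping_eqI)
      fix v
      show "coeff_at m v = coeff_at n v"
      proof (cases "v \<in> \<sigma>")
        case True
        then show ?thesis
          using fun_cong[OF that(3), of v] by simp
      next
        case False
        then have "v \<notin> supp m" "v \<notin> supp n"
          using that(1,2) by auto
        then show ?thesis
          by (simp add: in_keys_iff)
      qed
    qed
    then have inj: "inj_on ?f (?B \<sigma>)"
      by (intro inj_onI) blast
    have sub: "?f ` ?B \<sigma> \<subseteq> ?P"
      by auto
    have fin: "finite \<sigma>" "finite ?P"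
      using \<Delta>[OF that] by (auto intro: finite_PiE)
    have "card (?B \<sigma>) \<le> card ?P"
      using inj sub fin(2) by (rule card_inj_on_le)
    also have "\<dots> = (D + 1) ^ card \<sigma>"
      using fin(1) by (simp add: card_PiE)
    also have "\<dots> \<le> (D + 1) ^ d"
      using \<Delta>[OF that] by (intro power_increasing) auto
    finally show ?thesis
      using inj_on_finite[OF inj sub fin(2)] by blast
  qed
  then show "finite (bounded_exps \<Delta> D)"
    using assms(1) unfolding eq by blast
  have "card (bounded_exps \<Delta> D) \<le> (\<Sum>\<sigma>\<in>\<Delta>. card (?B \<sigma>))"
    unfolding eq using assms(1) by (rule card_UN_le)
  also have "\<dots> \<le> (\<Sum>\<sigma>\<in>\<Delta>. (D + 1) ^ d)"
    using 1 by (intro sum_mono) blast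
  finally show "card (bounded_exps \<Delta> D) \<le> card \<Delta> * (D + 1) ^ d"
    by simp
qed

text \<open>There are more power products of \<open>n > d\<close> elements with exponents below \<open>N\<close> than there are
  monomials supported on faces in the degrees that they reach, once \<open>N\<close> is large.\<close>

theorem chain_length_le:
  fixes ys :: "('a, 'k::field) mpoly list"
  assumes \<Delta>: "finite \<Delta>" "\<And>\<sigma>. \<sigma> \<in> \<Delta> \<Longrightarrow> finite \<sigma> \<and> card \<sigma> \<le> d"
    and J: "\<And>i. i \<le> length ys \<Longrightarrow> is_ideal (J i)"
    and step: "\<And>i. i < length ys \<Longrightarrow> J i \<subseteq> J (Suc i) \<and> ys ! i \<in> J (Suc i) \<and> colon (J i) (ys ! i) \<subseteq> J i"
    and proper: "1 \<notin> J (length ys)" and J0: "face_ideal \<Delta> \<subseteq> J 0"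
  shows "length ys \<le> d"
proof (rule ccontr)
  assume n: "\<not> length ys \<le> d"
  define n where "n = length ys"
  obtain D where D: "\<forall>y\<in>set ys. exps_le D y"
    using exps_le_exists by blast
  \<comment> \<open>Power products with exponents below \<open>N\<close> have exponents at most
    \<open>n * (N * D)\<close>, which is less than \<open>A * N\<close>. So at most
    \<open>card \<Delta> * A ^ d * N ^ d\<close> monomials on faces occur. As \<open>N\<close>
    exceeds \<open>card \<Delta> * A ^ d\<close> and \<open>n \<ge> d + 1\<close>, there are more
    power products, namely \<open>N ^ n\<close>.\<close>
  define A where "A = n * (D + 1)"
  define N where "N = card \<Delta> * A ^ d + 1"
  define B where "B = bounded_exps \<Delta> (n * (N * D))"
  have "n * (N * D) + 1 \<le> A * N"
    using n by (simp add: A_def n_def N_def algebra_simps)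
  then have "(n * (N * D) + 1) ^ d \<le> (A * N) ^ d"
    by (intro power_mono) auto
  then have "card B \<le> card \<Delta> * (A * N) ^ d"
    using card_bounded_exps(2)[OF \<Delta>, of "n * (N * D)"] unfolding B_def
    by (meson mult_le_mono2 order_trans)
  also have "\<dots> = (card \<Delta> * A ^ d) * N ^ d"
    by (simp add: power_mult_distrib)
  also have "\<dots> < N * N ^ d"
    by (intro mult_strict_right_mono) (auto simp: N_def)
  also have "\<dots> \<le> N ^ n"
    using n power_increasing[of "Suc d" n N] by (simp add: n_def N_def)
  finally have "card B < card (exponents N n)"
    by (simp add: card_exponents)
  then obtain c where c: "\<exists>es\<in>exponents N n. c es \<noteq> 0"
    "\<And>m. m \<in> B \<Longrightarrow> (\<Sum>es\<in>exponents N n. c es * coeff_at (power_product ys es) m) = 0"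
    using underdetermined_system[of B "exponents N n" "\<lambda>es. coeff_at (power_product ys es)"]
      card_bounded_exps(1)[OF \<Delta>] finite_exponents unfolding B_def by blast
  define p where "p = (\<Sum>es\<in>exponents N n. monomial 0 (c es) * power_product ys es)"
  have coeff: "coeff_at (monomial 0 a * q) m = a * coeff_at q m" for a and q :: "('a, 'k) mpoly" and m
    unfolding mult_map_scale_conv_mult[symmetric] by (simp add: map.rep_eq when_def)
  have "exps_le (n * (N * D)) (power_product ys es)" if "es \<in> exponents N n" for es
    using that D unfolding n_def by (intro exps_le_power_product) (auto simp: exponents_def)
  note exps = this
  have bound: "coeff_at m v \<le> n * (N * D)"
    if "es \<in> exponents N n" "coeff_at (power_product ys es) m \<noteq> 0" for es m v
  proof -
    have "exps_le (n * (N * D)) (power_product ys es)"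
      by (rule exps[OF that(1)])
    then show ?thesis
      using that(2) by (simp add: exps_le_def in_keys_iff)
  qed
  have "supp m \<notin> \<Delta>" if "m \<in> supp p" for m
  proof
    assume m: "supp m \<in> \<Delta>"
    have p: "coeff_at p m = (\<Sum>es\<in>exponents N n. c es * coeff_at (power_product ys es) m)"
      by (simp add: p_def lookup_sum coeff)
    show False
    proof (cases "m \<in> B")
      case True
      then show ?thesis
        using c(2) p that by (simp add: in_keys_iff)
    next
      case False
      then have "coeff_at (power_product ys es) m = 0" if "es \<in> exponents N n" for es
        using bound[OF that] m unfolding B_def bounded_exps_def by blast
      then show ?thesis
        using p that by (simp add: in_keys_iff)
    qed
  qed
  then have "p \<in> J 0"
    using J0 by (auto simp: face_ideal_def monomial_ideal_def)
  have "monomial 0 (c es) = (0 :: ('a, 'k) mpoly)" if "es \<in> exponents N n" for es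
  proof (rule chain_independent[where c = "\<lambda>es. monomial 0 (c es)", OF J step proper])
    show "monomial 0 (c es) = 0 \<or> monomial 0 (c es) dvd (1 :: ('a, 'k) mpoly)" for es
    proof (cases "c es = 0")
      case False
      then have "monomial 0 (c es) * monomial 0 (inverse (c es)) = (1 :: ('a, 'k) mpoly)"
        by (simp add: mult_single)
      then show ?thesis
        by (metis dvdI)
    qed simp
    show "(\<Sum>es\<in>exponents N (length ys). monomial 0 (c es) * power_product ys es) \<in> J 0"
      using \<open>p \<in> J 0\<close> by (simp add: p_def n_def)
  qed (use that n_def in auto)
  then show False
    using c(1) by (metis lookup_single_eq lookup_zero)
qed

section \<open>Monomial primes\<close>

text \<open>Lexicographic maxima: after maximizing coordinate \<open>v\<close> in both sets, a pair
  with the same sum at \<open>v\<close> must attain both maxima; induction handles the other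
  coordinates.\<close>

lemma unique_sum:
  fixes A B :: "('a \<Rightarrow> nat) set"
  assumes "finite G" "finite A" "finite B" "A \<noteq> {}" "B \<noteq> {}"
  shows "\<exists>a\<in>A. \<exists>b\<in>B. \<forall>a'\<in>A. \<forall>b'\<in>B. (\<forall>v\<in>G. a' v + b' v = a v + b v) \<longrightarrow>
    (\<forall>v\<in>G. a' v = a v \<and> b' v = b v)"
  using assms
proof (induction G arbitrary: A B rule: finite_induct)
  case empty
  then show ?case
    by auto
next
  case (insert v G)
  define s where "s = Max ((\<lambda>a. a v) ` A)"
  define t where "t = Max ((\<lambda>b. b v) ` B)"
  have "s \<in> (\<lambda>a. a v) ` A" "t \<in> (\<lambda>b. b v) ` B"
    unfolding s_def t_def using insert.prems by (auto intro!: Max_in)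
  then have s: "\<exists>a\<in>A. a v = s" and t: "\<exists>b\<in>B. b v = t"
    by auto
  have le: "\<And>a. a \<in> A \<Longrightarrow> a v \<le> s" "\<And>b. b \<in> B \<Longrightarrow> b v \<le> t"
    using insert.prems by (auto simp: s_def t_def)
  have "\<exists>a\<in>{a\<in>A. a v = s}. \<exists>b\<in>{b\<in>B. b v = t}. \<forall>a'\<in>{a\<in>A. a v = s}. \<forall>b'\<in>{b\<in>B. b v = t}.
      (\<forall>w\<in>G. a' w + b' w = a w + b w) \<longrightarrow> (\<forall>w\<in>G. a' w = a w \<and> b' w = b w)"
    by (rule insert.IH) (use insert.prems s t in auto)
  then obtain a b where ab: "a \<in> A" "a v = s" "b \<in> B" "b v = t"
    and u: "\<And>a' b'. \<lbrakk>a' \<in> A; a' v = s; b' \<in> B; b' v = t; \<forall>w\<in>G. a' w + b' w = a w + b w\<rbrakk> \<Longrightarrow>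
      \<forall>w\<in>G. a' w = a w \<and> b' w = b w"
    by blast
  have max: "a' v = s \<and> b' v = t" if "a' \<in> A" "b' \<in> B" "a' v + b' v = s + t" for a' b'
    using that le(1)[OF that(1)] le(2)[OF that(2)] by simp
  have "\<forall>w\<in>insert v G. a' w = a w \<and> b' w = b w"
    if "a' \<in> A" "b' \<in> B" "\<forall>w\<in>insert v G. a' w + b' w = a w + b w" for a' b'
  proof -
    have "a' v + b' v = a v + b v" and G: "\<forall>w\<in>G. a' w + b' w = a w + b w"
      using that(3) by blast+
    then have v: "a' v = s" "b' v = t"
      using max[OF that(1,2)] unfolding ab(2,4) by blast+
    show ?thesis
      using u[OF that(1) v(1) that(2) v(2) G] unfolding ball_simps(7) v ab(2,4) by blast
  qed
  then show ?case
    using ab(1,3) by blast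
qed

text \<open>A leading term argument restricted to monomials supported in \<open>G\<close>: by
  \<open>unique_sum\<close> some product of two such terms cannot be cancelled.\<close>

lemma monomial_prime:
  fixes p q :: "('a, 'k::field) mpoly"
  assumes G: "finite G" and pq: "p * q \<in> face_ideal (Pow G)"
  shows "p \<in> face_ideal (Pow G) \<or> q \<in> face_ideal (Pow G)"
proof (rule ccontr)
  assume neg: "\<not> ?thesis"
  define A where "A = {m \<in> supp p. supp m \<subseteq> G}"
  define B where "B = {m \<in> supp q. supp m \<subseteq> G}"
  have fin: "finite (coeff_at ` A)" "finite (coeff_at ` B)" and ne: "coeff_at ` A \<noteq> {}" "coeff_at ` B \<noteq> {}"
    using neg by (auto simp: face_ideal_def monomial_ideal_def A_def B_def)
  obtain \<alpha> \<beta> where \<alpha>\<beta>: "\<alpha> \<in> coeff_at ` A" "\<beta> \<in> coeff_at ` B" and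
    U: "\<forall>a'\<in>coeff_at ` A. \<forall>b'\<in>coeff_at ` B. (\<forall>v\<in>G. a' v + b' v = \<alpha> v + \<beta> v) \<longrightarrow>
      (\<forall>v\<in>G. a' v = \<alpha> v \<and> b' v = \<beta> v)"
    using unique_sum[OF G fin ne] by blast
  then obtain a b where a: "a \<in> A" and b: "b \<in> B" and ab: "\<alpha> = coeff_at a" "\<beta> = coeff_at b"
    by blast
  have u: "\<forall>v\<in>G. coeff_at a' v = coeff_at a v \<and> coeff_at b' v = coeff_at b v"
    if "a' \<in> A" "b' \<in> B" "\<forall>v\<in>G. coeff_at a' v + coeff_at b' v = coeff_at a v + coeff_at b v" for a' b'
    using U[rule_format, OF imageI imageI, OF that(1,2)] that(3) unfolding ab by blast
  have uniq: "m = a \<and> n = b" if mn: "m \<in> supp p" "n \<in> supp q" "m + n = a + b" for m n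
  proof -
    have "supp m \<union> supp n \<subseteq> G"
      using a b arg_cong[OF mn(3), of supp] by (auto simp: supp_add_nat A_def B_def)
    then have mn': "m \<in> A" "n \<in> B"
      using mn by (auto simp: A_def B_def)
    have "coeff_at m v + coeff_at n v = coeff_at a v + coeff_at b v" for v
      using arg_cong[OF mn(3), of "\<lambda>k. coeff_at k v"] by (simp add: lookup_add)
    then have eq: "coeff_at m v = coeff_at a v \<and> coeff_at n v = coeff_at b v" if "v \<in> G" for v
      using u[OF mn'] that by blast
    moreover have "coeff_at x v = 0" if "v \<notin> G" "x \<in> A \<union> B" for x v
      using that by (auto simp: A_def B_def in_keys_iff)
    ultimately have "coeff_at m v = coeff_at a v \<and> coeff_at n v = coeff_at b v" for v
      using a b mn' by (cases "v \<in> G") auto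
    then show ?thesis
      by (simp add: poly_mapping_eq_iff fun_eq_iff)
  qed
  have "coeff_at (p * q) (a + b) =
      (\<Sum>m\<in>supp p. \<Sum>n\<in>supp q. if n = b then if m = a then coeff_at p a * coeff_at q b else 0 else 0)"
    unfolding lookup_mpoly_mult using uniq by (intro sum.cong refl) auto
  also have "\<dots> = coeff_at p a * coeff_at q b"
    using a b by (simp add: A_def B_def)
  also have "\<dots> \<noteq> 0"
    using a b by (simp add: A_def B_def in_keys_iff)
  finally have "a + b \<in> supp (p * q)"
    by (simp add: in_keys_iff)
  moreover have "supp (a + b) \<subseteq> G"
    using a b by (simp add: supp_add_nat A_def B_def)
  ultimately show False
    using pq by (auto simp: face_ideal_def monomial_ideal_def)
qed

section \<open>Isolated pairs bound the depth\<close>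

definition total_degree :: "('a \<Rightarrow>\<^sub>0 nat) \<Rightarrow> nat" where
  "total_degree m = (\<Sum>v\<in>supp m. coeff_at m v)"

lemma total_degree_superset:
  "finite A \<Longrightarrow> supp m \<subseteq> A \<Longrightarrow> total_degree m = (\<Sum>v\<in>A. coeff_at m v)"
  unfolding total_degree_def by (rule sum.mono_neutral_left) (auto simp: in_keys_iff)

lemma total_degree_add: "total_degree (m + n) = total_degree m + total_degree n"
proof -
  let ?A = "supp m \<union> supp n"
  have "total_degree (m + n) = (\<Sum>v\<in>?A. coeff_at (m + n) v)"
    "total_degree m = (\<Sum>v\<in>?A. coeff_at m v)" "total_degree n = (\<Sum>v\<in>?A. coeff_at n v)"
    by (intro total_degree_superset; simp add: supp_add_nat)+
  then show ?thesis
    by (simp add: lookup_add sum.distrib)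
qed

definition min_degree :: "nat \<Rightarrow> ('a, 'k::comm_ring_1) mpoly \<Rightarrow> bool" where
  "min_degree k p \<longleftrightarrow> (\<forall>m\<in>supp p. k \<le> total_degree m)"

lemma min_degree_mult:
  assumes "min_degree k p" "min_degree l q"
  shows "min_degree (k + l) (p * q)"
  unfolding min_degree_def
proof
  fix m assume "m \<in> supp (p * q)"
  then obtain a b where "m = a + b" "a \<in> supp p" "b \<in> supp q"
    using keys_mult[of p q] by blast
  then show "k + l \<le> total_degree m"
    using assms by (simp add: min_degree_def total_degree_add add_mono)
qed

lemma min_degree_power: "min_degree 1 p \<Longrightarrow> min_degree n (p ^ n)"
proof (induction n)
  case 0
  then show ?case
    by (simp add: min_degree_def)
next
  case (Suc n)
  then show ?case
    using min_degree_mult[of 1 p n "p ^ n"] by simp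
qed

lemma homogeneous_min_degree: "homogeneous n p \<Longrightarrow> 0 < n \<Longrightarrow> min_degree 1 p"
  by (auto simp: homogeneous_def min_degree_def total_degree_def)

lemma linear_combinations_is_ideal:
  fixes a :: "'v \<Rightarrow> 'r::comm_ring_1"
  assumes I: "is_ideal I"
  shows "is_ideal {q. \<exists>f. q - (\<Sum>v\<in>V. f v * a v) \<in> I}"
proof (rule is_idealI)
  show "0 \<in> {q. \<exists>f. q - (\<Sum>v\<in>V. f v * a v) \<in> I}"
    using ideal_0[OF I] by (auto intro!: exI[of _ "\<lambda>_. 0"])
next
  fix p q
  assume "p \<in> {q. \<exists>f. q - (\<Sum>v\<in>V. f v * a v) \<in> I}" "q \<in> {q. \<exists>f. q - (\<Sum>v\<in>V. f v * a v) \<in> I}"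
  then obtain f g where "p - (\<Sum>v\<in>V. f v * a v) \<in> I" "q - (\<Sum>v\<in>V. g v * a v) \<in> I"
    by blast
  then have "p - (\<Sum>v\<in>V. f v * a v) + (q - (\<Sum>v\<in>V. g v * a v)) \<in> I"
    by (rule ideal_add[OF I])
  then have "(p + q) - (\<Sum>v\<in>V. (f v + g v) * a v) \<in> I"
    by (simp add: algebra_simps sum.distrib)
  then show "p + q \<in> {q. \<exists>f. q - (\<Sum>v\<in>V. f v * a v) \<in> I}"
    by (auto intro: exI[of _ "\<lambda>v. f v + g v"])
next
  fix p r assume "p \<in> {q. \<exists>f. q - (\<Sum>v\<in>V. f v * a v) \<in> I}"
  then obtain f where "p - (\<Sum>v\<in>V. f v * a v) \<in> I"
    by blast
  then have "r * (p - (\<Sum>v\<in>V. f v * a v)) \<in> I"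
    by (rule ideal_mult_left[OF I])
  then have "r * p - (\<Sum>v\<in>V. (r * f v) * a v) \<in> I"
    by (simp add: right_diff_distrib sum_distrib_left mult.assoc)
  then show "r * p \<in> {q. \<exists>f. q - (\<Sum>v\<in>V. f v * a v) \<in> I}"
    by (auto intro: exI[of _ "\<lambda>v. r * f v"])
qed

text \<open>A monomial of degree above \<open>card U\<close> either involves a variable outside
  \<open>U\<close> and lies in the face ideal, or has an exponent at least 2 by pigeonhole.\<close>

lemma min_degree_in_squares:
  fixes p :: "('a, 'k::field) mpoly"
  assumes U: "finite U" "\<Union>\<Delta> \<subseteq> U" and closed: "subset_closed \<Delta>"
    and p: "min_degree (Suc (card U)) p"
    and a: "\<And>v. v \<in> U \<Longrightarrow> a v = monomial (monomial v 2) 1"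
  shows "\<exists>f. p - (\<Sum>v\<in>U. f v * a v) \<in> face_ideal \<Delta>"
proof -
  let ?I = "face_ideal \<Delta> :: ('a, 'k) mpoly set"
  let ?J = "{q. \<exists>f. q - (\<Sum>v\<in>U. f v * a v) \<in> ?I}"
  have I: "is_ideal ?I"
    by (rule face_ideal_is_ideal[OF closed])
  have J: "is_ideal ?J"
    by (rule linear_combinations_is_ideal[OF I])
  have "monomial m c \<in> ?J" if m: "Suc (card U) \<le> total_degree m" for m and c :: 'k
  proof (cases "supp m \<subseteq> U")
    case False
    then have "monomial m c \<in> ?I"
      using U unfolding face_ideal_def by (intro monomial_in_monomial_ideal) blast
    then show ?thesis
      by (auto intro!: exI[of _ "\<lambda>_. 0"])
  next
    case True
    have "\<exists>v\<in>U. 2 \<le> coeff_at m v"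
    proof (rule ccontr)
      assume "\<not> ?thesis"
      then have "(\<Sum>v\<in>U. coeff_at m v) \<le> (\<Sum>v\<in>U. 1)"
        by (intro sum_mono) force
      then show False
        using m total_degree_superset[OF U(1) True] by simp
    qed
    then obtain w where w: "w \<in> U" "2 \<le> coeff_at m w"
      by blast
    then have "m = (m - monomial w 2) + monomial w 2"
      by (intro poly_mapping_eqI) (auto simp: lookup_add lookup_minus lookup_single when_def)
    then have "monomial m c = monomial (m - monomial w 2) c * a w"
      using a[OF w(1)] by (simp add: mult_single)
    also have "\<dots> = (\<Sum>v\<in>U. (if v = w then monomial (m - monomial w 2) c else 0) * a v)"
      using w(1) U(1) by (simp add: if_distrib[of "\<lambda>x. x * _"] cong: if_cong)
    finally show ?thesis
      using ideal_0[OF I]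
      by (auto intro!: exI[of _ "\<lambda>v. if v = w then monomial (m - monomial w 2) c else 0"])
  qed
  then have "p \<in> ?J"
    using monomial_ideal_subset[OF J, of "\<lambda>m. Suc (card U) \<le> total_degree m"] p
    unfolding min_degree_def monomial_ideal_def by blast
  then show ?thesis
    by blast
qed

text \<open>\<open>delta b\<close> squares to zero, and the unit covectors of \<open>ts\<close>
  already occur in the determinant, so only the part \<open>b'\<close> of the coefficients
  survives.\<close>

lemma delta_twisted_det_cochain:
  fixes b b' r :: "'v \<Rightarrow> 'r::comm_ring_1"
  shows "delta (\<lambda>v. b v + b' v + (\<Sum>t\<in>set ts. r t * (if v = t then 1 else 0))) (delta b (det_cochain ts)) L =
    delta b' (delta b (det_cochain ts)) L"
proof -
  let ?e = "\<lambda>t v. if v = t then 1 else (0::'r)"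
  have "delta (?e t) (delta b (det_cochain ts)) L = 0" if "t \<in> set ts" for t
  proof -
    have "delta (?e t) (det_cochain ts) = (\<lambda>_. 0::'r)"
      using delta_unit_det_cochain[OF that] by (intro ext)
    then show ?thesis
      using delta_anticommute[of "?e t" b "det_cochain ts" L] by (simp add: delta_zero)
  qed
  then show ?thesis
    by (simp add: delta_add_left delta_sum_left delta_delta)
qed

section \<open>The Koszul class of a disconnected link\<close>

context isolated_circuits
begin

definition core :: "'a set" where
  "core = U - (W\<^sub>1 \<union> W\<^sub>2)"

lemma card_U: "card U = card core + 2 * d"
proof -
  have "card (W\<^sub>1 \<union> W\<^sub>2) = 2 * d"
    using subsets circuits(3) by (simp add: card_Un_disjoint)
  moreover have "card U = card (W\<^sub>1 \<union> W\<^sub>2) + card core"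
    using subsets fin card_Diff_subset[of "W\<^sub>1 \<union> W\<^sub>2" U] card_mono[of U "W\<^sub>1 \<union> W\<^sub>2"]
    by (simp add: core_def)
  ultimately show ?thesis
    by simp
qed

lemma not_face: "v \<in> W\<^sub>1 \<Longrightarrow> w \<in> W\<^sub>2 \<Longrightarrow> insert v (insert w core) \<notin> cocomplex U C"
proof
  assume vw: "v \<in> W\<^sub>1" "w \<in> W\<^sub>2" and "insert v (insert w core) \<in> cocomplex U C"
  then obtain c where c: "c \<in> C" "insert v (insert w core) \<subseteq> U - c"
    by (auto simp: cocomplex_def)
  then have "c \<subseteq> W\<^sub>1 \<union> W\<^sub>2"
    using uniform[of c] by (auto simp: core_def)
  then show False
    using isolated[of c] c vw by blast
qed

lemma face: "v \<in> W\<^sub>1 \<union> W\<^sub>2 \<Longrightarrow> insert v core \<in> cocomplex U C"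
  using circuits subsets by (auto simp: cocomplex_def core_def)

text \<open>The link of \<open>core\<close> is disconnected. The class of local cohomology in degree
  \<open>card core + 1\<close> that this produces is represented by a Koszul cocycle over the squares of the
  variables.\<close>

theorem weakly_regular_length_less:
  fixes ys :: "('a, 'k::field) mpoly list"
  assumes wr: "weakly_regular (face_ideal (cocomplex U C)) ys"
    and hom: "\<And>y. y \<in> set ys \<Longrightarrow> min_degree 1 y"
  shows "length ys < card U - d"
proof (rule ccontr)
  assume "\<not> ?thesis"
  \<comment> \<open>Here \<open>d \<ge> 2\<close> enters: \<open>card U - d = card core + d\<close>,
    so a sequence of that length forces vanishing in degree \<open>card core + 1\<close>.\<close>
  then have len: "Suc (card core) < length ys"
    using card_U d by simp
  let ?I = "face_ideal (cocomplex U C) :: ('a, 'k) mpoly set"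
  let ?N = "Suc (card U)"
  have I: "is_ideal ?I"
    by (rule face_ideal_is_ideal[OF subset_closed_cocomplex])
  define a :: "'a \<Rightarrow> ('a, 'k) mpoly" where "a v = (if v \<in> U then monomial (monomial v 2) 1 else 0)" for v
  define b where "b v = (if v \<in> W\<^sub>1 then a v else 0)" for v
  define b' where "b' v = (if v \<in> W\<^sub>2 then a v else 0)" for v
  obtain ts where ts: "set ts = core" "distinct ts"
    using finite_distinct_list fin by (metis core_def finite_Diff)
  then have len_ts: "length ts = card core"
    using distinct_card by metis
  have a: "a = (\<lambda>v. b v + b' v + (\<Sum>t\<in>set ts. a t * (if v = t then 1 else 0)))"
  proof
    fix v
    have "(\<Sum>t\<in>set ts. a t * (if v = t then 1 else 0)) = (\<Sum>t\<in>set ts. if v = t then a t else 0)"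
      by (intro sum.cong) auto
    also have "\<dots> = (if v \<in> core then a v else 0)"
      unfolding ts(1)[symmetric] by simp
    finally have "(\<Sum>t\<in>set ts. a t * (if v = t then 1 else 0)) = (if v \<in> core then a v else 0)" .
    then show "a v = b v + b' v + (\<Sum>t\<in>set ts. a t * (if v = t then 1 else 0))"
      using circuits(3) subsets(1,2) by (auto simp: b_def b'_def core_def a_def)
  qed
  \<comment> \<open>This represents the function on the vertices of the link that is 1 on
    \<open>W\<^sub>1\<close> and 0 on \<open>W\<^sub>2\<close>. The factor
    \<open>sqfree core\<close> over the squares produces multidegree -1 on
    \<open>core\<close>.\<close>
  define z where "z L = sqfree core * delta b (det_cochain ts) L" for L
  have cocycle: "delta a z L \<in> ?I" for L
  proof -
    have "sqfree core * (b' v * b w) \<in> ?I" for v w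
    proof (cases "v \<in> W\<^sub>2 \<and> w \<in> W\<^sub>1")
      case True
      then have "sqfree core * (b' v * b w) =
          monomial (squarefree_exp core + (monomial v 2 + monomial w 2)) (1::'k)"
        using subsets by (auto simp: b_def b'_def a_def mult_single)
      moreover have "supp (squarefree_exp core + (monomial v 2 + monomial w 2)) = insert w (insert v core)"
        using fin by (auto simp: supp_add_nat supp_squarefree_exp core_def)
      ultimately show ?thesis
        using not_face True unfolding face_ideal_def by (auto intro!: monomial_in_monomial_ideal)
    next
      case False
      then show ?thesis
        using ideal_0[OF I] by (auto simp: b_def b'_def)
    qed
    then have "sqfree core * delta b' (delta b (det_cochain ts)) L \<in> ?I"
      by (rule delta_delta_coefficient_in_ideal[OF I])
    moreover have "delta a (delta b (det_cochain ts)) L = delta b' (delta b (det_cochain ts)) L"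
      by (subst a) (rule delta_twisted_det_cochain)
    ultimately show ?thesis
      unfolding z_def delta_scale by simp
  qed
  have "\<exists>u. \<forall>L\<in>lists U. length L = Suc (card core) \<longrightarrow> z L - delta a u L \<in> ?I"
  proof (rule koszul_acyclic[OF I])
    show "weakly_regular ?I (map (\<lambda>y. y ^ ?N) ys)"
      by (rule weakly_regular_power[OF I wr])
    show "\<exists>f. y - (\<Sum>v\<in>U. f v * a v) \<in> ?I" if y: "y \<in> set (map (\<lambda>y. y ^ ?N) ys)" for y
    proof (rule min_degree_in_squares[OF fin _ subset_closed_cocomplex])
      show "min_degree ?N y"
        using y min_degree_power[OF hom, of _ ?N] by auto
    qed (auto simp: cocomplex_def a_def)
    show "Suc (card core) < length (map (\<lambda>y. y ^ ?N) ys)"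
      using len by simp
    show "delta a z L \<in> ?I" for L
      by (rule cocycle)
  qed
  then obtain u where u: "\<And>L. \<lbrakk>L \<in> lists U; length L = Suc (card core)\<rbrakk> \<Longrightarrow> z L - delta a u L \<in> ?I"
    by blast
  \<comment> \<open>The left side does not involve \<open>v\<close>: a coboundary is constant on the
    vertices of the link, while \<open>z\<close> separates the two simplices.\<close>
  have "coeff_at (u ts) (squarefree_exp core) = (if v \<in> W\<^sub>1 then 1 else 0)" if v: "v \<in> W\<^sub>1 \<union> W\<^sub>2" for v
  proof -
    let ?m = "monomial v 2 + squarefree_exp core"
    have vU: "v \<in> U" "v \<notin> core"
      using v subsets by (auto simp: core_def)
    have "(\<lambda>M. det_cochain ts (v # M)) = (\<lambda>_. 0 :: ('a, 'k) mpoly)"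
      using vU ts by (intro ext det_cochain_notin) simp
    then have zv: "z (v # ts) = b v * sqfree core"
      by (simp add: z_def delta_zero det_cochain_self[OF ts(2)])
    have "supp ?m = insert v core"
      using fin by (simp add: supp_add_nat supp_squarefree_exp core_def)
    moreover have "z (v # ts) - delta a u (v # ts) \<in> ?I"
      using vU ts len_ts by (intro u) (auto simp: core_def)
    ultimately have "?m \<notin> supp (z (v # ts) - delta a u (v # ts))"
      using face[OF v] unfolding face_ideal_def monomial_ideal_def by fastforce
    then have "coeff_at (z (v # ts) - delta a u (v # ts)) ?m = 0"
      by (simp add: not_in_keys_iff_lookup_eq_zero)
    then have eq: "coeff_at (b v * sqfree core) ?m =
        coeff_at (a v * u ts) ?m - coeff_at (delta a (\<lambda>M. u (v # M)) ts) ?m"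
      by (simp add: zv lookup_minus)
    \<comment> \<open>The other terms of \<open>delta a u\<close> carry the square of a variable in
      \<open>core\<close>, whose exponent in \<open>?m\<close> is only 1.\<close>
    let ?P = "\<lambda>m. \<exists>t\<in>core. 2 \<le> coeff_at m t"
    have Q: "is_ideal (monomial_ideal ?P :: ('a, 'k) mpoly set)"
      by (rule monomial_ideal_is_ideal) (auto simp: lookup_add intro: trans_le_add2)
    have "1 * delta a (\<lambda>M. u (v # M)) ts \<in> monomial_ideal ?P"
    proof (rule delta_coefficient_in_ideal[OF Q])
      fix t assume "t \<in> set ts"
      then show "1 * a t \<in> monomial_ideal ?P"
        using ts(1) by (auto simp: a_def monomial_ideal_def intro!: bexI[of _ t])
    qed
    moreover have "coeff_at ?m t = 1" if "t \<in> core" for t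
      using that vU(2) fin
      by (auto simp: lookup_add lookup_single when_def lookup_squarefree_exp core_def)
    then have "\<not> ?P ?m"
      by simp
    ultimately have "?m \<notin> supp (delta a (\<lambda>M. u (v # M)) ts)"
      unfolding monomial_ideal_def by auto
    then have "coeff_at (delta a (\<lambda>M. u (v # M)) ts) ?m = 0"
      by (simp add: not_in_keys_iff_lookup_eq_zero)
    moreover have "coeff_at (a v * u ts) ?m = coeff_at (u ts) (squarefree_exp core)"
      using vU(1) by (simp add: a_def lookup_monomial_mult)
    moreover have "coeff_at (b v * sqfree core) ?m = (if v \<in> W\<^sub>1 then 1 else 0)"
      using vU(1) by (simp add: b_def a_def mult_single)
    ultimately show ?thesis
      using eq by simp
  qed
  moreover obtain v w where "v \<in> W\<^sub>1" "w \<in> W\<^sub>2"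
    using nonempty by blast
  moreover from this have "w \<notin> W\<^sub>1"
    using circuits(3) by blast
  ultimately show False
    by (metis UnCI zero_neq_one)
qed

end

section \<open>Quotient rings\<close>

lemma foldl_adjoin_is_ideal: "is_ideal I \<Longrightarrow> is_ideal (foldl adjoin I ys)"
  by (induction ys arbitrary: I) (simp_all add: adjoin_is_ideal)

lemma foldl_adjoin_subset: "is_ideal I \<Longrightarrow> I \<union> set ys \<subseteq> foldl adjoin I ys"
proof (induction ys arbitrary: I)
  case (Cons y ys)
  have "adjoin I y \<union> set ys \<subseteq> foldl adjoin (adjoin I y) ys"
    by (rule Cons.IH[OF adjoin_is_ideal[OF Cons.prems]])
  then show ?case
    using adjoin_subset[OF Cons.prems, of y] adjoin_self[OF Cons.prems, of y] by auto
qed simp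

lemma foldl_adjoin_least:
  assumes "is_ideal J" "I \<union> set ys \<subseteq> J"
  shows "foldl adjoin I ys \<subseteq> J"
  using assms(2)
proof (induction ys arbitrary: I)
  case (Cons y ys)
  have "adjoin I y \<subseteq> J"
    using Cons.prems by (intro adjoin_least[OF assms(1)]) auto
  then show ?case
    using Cons by simp
qed simp

lemma weakly_regular_iff_nth:
  "weakly_regular I ys \<longleftrightarrow>
     (\<forall>i<length ys. colon (foldl adjoin I (take i ys)) (ys ! i) \<subseteq> foldl adjoin I (take i ys))"
proof (induction ys arbitrary: I)
  case (Cons y ys)
  show ?case
    unfolding weakly_regular.simps Cons.IH by (simp add: All_less_Suc2)
qed simp

lemma ring_of_type_algebra_simps:
  "carrier ring_of_type_algebra = UNIV" "x \<otimes>\<^bsub>ring_of_type_algebra\<^esub> y = x * y"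
  "x \<oplus>\<^bsub>ring_of_type_algebra\<^esub> y = x + y" "\<zero>\<^bsub>ring_of_type_algebra\<^esub> = 0"
  "\<one>\<^bsub>ring_of_type_algebra\<^esub> = 1"
  for x y :: "'r::comm_ring_1"
  by (simp_all add: ring_of_type_algebra_def)

lemma ideal_type_algebra_iff:
  "ideal I ring_of_type_algebra \<longleftrightarrow> is_ideal I" for I :: "'r::comm_ring_1 set"
proof
  let ?S = "ring_of_type_algebra :: 'r ring"
  assume "ideal I ?S"
  then interpret ideal I ?S .
  note add = ideal.axioms(1)[OF ideal_axioms]
  show "is_ideal I"
    using additive_subgroup.zero_closed[OF add] additive_subgroup.a_closed[OF add] I_l_closed
    by (intro is_idealI) (auto simp: ring_of_type_algebra_simps)
next
  let ?S = "ring_of_type_algebra :: 'r ring"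
  assume I: "is_ideal I"
  have S: "ring ?S"
    by (rule ring_from_type_algebra)
  show "ideal I ?S"
  proof (rule idealI[OF S])
    show "subgroup I (add_monoid ?S)"
    proof
      fix x assume x: "x \<in> I"
      have "inv\<^bsub>add_monoid ?S\<^esub> x = - x"
        using abelian_group.minus_equality[OF ring.is_abelian_group[OF S], of "- x" x]
        by (simp add: ring_of_type_algebra_simps a_inv_def)
      then show "inv\<^bsub>add_monoid ?S\<^esub> x \<in> I"
        using ideal_uminus[OF I x] by simp
    qed (simp_all add: ring_of_type_algebra_simps ideal_0[OF I] ideal_add[OF I])
  qed (simp_all add: ring_of_type_algebra_simps ideal_mult_left[OF I] ideal_mult_right[OF I])
qed

text \<open>Elements of the quotient are cosets; statements about them are pulled back along
  \<open>proj\<close> to ideals containing \<open>I\<close>.\<close>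

locale quotient_by_ideal =
  fixes I :: "'r::comm_ring_1 set"
  assumes I: "is_ideal I"
begin

abbreviation "S \<equiv> ring_of_type_algebra :: 'r ring"
abbreviation "R \<equiv> S Quot I"

definition proj :: "'r \<Rightarrow> 'r set" where
  "proj x = I +>\<^bsub>S\<^esub> x"

lemma ideal_I: "ideal I S"
  using I by (simp add: ideal_type_algebra_iff)

lemma proj_hom: "proj \<in> ring_hom S R"
proof -
  have "(+>\<^bsub>S\<^esub>) I \<in> ring_hom S R"
    by (rule ideal.rcos_ring_hom[OF ideal_I])
  then show ?thesis
    by (simp add: proj_def[abs_def])
qed

lemma proj_simps: "proj x \<otimes>\<^bsub>R\<^esub> proj y = proj (x * y)" "proj x \<oplus>\<^bsub>R\<^esub> proj y = proj (x + y)"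
  "\<one>\<^bsub>R\<^esub> = proj 1"
  using ring_hom_mult[OF proj_hom, of x y] ring_hom_add[OF proj_hom, of x y] ring_hom_one[OF proj_hom]
  by (simp_all add: ring_of_type_algebra_simps)

lemma carrier_R: "carrier R = range proj"
  by (auto simp: FactRing_def A_RCOSETS_def' proj_def ring_of_type_algebra_simps)

lemma proj_eq_iff: "proj x = proj y \<longleftrightarrow> x - y \<in> I"
proof -
  have proj: "z \<in> proj x \<longleftrightarrow> z - x \<in> I" for x z
    by (auto simp: proj_def a_r_coset_def' ring_of_type_algebra_simps intro!: bexI[of _ "z - x"])
  show ?thesis
  proof
    assume "proj x = proj y"
    then show "x - y \<in> I"
      using proj[of x x] proj[of x y] ideal_0[OF I] by simp
  next
    assume xy: "x - y \<in> I"
    have "z - x \<in> I \<longleftrightarrow> z - y \<in> I" for z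
      by (rule ideal_cong[OF I]) (use ideal_uminus[OF I xy] in simp)
    then show "proj x = proj y"
      using proj by blast
  qed
qed

lemma ring_R: "ring R"
  by (rule ideal.quotient_is_ring[OF ideal_I])

lemma cring_R: "cring R"
  by (rule ideal.quotient_is_cring[OF ideal_I]) (rule cring_from_type_algebra)

lemma zero_R: "\<zero>\<^bsub>R\<^esub> = proj 0"
  using ring_hom_zero[OF proj_hom ring_from_type_algebra ring_R] by (simp add: ring_of_type_algebra_simps)

lemma vimage_ideal:
  assumes "ideal K R"
  shows "is_ideal (proj -` K)" "I \<subseteq> proj -` K"
proof -
  note add = ideal.axioms(1)[OF assms]
  have zero: "proj 0 \<in> K"
    using additive_subgroup.zero_closed[OF add] by (simp add: zero_R)
  show "is_ideal (proj -` K)"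
  proof (rule is_idealI)
    show "0 \<in> proj -` K"
      using zero by simp
    show "a + b \<in> proj -` K" if "a \<in> proj -` K" "b \<in> proj -` K" for a b
      using additive_subgroup.a_closed[OF add, of "proj a" "proj b"] that by (simp add: proj_simps)
    show "r * a \<in> proj -` K" if "a \<in> proj -` K" for a r
      using ideal.I_l_closed[OF assms, of "proj a" "proj r"] that by (simp add: proj_simps carrier_R)
  qed
  have "proj i = proj 0" if "i \<in> I" for i
    using that by (simp add: proj_eq_iff)
  then show "I \<subseteq> proj -` K"
    using zero by auto
qed

lemma image_ideal: "is_ideal J \<Longrightarrow> ideal (proj ` J) R"
  unfolding proj_def[abs_def]
  by (rule ring.ring_ideal_imp_quot_ideal[OF ring_from_type_algebra ideal_I])
    (simp add: ideal_type_algebra_iff)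

lemma proj_in_image_iff:
  assumes "is_ideal J" "I \<subseteq> J"
  shows "proj x \<in> proj ` J \<longleftrightarrow> x \<in> J"
proof
  assume "proj x \<in> proj ` J"
  then obtain y where "y \<in> J" "x - y \<in> J"
    using assms(2) by (auto simp: proj_eq_iff)
  then show "x \<in> J"
    using ideal_cong[OF assms(1)] by blast
qed blast

lemma proj_in_genideal_iff:
  "proj x \<in> genideal R (proj ` set ys) \<longleftrightarrow> x \<in> foldl adjoin I ys"
proof
  let ?J = "foldl adjoin I ys"
  have J: "is_ideal ?J" "I \<subseteq> ?J" "set ys \<subseteq> ?J"
    using foldl_adjoin_is_ideal[OF I] foldl_adjoin_subset[OF I] by blast+
  assume "proj x \<in> genideal R (proj ` set ys)"
  then have "proj x \<in> proj ` ?J"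
    using image_ideal[OF J(1)] J(3) unfolding genideal_def by blast
  then show "x \<in> ?J"
    using proj_in_image_iff[OF J(1,2)] by blast
next
  assume x: "x \<in> foldl adjoin I ys"
  have "proj x \<in> K" if K: "ideal K R" "proj ` set ys \<subseteq> K" for K
  proof -
    have "foldl adjoin I ys \<subseteq> proj -` K"
      using vimage_ideal[OF K(1)] K(2) by (intro foldl_adjoin_least) auto
    then show ?thesis
      using x by blast
  qed
  then show "proj x \<in> genideal R (proj ` set ys)"
    unfolding genideal_def by blast
qed

lemma regular_sequence_iff:
  "regular_sequence R (map proj ys) \<longleftrightarrow> weakly_regular I ys \<and> 1 \<notin> foldl adjoin I ys"
proof -
  have "genideal R (proj ` set ys) \<subseteq> carrier R"
    using ring.genideal_ideal[OF ring_R, of "proj ` set ys"] ideal.Icarr by (metis carrier_R image_subset_iff rangeI subsetI)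
  moreover have "carrier R \<subseteq> genideal R (proj ` set ys) \<longleftrightarrow> 1 \<in> foldl adjoin I ys"
    using ideal_eq_UNIV[OF foldl_adjoin_is_ideal[OF I], of ys] proj_in_genideal_iff[of _ ys]
    unfolding carrier_R by auto
  ultimately have proper: "genideal R (proj ` set ys) \<noteq> carrier R \<longleftrightarrow> 1 \<notin> foldl adjoin I ys"
    by blast
  have "(\<forall>a\<in>carrier R. map proj ys ! i \<otimes>\<^bsub>R\<^esub> a \<in> genideal R (set (take i (map proj ys))) \<longrightarrow>
        a \<in> genideal R (set (take i (map proj ys)))) \<longleftrightarrow>
      colon (foldl adjoin I (take i ys)) (ys ! i) \<subseteq> foldl adjoin I (take i ys)"
    if "i < length ys" for i
    using that
    by (auto simp: carrier_R take_map proj_simps proj_in_genideal_iff colon_def)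
  then show ?thesis
    unfolding regular_sequence_def weakly_regular_iff_nth
    using proper by (auto simp: carrier_R)
qed

lemma primeideal_vimage:
  assumes "primeideal P R"
  shows "is_ideal (proj -` P)" "I \<subseteq> proj -` P" "1 \<notin> proj -` P"
    "\<And>a b. a * b \<in> proj -` P \<Longrightarrow> a \<in> proj -` P \<or> b \<in> proj -` P"
proof -
  interpret primeideal P R
    by fact
  show "is_ideal (proj -` P)" "I \<subseteq> proj -` P"
    using vimage_ideal[OF ideal_axioms] by auto
  show "1 \<notin> proj -` P"
    using one_imp_carrier I_notcarr by (auto simp: proj_simps)
  show "a \<in> proj -` P \<or> b \<in> proj -` P" if "a * b \<in> proj -` P" for a b
    using I_prime[of "proj a" "proj b"] that by (simp add: proj_simps carrier_R)
qed

lemma primeideal_image: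
  assumes J: "is_ideal J" "I \<subseteq> J" "1 \<notin> J" "\<And>a b. a * b \<in> J \<Longrightarrow> a \<in> J \<or> b \<in> J"
  shows "primeideal (proj ` J) R"
proof (rule primeidealI[OF image_ideal[OF J(1)] cring_R])
  show "carrier R \<noteq> proj ` J"
    using proj_in_image_iff[OF J(1,2), of 1] J(3) by (auto simp: carrier_R)
  fix a b assume "a \<in> carrier R" "b \<in> carrier R" and ab: "a \<otimes>\<^bsub>R\<^esub> b \<in> proj ` J"
  then obtain x y where xy: "a = proj x" "b = proj y"
    by (auto simp: carrier_R)
  then have "x * y \<in> J"
    using ab proj_in_image_iff[OF J(1,2)] by (simp add: proj_simps)
  then show "a \<in> proj ` J \<or> b \<in> proj ` J"
    using J(4) xy by blast
qed

end

section \<open>Stanley--Reisner rings\<close>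

text \<open>A monomial whose support is a nonface is divisible by the generator belonging to that
  support.\<close>

lemma stanley_reisner_ideal_eq:
  assumes "subset_closed \<Delta>"
  shows "stanley_reisner_ideal \<Delta> = (face_ideal \<Delta> :: ('a, 'k::field) mpoly set)"
proof -
  let ?G = "{\<Prod>v\<in>\<tau>. poly_var v | \<tau>. finite \<tau> \<and> \<tau> \<notin> \<Delta>} :: ('a, 'k) mpoly set"
  have I: "is_ideal (face_ideal \<Delta> :: ('a, 'k) mpoly set)"
    by (rule face_ideal_is_ideal[OF assms])
  have G: "?G \<subseteq> face_ideal \<Delta>"
  proof
    fix p assume "p \<in> ?G"
    then obtain \<tau> where "p = (\<Prod>v\<in>\<tau>. poly_var v)" "finite \<tau>" "\<tau> \<notin> \<Delta>"
      by blast
    then show "p \<in> face_ideal \<Delta>"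
      by (simp add: prod_poly_var sqfree_in_face_ideal)
  qed
  have least: "face_ideal \<Delta> \<subseteq> J" if J: "is_ideal J" "?G \<subseteq> J" for J :: "('a, 'k) mpoly set"
    unfolding face_ideal_def
  proof (rule monomial_ideal_subset[OF J(1)])
    fix m :: "'a \<Rightarrow>\<^sub>0 nat" and c :: 'k assume m: "supp m \<notin> \<Delta>"
    define s where "s = squarefree_exp (supp m)"
    obtain k where "m = s + k"
      using squarefree_exp_divides_iff[of "supp m" m] by (auto simp: s_def)
    then have "monomial m c = monomial s 1 * monomial k c"
      by (simp add: mult_single)
    moreover have "sqfree (supp m) \<in> J"
    proof -
      have "(\<Prod>v\<in>supp m. poly_var v) \<in> ?G"
        using m finite_keys[of m] by blast
      then show ?thesis
        using J(2) prod_poly_var[OF finite_keys[of m], where 'k = 'k] by auto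
    qed
    ultimately show "monomial m c \<in> J"
      using ideal_mult_right[OF J(1)] by (simp add: s_def)
  qed
  show ?thesis
    unfolding stanley_reisner_ideal_def genideal_def ideal_type_algebra_iff
    using I G least by blast
qed

locale stanley_reisner =
  fixes \<Delta> :: "'a set set" and k :: "'k::field itself"
  assumes closed: "subset_closed \<Delta>" and fin: "finite \<Delta>"
begin

abbreviation "SR_ideal \<equiv> face_ideal \<Delta> :: ('a, 'k) mpoly set"

sublocale quotient_by_ideal SR_ideal
  by unfold_locales (rule face_ideal_is_ideal[OF closed])

lemma SR_ring: "stanley_reisner_ring \<Delta> = R"
  by (simp add: stanley_reisner_ring_def stanley_reisner_ideal_eq[OF closed])

lemma sr_class: "sr_class \<Delta> p = proj p"
  by (simp add: sr_class_def proj_def stanley_reisner_ideal_eq[OF closed])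

lemma depth_eq:
  "stanley_reisner_depth k \<Delta> = Sup {enat (length ps) | ps :: ('a, 'k) mpoly list.
     weakly_regular SR_ideal ps \<and> 1 \<notin> foldl adjoin SR_ideal ps \<and>
     (\<forall>p\<in>set ps. \<exists>n>0. homogeneous n p)}"
proof -
  let ?h = "\<lambda>p::('a, 'k) mpoly. \<exists>n>0. homogeneous n p"
  have lists: "(\<forall>x\<in>set xs. \<exists>n p. 0 < n \<and> homogeneous n p \<and> x = proj p) \<longleftrightarrow>
      (\<exists>ps. xs = map proj ps \<and> (\<forall>p\<in>set ps. ?h p))" for xs
  proof
    assume "\<forall>x\<in>set xs. \<exists>n p. 0 < n \<and> homogeneous n p \<and> x = proj p"
    then have "xs \<in> lists (proj ` Collect ?h)"
      unfolding in_lists_conv_set by blast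
    then show "\<exists>ps. xs = map proj ps \<and> (\<forall>p\<in>set ps. ?h p)"
      by (auto simp: lists_image)
  qed (clarsimp, blast)
  have "{enat (length xs) | xs. regular_sequence R xs \<and>
      (\<forall>x\<in>set xs. \<exists>n p. 0 < n \<and> homogeneous n p \<and> x = proj p)} =
    {enat (length ps) | ps. regular_sequence R (map proj ps) \<and> (\<forall>p\<in>set ps. ?h p)}"
    unfolding lists by (intro Collect_cong) (metis length_map)
  then show ?thesis
    by (simp add: stanley_reisner_depth_def SR_ring sr_class regular_sequence_iff conj_assoc)
qed

context
  fixes d :: nat
  assumes dim: "\<And>\<sigma>. \<sigma> \<in> \<Delta> \<Longrightarrow> finite \<sigma> \<and> card \<sigma> \<le> d"
begin

lemma regular_length_le:
  assumes "weakly_regular SR_ideal ps" "1 \<notin> foldl adjoin SR_ideal ps"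
  shows "length ps \<le> d"
proof (rule chain_length_le[OF fin dim, where J = "\<lambda>i. foldl adjoin SR_ideal (take i ps)"])
  show "is_ideal (foldl adjoin SR_ideal (take i ps))" for i
    by (rule foldl_adjoin_is_ideal[OF I])
  show "foldl adjoin SR_ideal (take i ps) \<subseteq> foldl adjoin SR_ideal (take (Suc i) ps) \<and>
      ps ! i \<in> foldl adjoin SR_ideal (take (Suc i) ps) \<and>
      colon (foldl adjoin SR_ideal (take i ps)) (ps ! i) \<subseteq> foldl adjoin SR_ideal (take i ps)"
    if "i < length ps" for i
    using that assms(1) adjoin_subset[OF foldl_adjoin_is_ideal[OF I]] adjoin_self[OF foldl_adjoin_is_ideal[OF I]]
    by (simp add: take_Suc_conv_app_nth weakly_regular_iff_nth)
qed (use assms(2) in auto)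

text \<open>An element picked from each strict step of a chain of primes gives the sequence;
  primality is the colon condition of \<open>chain_length_le\<close>.\<close>

lemma krull_dim_le: "krull_dim R \<le> enat d"
  unfolding krull_dim_def
proof (rule Sup_least, clarify)
  fix n P assume P: "\<forall>i\<le>n. primeideal (P i) R" "\<forall>i<n. P i \<subset> P (Suc i)"
  have "\<exists>y. proj y \<in> P (Suc i) - P i" if i: "i < n" for i
  proof -
    obtain x where "x \<in> P (Suc i)" "x \<notin> P i"
      using P(2) i by blast
    moreover have "P (Suc i) \<subseteq> carrier R"
      using P(1) i ideal.Icarr primeideal.axioms(1) by (metis Suc_leI subsetI)
    ultimately show ?thesis
      by (auto simp: carrier_R)
  qed
  then obtain y where y: "\<And>i. i < n \<Longrightarrow> proj (y i) \<in> P (Suc i) - P i"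
    by metis
  have "length (map y [0..<n]) \<le> d"
  proof (rule chain_length_le[OF fin dim, where J = "\<lambda>i. proj -` P i"])
    show "is_ideal (proj -` P i)" if "i \<le> length (map y [0..<n])" for i
      using that P(1) by (intro primeideal_vimage) simp
    show "proj -` P i \<subseteq> proj -` P (Suc i) \<and> map y [0..<n] ! i \<in> proj -` P (Suc i) \<and>
        colon (proj -` P i) (map y [0..<n] ! i) \<subseteq> proj -` P i"
      if "i < length (map y [0..<n])" for i
      using that P y[of i] primeideal_vimage(4)[of "P i" "y i"] by (auto simp: colon_def)
    show "1 \<notin> proj -` P (length (map y [0..<n]))"
      using P(1) primeideal_vimage(3)[of "P n"] by simp
    show "SR_ideal \<subseteq> proj -` P 0"
      using P(1) by (intro primeideal_vimage) simp
  qed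
  then show "enat n \<le> enat d"
    by simp
qed

text \<open>Removing the vertices of \<open>F\<close> one at a time gives a chain of monomial
  primes, the face ideals of ever smaller simplices.\<close>

lemma krull_dim_ge:
  assumes F: "F \<in> \<Delta>"
  shows "enat (card F) \<le> krull_dim R"
proof -
  obtain fs where fs: "set fs = F" "distinct fs"
    using finite_distinct_list dim[OF F] by metis
  have len: "length fs = card F"
    using fs distinct_card by metis
  define G where "G i = set (drop i fs)" for i
  define Q where "Q i = (face_ideal (Pow (G i)) :: ('a, 'k) mpoly set)" for i
  have Q: "is_ideal (Q i)" for i
    unfolding Q_def by (rule face_ideal_is_ideal) (auto simp: subset_closed_def)
  have sub: "SR_ideal \<subseteq> Q i" for i
  proof -
    have "Pow (G i) \<subseteq> \<Delta>"
      using F fs(1) closed set_drop_subset[of i fs] unfolding G_def subset_closed_def by blast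
    then show ?thesis
      by (auto simp: Q_def face_ideal_def monomial_ideal_def)
  qed
  have "primeideal (proj ` Q i) R" for i
  proof (rule primeideal_image[OF Q sub])
    show "1 \<notin> Q i"
      by (simp add: Q_def face_ideal_def monomial_ideal_def)
    show "a \<in> Q i \<or> b \<in> Q i" if "a * b \<in> Q i" for a b
      using that unfolding Q_def by (intro monomial_prime) (auto simp: G_def)
  qed
  moreover have "proj ` Q i \<subset> proj ` Q (Suc i)" if i: "i < card F" for i
  proof -
    have drop: "drop i fs = fs ! i # drop (Suc i) fs"
      using i len by (simp add: Cons_nth_drop_Suc)
    then have G: "G i = insert (fs ! i) (G (Suc i))" "fs ! i \<notin> G (Suc i)"
      using distinct_drop[OF fs(2), of i] unfolding G_def drop by simp_all
    have "Q i \<subseteq> Q (Suc i)"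
      using G by (auto simp: Q_def face_ideal_def monomial_ideal_def)
    moreover have "sqfree {fs ! i} \<in> Q (Suc i)"
      using G(2) unfolding Q_def by (intro sqfree_in_face_ideal) auto
    moreover have "sqfree {fs ! i} \<notin> Q i"
      using G(1) by (simp add: Q_def face_ideal_def monomial_ideal_def supp_squarefree_exp)
    ultimately show ?thesis
      using proj_in_image_iff[OF Q sub] by (metis image_mono psubsetI)
  qed
  ultimately have "\<exists>P. (\<forall>i\<le>card F. primeideal (P i) R) \<and> (\<forall>i<card F. P i \<subset> P (Suc i))"
    by (intro exI[of _ "\<lambda>i. proj ` Q i"]) simp
  then show ?thesis
    unfolding krull_dim_def by (intro Sup_upper CollectI exI[of _ "card F"] conjI refl)
qed

end

end

section \<open>Cohen--Macaulayness and gap-freeness\<close>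

lemma homogeneous_elementary_symmetric:
  assumes "finite V"
  shows "homogeneous i (elementary_symmetric V i :: ('a, 'k::field) mpoly)"
  unfolding homogeneous_def
proof
  fix m assume "m \<in> supp (elementary_symmetric V i :: ('a, 'k) mpoly)"
  then obtain A where A: "A \<subseteq> V" "card A = i" "m = squarefree_exp A"
    using keys_sum[of "\<lambda>A. sqfree A :: ('a, 'k) mpoly" "{A. A \<subseteq> V \<and> card A = i}"]
    unfolding elementary_symmetric_def by auto
  moreover have "finite A"
    using A(1) assms finite_subset by blast
  ultimately show "(\<Sum>v\<in>supp m. coeff_at m v) = i"
    by (simp add: supp_squarefree_exp lookup_squarefree_exp)
qed

context stanley_reisner
begin

lemma depth_le:
  assumes "\<And>ps :: ('a, 'k) mpoly list. \<lbrakk>weakly_regular SR_ideal ps; 1 \<notin> foldl adjoin SR_ideal ps;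
    \<forall>p\<in>set ps. min_degree 1 p\<rbrakk> \<Longrightarrow> length ps \<le> n"
  shows "stanley_reisner_depth k \<Delta> \<le> enat n"
  unfolding depth_eq
proof (rule Sup_least, clarify)
  fix ps :: "('a, 'k) mpoly list"
  assume "weakly_regular SR_ideal ps" "1 \<notin> foldl adjoin SR_ideal ps"
    and hom: "\<forall>p\<in>set ps. \<exists>n>0. homogeneous n p"
  moreover have "\<forall>p\<in>set ps. min_degree 1 p"
    using hom homogeneous_min_degree by blast
  ultimately show "enat (length ps) \<le> enat n"
    using assms by simp
qed

text \<open>With \<open>{} \<in> \<Delta>\<close>, the face ideal and all forms of positive degree
  lie in the irrelevant ideal, which gives properness.\<close>

lemma depth_ge:
  assumes "{} \<in> \<Delta>" "weakly_regular SR_ideal ps" "\<And>p. p \<in> set ps \<Longrightarrow> \<exists>n>0. homogeneous n p"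
  shows "enat (length ps) \<le> stanley_reisner_depth k \<Delta>"
proof -
  let ?M = "monomial_ideal (\<lambda>m. m \<noteq> 0) :: ('a, 'k) mpoly set"
  have M: "is_ideal ?M"
  proof (rule monomial_ideal_is_ideal)
    fix m n :: "'a \<Rightarrow>\<^sub>0 nat" assume "m \<noteq> 0"
    then have "supp (n + m) \<noteq> {}"
      by (simp add: supp_add_nat)
    then show "n + m \<noteq> 0"
      by auto
  qed
  have "SR_ideal \<subseteq> ?M"
    using assms(1) by (auto simp: face_ideal_def monomial_ideal_def)
  moreover have "set ps \<subseteq> ?M"
    using assms(3) by (fastforce simp: homogeneous_def monomial_ideal_def)
  ultimately have "foldl adjoin SR_ideal ps \<subseteq> ?M"
    by (intro foldl_adjoin_least[OF M]) simp
  moreover have "1 \<notin> ?M"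
    by (simp add: monomial_ideal_def)
  ultimately show ?thesis
    unfolding depth_eq using assms(2,3) by (intro Sup_upper) blast
qed

end

section \<open>Depth and dimension for uniform clutters\<close>

locale uniform_clutter =
  fixes U :: "'a set" and C :: "'a set set" and d :: nat and k :: "'k::field itself"
  assumes finU: "finite U" and uniformC: "\<And>c. c \<in> C \<Longrightarrow> c \<subseteq> U \<and> card c = d"
begin

sublocale stanley_reisner "cocomplex U C" k
proof
  show "finite (cocomplex U C)"
    using finU by (rule_tac finite_subset[of _ "Pow U"]) (auto simp: cocomplex_def)
qed (rule subset_closed_cocomplex)

lemma face_card:
  assumes "\<sigma> \<in> cocomplex U C"
  shows "finite \<sigma> \<and> card \<sigma> \<le> card U - d"
proof -
  obtain c where c: "c \<in> C" "\<sigma> \<subseteq> U - c"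
    using assms by (auto simp: cocomplex_def)
  moreover have "card (U - c) = card U - d"
    using uniformC[OF c(1)] finU finite_subset by (metis card_Diff_subset)
  ultimately show ?thesis
    using finU card_mono[of "U - c" \<sigma>] finite_subset[of \<sigma> "U - c"] by simp
qed

lemma krull_dim_eq:
  assumes "c \<in> C"
  shows "krull_dim R = enat (card U - d)"
proof (rule antisym)
  have "U - c \<in> cocomplex U C"
    using assms by (auto simp: cocomplex_def)
  moreover have "card (U - c) = card U - d"
    using uniformC[OF assms] finU finite_subset by (metis card_Diff_subset)
  ultimately show "enat (card U - d) \<le> krull_dim R"
    using krull_dim_ge[OF face_card] by metis
qed (rule krull_dim_le[OF face_card])

lemma splittable_imp_cohen_macaulay:
  assumes "splittable d C"
  shows "cohen_macaulay k (cocomplex U C)"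
proof (cases "C = {}")
  case True
  then have empty: "cocomplex U C = {}"
    by (simp add: cocomplex_def)
  have "stanley_reisner_depth k (cocomplex U C) \<le> enat 0"
    using regular_length_le[of 0] empty by (intro depth_le) auto
  moreover have "krull_dim R \<le> enat 0"
    using empty by (intro krull_dim_le) auto
  ultimately show ?thesis
    by (simp add: cohen_macaulay_def SR_ring zero_enat_def[symmetric])
next
  case False
  then obtain c where c: "c \<in> C"
    by blast
  let ?ps = "symmetric_sequence U (card U - d) :: ('a, 'k) mpoly list"
  have "enat (length ?ps) \<le> stanley_reisner_depth k (cocomplex U C)"
  proof (rule depth_ge)
    show "{} \<in> cocomplex U C"
      using c by (auto simp: cocomplex_def)
    show "weakly_regular SR_ideal ?ps"
      using uniformC by (intro splittable_imp_weakly_regular assms finU) auto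
    show "\<exists>n>0. homogeneous n p" if p: "p \<in> set ?ps" for p
    proof -
      obtain i where i: "i \<in> set (rev [1..<Suc (card U - d)])" "p = elementary_symmetric U i"
        using p unfolding symmetric_sequence_def set_map by blast
      then have "0 < i"
        by auto
      then show ?thesis
        using homogeneous_elementary_symmetric[OF finU] i(2) by blast
    qed
  qed
  moreover have "stanley_reisner_depth k (cocomplex U C) \<le> enat (card U - d)"
    using regular_length_le[OF face_card] by (intro depth_le)
  ultimately show ?thesis
    using krull_dim_eq[OF c] by (simp add: cohen_macaulay_def SR_ring length_symmetric_sequence)
qed

lemma isolated_pair_imp_not_cohen_macaulay:
  assumes "2 \<le> d" "isolated_pair C W\<^sub>1 W\<^sub>2"
  shows "\<not> cohen_macaulay k (cocomplex U C)"
proof -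
  interpret isolated_circuits U C d W\<^sub>1 W\<^sub>2
    using finU uniformC assms by unfold_locales
  have "length ps \<le> card U - d - 1"
    if "weakly_regular SR_ideal ps" "\<forall>p\<in>set ps. min_degree 1 p" for ps :: "('a, 'k) mpoly list"
    using weakly_regular_length_less[OF that(1)] that(2) by fastforce
  then have "stanley_reisner_depth k (cocomplex U C) \<le> enat (card U - d - 1)"
    by (intro depth_le)
  \<comment> \<open>Subtraction is truncated, so a gap between depth and dimension requires positive
    dimension.\<close>
  moreover have "card U - d \<noteq> 0"
    using card_U d by simp
  ultimately show ?thesis
    using krull_dim_eq[OF circuits(1)] by (auto simp: cohen_macaulay_def SR_ring)
qed

end

theorem theorem4p7:
  fixes V :: "'a set" and E :: "'a set set" and r :: nat
  assumes "cograph V E" and "2 \<le> r"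
  shows "(vertex_decomposable (Sigma_complex r V E) \<longleftrightarrow> shellable (Sigma_complex r V E)) \<and>
         (shellable (Sigma_complex r V E) \<longleftrightarrow>
            cohen_macaulay TYPE('k::field) (Sigma_complex r V E)) \<and>
         (cohen_macaulay TYPE('k) (Sigma_complex r V E) \<longleftrightarrow> gap_free r V E) \<and>
         (gap_free r V E \<longleftrightarrow> co_chordal r V (Con r V E))"
proof -
  let ?C = "Con r V E"
  have uniform: "c \<subseteq> V \<and> card c = r" if "c \<in> ?C" for c
    using that by (simp add: Con_def)
  have V: "finite V"
    by (rule cograph_finite[OF assms(1)])
  interpret uniform_clutter V ?C r "TYPE('k)"
    using V uniform by unfold_locales
  show ?thesis
  \<comment> \<open>All five properties hold in the first case and all fail in the second, which
    gives the equivalences at once.\<close>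
  proof (cases "gap_free r V E")
    case True
    then have split: "splittable r ?C"
      using gap_free_imp_splittable assms by blast
    have "\<Union>?C \<subseteq> V"
      using uniform by blast
    then show ?thesis
      using True splittable_imp_vertex_decomposable[OF split V] splittable_imp_shellable[OF split V]
        splittable_imp_co_chordal[OF split V] splittable_imp_cohen_macaulay[OF split] assms(2)
      by (simp add: Sigma_complex_eq_cocomplex)
  next
    case False
    then obtain W\<^sub>1 W\<^sub>2 where pair: "isolated_pair ?C W\<^sub>1 W\<^sub>2"
      by (rule not_gap_free_imp_isolated_pair)
    interpret isolated_circuits V ?C r W\<^sub>1 W\<^sub>2
      using V uniform assms(2) pair by unfold_locales
    show ?thesis
      using False not_vertex_decomposable not_shellable not_co_chordal
        isolated_pair_imp_not_cohen_macaulay[OF assms(2) pair]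
      by (simp add: Sigma_complex_eq_cocomplex)
  qed
qed

end
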